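(* Let $\mathcal X\subset\mathbb R^n$, $\mathcal Y\subset\mathbb R^m$ be nonempty convex compact sets given by essentially strictly feasible $\mathcal K$-representations $$\mathcal X=\{x:\exists\xi: Ax+B\xi\leq_{\mathbf K_{\mathcal X}}c\},\qquad \mathcal Y=\{y:\exists\eta: Cy+D\eta\leq_{\mathbf K_{\mathcal Y}}e\}\qquad[\mathbf K_{\mathcal X},\mathbf K_{\mathcal Y}\in\mathcal K],$$ and assume that the conic constraint $D^T\lambda=0$, $\lambda\geq_{\mathbf K_{\mathcal Y}^*}0$ in variable $\lambda$ is essentially strictly feasible. Let $\psi:\mathcal X\times\mathcal Y\to\mathbb R$ be a continuous convex-concave function given by an essentially strictly feasible $\mathcal K$-representation $$\psi(x,y)=\inf_{f,t,u}\{f^Ty+t: Pf+t\Pi+Qu+Rx\leq_{\mathbf K}s\}\quad\forall x\in\mathcal X,\ y\in\mathcal Y\qquad[\mathbf K\in\mathcal K].$$ Consider the Fenchel conjugate of $\psi$, the function $$\psi_*(p,q)=\max_{x\in\mathcal X}\min_{y\in\mathcal Y}[p^Tx+q^Ty-\psi(x,y)]:\ \mathbb R^n\times\mathbb R^m\to\mathbb R.$$ Then $\psi_*$ is a well-defined continuous function, convex in $p$ and concave in $q$, and is $\mathcal K$-representable on $\mathbb R^n\times\mathbb R^m$, with the $\mathcal K$-representation $$\psi_*(p,q)=\min_{\beta,\tau,\alpha,\delta,\epsilon}\left\{\beta^Tq+\tau:\ \begin{array}{l}\delta\geq_{\mathbf K^*}0,\ \epsilon\geq_{\mathbf K_{\mathcal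 X}^*}0,\ \tau=s^T\delta+c^T\epsilon,\\ R^T\delta+A^T\epsilon=p,\ B^T\epsilon=0,\ P^T\delta+\beta=0,\\ \Pi^T\delta=-1,\ Q^T\delta=0,\ D\alpha-C\beta+e\geq_{\mathbf K_{\mathcal Y}}0\end{array}\right\}\quad\forall p\in\mathbb R^n,\ q\in\mathbb R^m.$$
   Context: $\mathcal K$ is a fixed family of regular cones (closed, convex, pointed, with nonempty interior) in Euclidean spaces which contains $\mathbb R_+$, is closed under finite direct products, and is closed under passing from a cone $\mathbf K$ to its dual $\mathbf K^*$. $a\leq_{\mathbf K}b$ (or $b\geq_{\mathbf K}a$) means $b-a\in\mathbf K$. Finite systems of $\mathcal K$-conic constraints, linear equalities and nonstrict linear inequalities are (equivalent to) a single $\mathcal K$-conic constraint. A conic constraint $Ax\leq_{\mathbf K}a$ is essentially strictly feasible if $\mathbf K=\mathbb R^m_+\times\mathbf L$ with regular $\mathbf L$ (either factor may be absent), so that it reads $Px\leq p$, $Qx\leq_{\mathbf L}q$, and there is $\bar x$ with $P\bar x\leq p$ and $q-Q\bar x\in\operatorname{int}\mathbf L$ (linear equalities count as pairs of linear inequalities, i.e. belong to the polyhedral part). A $\mathcal K$-representation $Ax+Bu\leq_{\mathbf K}c$ of a set is essentially strictly feasible if it is so as a constraint in $(x,u)$. A continuous convex-concave (convex in the first, concave in the second argument) function $\psi:\mathcal X\times\mathcal Y\to\mathbb R$ is $\mathcal K$-representable on $\mathcal X\times\mathcal Y$ if $\psi(x,y)=\inf_{f,t,u}\{f^Ty+t:Pf+tp+Qu+Rx\leq_{\mathbf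 K}s\}$ for all $x\in\mathcal X,y\in\mathcal Y$, with some $\mathbf K\in\mathcal K$ (the constraint may be given as an equivalent finite system). This representation is essentially strictly feasible if for every $x\in\mathcal X$ the conic constraint $Pf+tp+Qu\leq_{\mathbf K}s-Rx$ in variables $f,t,u$ is essentially strictly feasible. *)

theory Defs
  imports "HOL-Analysis.Analysis" "Jordan_Normal_Form.Matrix"
begin

unbundle no vec_syntax and no inner_syntax

section \<open>Euclidean spaces of variable dimension\<close>

text \<open>The family of cones lives in spaces of all dimensions, so $\mathbf{R}^n$ is
  \<^term>\<open>carrier_vec n\<close>.  The type \<^typ>\<open>real vec\<close> carries no topology of its own.\<close>

definition eucl_dist :: "nat \<Rightarrow> real vec \<Rightarrow> real vec \<Rightarrow> real" where
  "eucl_dist n x y = L2_set (\<lambda>i. x $ i - y $ i) {..<n}"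

lemma Metric_space_eucl: "Metric_space (carrier_vec n) (eucl_dist n)"
proof
  show "0 \<le> eucl_dist n x y" for x y
    by (simp add: eucl_dist_def L2_set_nonneg)
  show "eucl_dist n x y = eucl_dist n y x" for x y
    by (simp add: eucl_dist_def L2_set_def power2_commute)
  show "eucl_dist n x y = 0 \<longleftrightarrow> x = y" if "x \<in> carrier_vec n" "y \<in> carrier_vec n" for x y
    using that by (auto simp: eucl_dist_def L2_set_eq_0_iff)
  show "eucl_dist n x z \<le> eucl_dist n x y + eucl_dist n y z" for x y z
    using L2_set_triangle_ineq[of "\<lambda>i. x $ i - y $ i" "\<lambda>i. y $ i - z $ i" "{..<n}"]
    by (simp add: eucl_dist_def)
qed

definition eucl_top :: "nat \<Rightarrow> real vec topology" where
  "eucl_top n = Metric_space.mtopology (carrier_vec n) (eucl_dist n)"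

definition convex_set_vec :: "real vec set \<Rightarrow> bool" where
  "convex_set_vec S \<longleftrightarrow>
     (\<forall>x\<in>S. \<forall>y\<in>S. \<forall>t\<in>{0..1}. (1 - t) \<cdot>\<^sub>v x + t \<cdot>\<^sub>v y \<in> S)"

definition convex_fun_vec :: "real vec set \<Rightarrow> (real vec \<Rightarrow> real) \<Rightarrow> bool" where
  "convex_fun_vec S f \<longleftrightarrow> convex_set_vec S \<and>
     (\<forall>x\<in>S. \<forall>y\<in>S. \<forall>t\<in>{0..1}.
        f ((1 - t) \<cdot>\<^sub>v x + t \<cdot>\<^sub>v y) \<le> (1 - t) * f x + t * f y)"

definition append_cols :: "real mat \<Rightarrow> real mat \<Rightarrow> real mat" (infixr \<open>@\<^sub>c\<close> 65) where
  "A @\<^sub>c B = four_block_mat A B (0\<^sub>m 0 (dim_col A)) (0\<^sub>m 0 (dim_col B))"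

section \<open>Cones and conic constraints\<close>

definition regular_cone :: "nat \<Rightarrow> real vec set \<Rightarrow> bool" where
  "regular_cone k K \<longleftrightarrow>
     K \<subseteq> carrier_vec k \<and> K \<noteq> {} \<and> (\<forall>x\<in>K. \<forall>t\<ge>0. t \<cdot>\<^sub>v x \<in> K) \<and>
     closedin (eucl_top k) K \<and> convex_set_vec K \<and>
     (\<forall>x. x \<in> K \<and> - x \<in> K \<longrightarrow> x = 0\<^sub>v k) \<and>
     eucl_top k interior_of K \<noteq> {}"

definition orthant :: "nat \<Rightarrow> real vec set" where
  "orthant r = {x. 0\<^sub>v r \<le> x}"

definition vec_prod :: "real vec set \<Rightarrow> real vec set \<Rightarrow> real vec set" (infixr \<open>\<times>\<^sub>v\<close> 75) where
  "K \<times>\<^sub>v L = {x @\<^sub>v y | x y. x \<in> K \<and> y \<in> L}"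

definition dual_cone :: "nat \<Rightarrow> real vec set \<Rightarrow> real vec set" where
  "dual_cone k K = {y \<in> carrier_vec k. \<forall>x\<in>K. 0 \<le> y \<bullet> x}"

text \<open>A regular cone is nonempty, so the set itself determines its dimension.\<close>

definition cone_family :: "real vec set set \<Rightarrow> bool" where
  "cone_family \<K> \<longleftrightarrow>
     (\<forall>K\<in>\<K>. \<exists>k. regular_cone k K) \<and>
     orthant 1 \<in> \<K> \<and>
     (\<forall>K\<in>\<K>. \<forall>L\<in>\<K>. K \<times>\<^sub>v L \<in> \<K>) \<and>
     (\<forall>K\<in>\<K>. \<forall>k. regular_cone k K \<longrightarrow> dual_cone k K \<in> \<K>)"

definition conic_le :: "real vec \<Rightarrow> real vec set \<Rightarrow> real vec \<Rightarrow> bool"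
    (\<open>(_/ \<le>\<^bsub>_\<^esub> _)\<close> [51, 0, 51] 50) where
  "a \<le>\<^bsub>K\<^esub> b \<longleftrightarrow> b - a \<in> K"

text \<open>Essential strict feasibility of $Ax \leq_K a$.  An absent factor is $r = 0$ or $l = 0$:
  the zero-dimensional space is its only, regular, cone.\<close>

definition ess_strictly_feasible :: "real vec set \<Rightarrow> real mat \<Rightarrow> real vec \<Rightarrow> bool" where
  "ess_strictly_feasible K A a \<longleftrightarrow>
     (\<exists>r l L. r + l = dim_row A \<and> regular_cone l L \<and> K = orthant r \<times>\<^sub>v L \<and>
        (\<exists>x \<in> carrier_vec (dim_col A).
           a - A *\<^sub>v x \<in> orthant r \<times>\<^sub>v (eucl_top l interior_of L)))"

section \<open>Representations of convex-concave functions\<close>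

definition cont_convex_concave ::
    "nat \<Rightarrow> real vec set \<Rightarrow> nat \<Rightarrow> real vec set \<Rightarrow> (real vec \<Rightarrow> real vec \<Rightarrow> real) \<Rightarrow> bool" where
  "cont_convex_concave n X m Y \<psi> \<longleftrightarrow>
     continuous_map (prod_topology (subtopology (eucl_top n) X) (subtopology (eucl_top m) Y))
       euclideanreal (\<lambda>(x, y). \<psi> x y) \<and>
     (\<forall>y\<in>Y. convex_fun_vec X (\<lambda>x. \<psi> x y)) \<and>
     (\<forall>x\<in>X. convex_fun_vec Y (\<lambda>y. - \<psi> x y))"

text \<open>The infimum is taken in the extended reals, so that it is finite exactly when the constraint
  is feasible and the objective is bounded below.\<close>

definition inf_represents ::
    "real vec set \<Rightarrow> real vec set \<Rightarrow> (real vec \<Rightarrow> real vec \<Rightarrow> real) \<Rightarrow> nat \<Rightarrow> nat \<Rightarrow>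
     (real vec \<Rightarrow> real \<Rightarrow> real vec \<Rightarrow> real vec \<Rightarrow> bool) \<Rightarrow> bool" where
  "inf_represents X Y \<psi> m l F \<longleftrightarrow>
     (\<forall>x\<in>X. \<forall>y\<in>Y. ereal (\<psi> x y) =
        Inf {ereal (f \<bullet> y + t) | f t u. f \<in> carrier_vec m \<and> u \<in> carrier_vec l \<and> F f t u x})"

text \<open>The system $F$ in the variables $f \in \mathbf{R}^m$, $t \in \mathbf{R}$,
  $u \in \mathbf{R}^l$, $x \in \mathbf{R}^n$ is equivalent to a single conic constraint with a
  cone from the family.\<close>

definition conic_system ::
    "real vec set set \<Rightarrow> nat \<Rightarrow> nat \<Rightarrow> nat \<Rightarrow>
     (real vec \<Rightarrow> real \<Rightarrow> real vec \<Rightarrow> real vec \<Rightarrow> bool) \<Rightarrow> bool" where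
  "conic_system \<K> m l n F \<longleftrightarrow>
     (\<exists>k K P \<pi> Q R s. K \<in> \<K> \<and> K \<subseteq> carrier_vec k \<and>
        P \<in> carrier_mat k m \<and> \<pi> \<in> carrier_vec k \<and> Q \<in> carrier_mat k l \<and>
        R \<in> carrier_mat k n \<and> s \<in> carrier_vec k \<and>
        (\<forall>f\<in>carrier_vec m. \<forall>t. \<forall>u\<in>carrier_vec l. \<forall>x\<in>carrier_vec n.
           F f t u x \<longleftrightarrow> P *\<^sub>v f + t \<cdot>\<^sub>v \<pi> + Q *\<^sub>v u + R *\<^sub>v x \<le>\<^bsub>K\<^esub> s))"

definition K_representable ::
    "real vec set set \<Rightarrow> nat \<Rightarrow> real vec set \<Rightarrow> nat \<Rightarrow> real vec set \<Rightarrow>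
     (real vec \<Rightarrow> real vec \<Rightarrow> real) \<Rightarrow> bool" where
  "K_representable \<K> n X m Y \<psi> \<longleftrightarrow> cont_convex_concave n X m Y \<psi> \<and>
     (\<exists>l F. conic_system \<K> m l n F \<and> inf_represents X Y \<psi> m l F)"

section \<open>The Fenchel conjugate\<close>

definition conj_payoff ::
    "(real vec \<Rightarrow> real vec \<Rightarrow> real) \<Rightarrow> real vec \<Rightarrow> real vec \<Rightarrow> real vec \<Rightarrow> real vec \<Rightarrow> real" where
  "conj_payoff \<psi> p q x y = p \<bullet> x + q \<bullet> y - \<psi> x y"

text \<open>The conjugate is defined by supremum and infimum over the reals; it is meaningful as a
  max-min only together with \<open>conjugate_attained\<close>.\<close>

definition conjugate_fun ::
    "real vec set \<Rightarrow> real vec set \<Rightarrow> (real vec \<Rightarrow> real vec \<Rightarrow> real) \<Rightarrow>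
     real vec \<Rightarrow> real vec \<Rightarrow> real" where
  "conjugate_fun X Y \<psi> p q = (SUP x\<in>X. INF y\<in>Y. conj_payoff \<psi> p q x y)"

definition conjugate_attained ::
    "real vec set \<Rightarrow> real vec set \<Rightarrow> (real vec \<Rightarrow> real vec \<Rightarrow> real) \<Rightarrow>
     real vec \<Rightarrow> real vec \<Rightarrow> bool" where
  "conjugate_attained X Y \<psi> p q \<longleftrightarrow>
     (\<forall>x\<in>X. \<exists>y. is_arg_min (conj_payoff \<psi> p q x) (\<lambda>y. y \<in> Y) y) \<and>
     (\<exists>x. is_arg_max (\<lambda>x. INF y\<in>Y. conj_payoff \<psi> p q x y) (\<lambda>x. x \<in> X) x)"

definition is_minimum :: "real set \<Rightarrow> real \<Rightarrow> bool" where
  "is_minimum S v \<longleftrightarrow> v \<in> S \<and> (\<forall>w\<in>S. v \<le> w)"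

end

(*  For y in Y, the value sup_x (p.x - psi(x,y)) is the optimal value of a conic problem in (f,t,u,x,xi);
    strong duality turns it into an attained minimum over (delta, epsilon), and the constraint
    D alpha - C beta + e >= 0 says beta in Y.  Since X and Y are compact and psi is continuous
    convex-concave, minimax lets one minimise over y = beta last, which gives the representation.

    The cone K may be a product of an orthant with a cone L on which alone the constraint is strictly
    feasible.  Strong duality is therefore derived from closedness of the cone
    {(M^T l, r) : l in K^*, r >= b.l}.

    Saddle points give the rest: convexity and concavity by evaluating each conjugate value at the
    saddle points of the others, and a Lipschitz bound, because X and Y are bounded.  *)
theory Submission
  imports Defs
begin

text \<open>The obstacle is the orthant factor: the slack may vanish there, so multipliers with zero
  image and zero cost can be nonzero, and minimising multipliers can escape to infinity. What saves
  closedness is that such a multiplier lives on orthant coordinates alone, where the dual cone asks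
  only for nonnegativity and can be left only through a sign.

  The variable x stays inside the conic problem, because then one common slack point is enough:
  strict feasibility for X yields some x, and the constraint of \<psi> is strictly feasible at that
  very x.

  The infimum representing \<psi> may fail to be attained. Both halves therefore use inequalities
  that hold for every feasible (f, t, u): \<psi>(x, y) \<le> f.y + t bounds the primal problem, and
  weak duality bounds f.\<beta> + t from below, hence also the infimum.

  The two halves meet at a saddle point (x, y): its x tests every feasible \<beta>, while its y is
  the minimising \<beta>. A witness \<eta> of y in Y enters with the opposite sign, as \<alpha> =
  -\<eta>.

  Cones are first treated as sets of functions on finite index sets, so that sum types can index the
  blocks of a matrix without offsets.\<close>

subsection \<open>Cones of real functions on a finite index set\<close>

text \<open>Convergence is demanded on \<open>I\<close> alone and the limit is arbitrary elsewhere.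
  A closed set is therefore insensitive to values outside \<open>I\<close>, which lets total
  functions stand for vectors indexed by \<open>I\<close>.\<close>

definition coord_closed :: "'i set \<Rightarrow> ('i \<Rightarrow> real) set \<Rightarrow> bool" where
  "coord_closed I S \<longleftrightarrow>
     (\<forall>x l. (\<forall>k. x k \<in> S) \<longrightarrow> (\<forall>i\<in>I. (\<lambda>k::nat. x k i) \<longlonglongrightarrow> l i) \<longrightarrow> l \<in> S)"

definition fun_cone :: "('i \<Rightarrow> real) set \<Rightarrow> bool" where
  "fun_cone S \<longleftrightarrow> (\<lambda>_. 0) \<in> S \<and> (\<forall>x\<in>S. \<forall>y\<in>S. (\<lambda>i. x i + y i) \<in> S) \<and>
     (\<forall>x\<in>S. \<forall>t\<ge>0. (\<lambda>i. t * x i) \<in> S)"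

definition fun_dual :: "'i set \<Rightarrow> ('i \<Rightarrow> real) set \<Rightarrow> ('i \<Rightarrow> real) set" where
  "fun_dual I S = {z. \<forall>x\<in>S. 0 \<le> (\<Sum>i\<in>I. z i * x i)}"

lemma coord_closedD:
  "\<lbrakk>coord_closed I S; \<And>k::nat. x k \<in> S; \<And>i. i \<in> I \<Longrightarrow> (\<lambda>k. x k i) \<longlonglongrightarrow> l i\<rbrakk> \<Longrightarrow> l \<in> S"
  unfolding coord_closed_def by blast

lemma coord_closed_cong:
  "\<lbrakk>coord_closed I S; x \<in> S; \<And>i. i \<in> I \<Longrightarrow> x i = y i\<rbrakk> \<Longrightarrow> y \<in> S"
  by (erule coord_closedD[where x = "\<lambda>_. x"]) simp_all

lemma coord_closed_fun_dual: "coord_closed I (fun_dual I S)"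
  unfolding coord_closed_def
proof (intro allI impI)
  fix x :: "nat \<Rightarrow> 'a \<Rightarrow> real" and l
  assume x: "\<forall>k. x k \<in> fun_dual I S" and lim: "\<forall>i\<in>I. (\<lambda>k. x k i) \<longlonglongrightarrow> l i"
  have "0 \<le> (\<Sum>i\<in>I. l i * y i)" if "y \<in> S" for y
  proof (rule LIMSEQ_le_const)
    show "(\<lambda>k. \<Sum>i\<in>I. x k i * y i) \<longlonglongrightarrow> (\<Sum>i\<in>I. l i * y i)"
      using lim by (intro tendsto_intros) auto
    show "\<exists>N. \<forall>k\<ge>N. 0 \<le> (\<Sum>i\<in>I. x k i * y i)"
      using x that by (auto simp: fun_dual_def)
  qed
  then show "l \<in> fun_dual I S"
    by (simp add: fun_dual_def)
qed

lemma fun_cone_fun_dual: "fun_cone (fun_dual I S)"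
proof -
  have "(\<Sum>i\<in>I. (t * z i) * x i) = t * (\<Sum>i\<in>I. z i * x i)" for t and z x :: "'a \<Rightarrow> real"
    by (simp add: sum_distrib_left mult.assoc)
  then show ?thesis
    by (auto simp: fun_cone_def fun_dual_def distrib_right sum.distrib)
qed

text \<open>Bolzano-Weierstrass one coordinate at a time: each new index costs a further
  subsequence, along which the limits already found persist.\<close>

lemma bounded_coords_convergent_subseq:
  fixes x :: "nat \<Rightarrow> 'i \<Rightarrow> real"
  assumes "finite I" and "\<And>i k. i \<in> I \<Longrightarrow> \<bar>x k i\<bar> \<le> b"
  shows "\<exists>r l. strict_mono (r :: nat \<Rightarrow> nat) \<and> (\<forall>i\<in>I. (\<lambda>k. x (r k) i) \<longlonglongrightarrow> l i)"
  using assms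
proof (induction I rule: finite_induct)
  case empty
  show ?case
    by (rule exI[of _ id]) (simp add: strict_mono_def)
next
  case (insert j I)
  have "\<exists>r l. strict_mono (r :: nat \<Rightarrow> nat) \<and> (\<forall>i\<in>I. (\<lambda>k. x (r k) i) \<longlonglongrightarrow> l i)"
    by (rule insert.IH) (use insert.prems in auto)
  then obtain r l where r: "strict_mono (r :: nat \<Rightarrow> nat)"
    and l: "\<And>i. i \<in> I \<Longrightarrow> (\<lambda>k. x (r k) i) \<longlonglongrightarrow> l i"
    by blast
  have "\<forall>k. x (r k) j \<in> {-b..b}"
    using insert.prems[of j] by (simp add: abs_le_iff minus_le_iff)
  then obtain a r' where r': "strict_mono (r' :: nat \<Rightarrow> nat)"
    and a: "((\<lambda>k. x (r k) j) \<circ> r') \<longlonglongrightarrow> a"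
    using compact_Icc[of "-b" b, unfolded compact_def] by metis
  have "\<forall>i\<in>insert j I. (\<lambda>k. x ((r \<circ> r') k) i) \<longlonglongrightarrow> (l(j := a)) i"
  proof
    fix i assume i: "i \<in> insert j I"
    show "(\<lambda>k. x ((r \<circ> r') k) i) \<longlonglongrightarrow> (l(j := a)) i"
    proof (cases "i = j")
      case True
      then show ?thesis
        using a by (simp add: comp_def)
    next
      case False
      then show ?thesis
        using i LIMSEQ_subseq_LIMSEQ[OF l r'] by (simp add: comp_def)
    qed
  qed
  then show ?case
    using strict_mono_o[OF r r'] by blast
qed

section \<open>Separation of a point from a closed cone\<close>

lemma sum_power2_line:
  fixes d x :: "'i \<Rightarrow> real"
  shows "(\<Sum>i\<in>I. (d i + t * x i)^2)
    = (\<Sum>i\<in>I. (d i)^2) + 2 * t * (\<Sum>i\<in>I. d i * x i) + t^2 * (\<Sum>i\<in>I. (x i)^2)"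
  by (simp add: power2_eq_square algebra_simps sum.distrib sum_distrib_left)

text \<open>First-order optimality: divide by t and let t = 1/(n+1) tend to 0. The range of t stops
  at 1 because the cone is left when a point is moved past the origin.\<close>

lemma quadratic_nonneg_imp_slope_nonneg:
  fixes a b :: real
  assumes "\<And>t. \<lbrakk>0 < t; t \<le> 1\<rbrakk> \<Longrightarrow> 0 \<le> 2 * t * a + t^2 * b"
  shows "0 \<le> a"
proof (rule LIMSEQ_le_const)
  have "(\<lambda>n. (2 * a + inverse (real (Suc n)) * b) / 2) \<longlonglongrightarrow> (2 * a + 0 * b) / 2"
    by (intro tendsto_intros LIMSEQ_inverse_real_of_nat) simp
  then show "(\<lambda>n. (2 * a + inverse (real (Suc n)) * b) / 2) \<longlonglongrightarrow> a"
    by simp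
  have "0 \<le> 2 * a + inverse (real (Suc n)) * b" for n
  proof -
    define t where "t = inverse (real (Suc n))"
    have t: "0 < t" "t \<le> 1"
      by (simp_all add: t_def inverse_le_1_iff)
    have "0 \<le> t * (2 * a + t * b)"
      using assms[OF t] by (simp add: power2_eq_square algebra_simps)
    then show ?thesis
      using t by (simp add: zero_le_mult_iff t_def)
  qed
  then show "\<exists>N. \<forall>n\<ge>N. 0 \<le> (2 * a + inverse (real (Suc n)) * b) / 2"
    by simp
qed

text \<open>The normal is z = l - w, with l a point of \<open>S\<close> nearest to w. Optimality of
  l in each direction of \<open>S\<close> puts z in the dual cone; optimality towards the origin
  gives z.l \<le> 0; and z.w is z.l minus the positive squared distance.\<close>

lemma closed_cone_separation:
  fixes S :: "('i \<Rightarrow> real) set"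
  assumes I: "finite I" and cl: "coord_closed I S" and S: "fun_cone S" and w: "w \<notin> S"
  shows "\<exists>z\<in>fun_dual I S. (\<Sum>i\<in>I. z i * w i) < 0"
proof -
  define N where "N x = (\<Sum>i\<in>I. (x i - w i)^2)" for x
  define v where "v = Inf (N ` S)"
  have N0: "0 \<le> N x" for x
    by (simp add: N_def sum_nonneg)
  have ne: "N ` S \<noteq> {}"
    using S by (auto simp: fun_cone_def)
  have bdd: "bdd_below (N ` S)"
    by (rule bdd_belowI2[OF N0])
  have v: "v \<le> N x" if "x \<in> S" for x
    unfolding v_def using bdd that by (intro cInf_lower) auto
  have v0: "0 \<le> v"
    unfolding v_def by (rule cInf_greatest[OF ne]) (use N0 in auto)
  have "\<exists>x\<in>S. N x < v + inverse (real (Suc k))" for k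
    using cInf_lessD[OF ne, of "v + inverse (real (Suc k))"] by (auto simp: v_def)
  then obtain x where x: "\<And>k. x k \<in> S" "\<And>k. N (x k) < v + inverse (real (Suc k))"
    by metis
  \<comment> \<open>The squared difference is at most v + 1, so the difference itself is at most 1
    or at most v + 1; v + 2 covers both cases. Summing all of w makes the bound independent of
    i.\<close>
  have "\<bar>x k i\<bar> \<le> (v + 2) + (\<Sum>i\<in>I. \<bar>w i\<bar>)" if i: "i \<in> I" for k i
  proof -
    have "(x k i - w i)^2 \<le> N (x k)"
      unfolding N_def by (rule member_le_sum) (use I i in auto)
    also have "\<dots> \<le> v + 1"
      using x(2)[of k] inverse_le_1_iff[of "real (Suc k)"] by linarith
    finally have "\<bar>x k i - w i\<bar> \<le> v + 2"
      using abs_le_square_iff[of 1 "x k i - w i"] power2_abs[of "x k i - w i"]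
        mult_right_mono[of 1 "\<bar>x k i - w i\<bar>" "\<bar>x k i - w i\<bar>"] v0
      by (cases "\<bar>x k i - w i\<bar> \<le> 1") (auto simp: power2_eq_square)
    moreover have "\<bar>w i\<bar> \<le> (\<Sum>i\<in>I. \<bar>w i\<bar>)"
      by (rule member_le_sum) (use I i in auto)
    ultimately show ?thesis
      by linarith
  qed
  then have "\<exists>r l. strict_mono (r :: nat \<Rightarrow> nat) \<and> (\<forall>i\<in>I. (\<lambda>k. x (r k) i) \<longlonglongrightarrow> l i)"
    by (rule bounded_coords_convergent_subseq[OF I])
  then obtain r l where r: "strict_mono (r :: nat \<Rightarrow> nat)"
    and l: "\<And>i. i \<in> I \<Longrightarrow> (\<lambda>k. x (r k) i) \<longlonglongrightarrow> l i"
    by blast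
  have lS: "l \<in> S"
    by (rule coord_closedD[OF cl _ l]) (use x in auto)
  have "N l \<le> v"
  proof (rule LIMSEQ_le)
    show "(\<lambda>k. N (x (r k))) \<longlonglongrightarrow> N l"
      unfolding N_def using l by (intro tendsto_intros) auto
    show "(\<lambda>k. v + inverse (real (Suc (r k)))) \<longlonglongrightarrow> v"
      using LIMSEQ_subseq_LIMSEQ[OF LIMSEQ_inverse_real_of_nat_add[of v] r] by (simp add: comp_def)
    show "\<exists>n. \<forall>k\<ge>n. N (x (r k)) \<le> v + inverse (real (Suc (r k)))"
      using x(2) by (meson less_imp_le)
  qed
  then have min: "N l \<le> N y" if "y \<in> S" for y
    using v[OF that] by linarith
  define z where "z i = l i - w i" for i
  have line: "N (\<lambda>i. l i + t * y i) = N l + (2 * t * (\<Sum>i\<in>I. z i * y i) + t^2 * (\<Sum>i\<in>I. (y i)^2))" for t y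
    using sum_power2_line[of z t y I] by (simp add: N_def z_def algebra_simps)
  have "z \<in> fun_dual I S"
    unfolding fun_dual_def
  proof (safe, rule quadratic_nonneg_imp_slope_nonneg)
    fix y and t :: real assume "y \<in> S" "0 < t" "t \<le> 1"
    then have "(\<lambda>i. l i + t * y i) \<in> S"
      using S lS by (simp add: fun_cone_def)
    then show "0 \<le> 2 * t * (\<Sum>i\<in>I. z i * y i) + t^2 * (\<Sum>i\<in>I. (y i)^2)"
      using min line[of t y] by fastforce
  qed
  \<comment> \<open>The direction is -l: the points (1 - t) l stay in the cone for t \<le>
    1.\<close>
  moreover have "0 \<le> - (\<Sum>i\<in>I. z i * l i)"
  proof (rule quadratic_nonneg_imp_slope_nonneg)
    fix t :: real assume "0 < t" "t \<le> 1"
    then have "(\<lambda>i. (1 - t) * l i) \<in> S"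
      using S lS by (simp add: fun_cone_def)
    then have "N l \<le> N (\<lambda>i. l i + (- t) * l i)"
      using min by (simp add: algebra_simps)
    then show "0 \<le> 2 * t * (- (\<Sum>i\<in>I. z i * l i)) + t^2 * (\<Sum>i\<in>I. (l i)^2)"
      unfolding line by simp
  qed
  moreover have "N l > 0"
  proof (rule ccontr)
    assume "\<not> 0 < N l"
    then have "N l = 0"
      using N0[of l] by simp
    then have "l i = w i" if "i \<in> I" for i
      using that I by (simp add: N_def sum_nonneg_eq_0_iff)
    then show False
      using coord_closed_cong[OF cl lS] w by blast
  qed
  moreover have "(\<Sum>i\<in>I. z i * w i) = (\<Sum>i\<in>I. z i * l i) - N l"
    by (simp add: N_def z_def power2_eq_square flip: sum_subtractf) (simp add: algebra_simps)
  ultimately show ?thesis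
    by (intro bexI[of _ z]) auto
qed

text \<open>The nontrivial inclusion of the bipolar theorem.\<close>

lemma fun_dual_fun_dual:
  assumes "finite I" "coord_closed I S" "fun_cone S" "\<And>z. z \<in> fun_dual I S \<Longrightarrow> 0 \<le> (\<Sum>i\<in>I. z i * x i)"
  shows "x \<in> S"
  using closed_cone_separation[OF assms(1-3), of x] assms(4) by fastforce

text \<open>Closedness of the image of the dual cone is the only place where a constraint qualification
  is needed.  For each point of the sequence, a preimage of almost minimal 1-norm is taken;
  if these norms were unbounded, a limit of normalised preimages would lie in the kernel, hence in
  the polyhedral part, and subtracting a multiple of it would shorten some preimage.\<close>

lemma coord_closed_dual_image:
  fixes M :: "'i \<Rightarrow> 'j \<Rightarrow> real" and b :: "'i \<Rightarrow> real"
  assumes I: "finite I" and S: "coord_closed I S" "fun_cone S"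
    and sub: "T \<subseteq> I"
    and pos: "\<And>l i. \<lbrakk>l \<in> S; i \<in> T\<rbrakk> \<Longrightarrow> 0 \<le> l i"
    and repl: "\<And>l l'. \<lbrakk>l \<in> S; \<And>i. i \<in> I - T \<Longrightarrow> l' i = l i; \<And>i. i \<in> T \<Longrightarrow> 0 \<le> l' i\<rbrakk> \<Longrightarrow> l' \<in> S"
    and kern: "\<And>l. \<lbrakk>l \<in> S; \<And>j. j \<in> J \<Longrightarrow> (\<Sum>i\<in>I. l i * M i j) = 0\<rbrakk> \<Longrightarrow> 0 \<le> (\<Sum>i\<in>I. l i * b i)"
    and kern0: "\<And>l i. \<lbrakk>l \<in> S; \<And>j. j \<in> J \<Longrightarrow> (\<Sum>i\<in>I. l i * M i j) = 0; (\<Sum>i\<in>I. l i * b i) = 0; i \<in> I - T\<rbrakk>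
      \<Longrightarrow> l i = 0"
  shows "coord_closed (insert None (Some ` J))
    {y. \<exists>l\<in>S. (\<forall>j\<in>J. (\<Sum>i\<in>I. l i * M i j) = y (Some j)) \<and> (\<Sum>i\<in>I. l i * b i) \<le> y None}"
    (is "coord_closed _ ?G")
  unfolding coord_closed_def
proof (intro allI impI)
  fix y :: "nat \<Rightarrow> 'j option \<Rightarrow> real" and y'
  assume y: "\<forall>k. y k \<in> ?G" and lim: "\<forall>i\<in>insert None (Some ` J). (\<lambda>k. y k i) \<longlonglongrightarrow> y' i"
  define F where "F u = {l\<in>S. (\<forall>j\<in>J. (\<Sum>i\<in>I. l i * M i j) = u (Some j)) \<and> (\<Sum>i\<in>I. l i * b i) \<le> u None}"
    for u :: "'j option \<Rightarrow> real"
  define N where "N l = (\<Sum>i\<in>I. \<bar>l i\<bar>)" for l :: "'i \<Rightarrow> real"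
  have N0: "0 \<le> N l" for l
    by (simp add: N_def sum_nonneg)
  \<comment> \<open>Preimages within 1 of the infimal norm always exist; the contradiction below
    gains more than 2, so this slack is harmless.\<close>
  have "\<exists>l\<in>F (y k). \<forall>l'\<in>F (y k). N l \<le> N l' + 1" for k
  proof -
    have ne: "N ` F (y k) \<noteq> {}"
      using y by (auto simp: F_def)
    obtain l where l: "l \<in> F (y k)" "N l < Inf (N ` F (y k)) + 1"
      using cInf_lessD[OF ne, of "Inf (N ` F (y k)) + 1"] by auto
    have "Inf (N ` F (y k)) \<le> N l'" if "l' \<in> F (y k)" for l'
      using that bdd_belowI2[OF N0] by (intro cInf_lower) auto
    with l show ?thesis
      by force
  qed
  then obtain L where L: "\<And>k. L k \<in> F (y k)" and Lmin: "\<And>k l'. l' \<in> F (y k) \<Longrightarrow> N (L k) \<le> N l' + 1"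
    by metis
  \<comment> \<open>With 1 + N in the denominator both the scale and the scaled preimage stay
    bounded by 1. Recording the scale as coordinate \<open>None\<close> gives one subsequence for
    both; its limit t is positive if the norms stay bounded along it and 0 if they blow up.\<close>
  define \<theta> where "\<theta> k = inverse (1 + N (L k))" for k
  have \<theta>: "0 < \<theta> k" "\<theta> k \<le> 1" "\<theta> k * N (L k) = 1 - \<theta> k" for k
    using N0[of "L k"] by (auto simp: \<theta>_def field_simps)
  have bound: "\<bar>case i of None \<Rightarrow> \<theta> k | Some i' \<Rightarrow> \<theta> k * L k i'\<bar> \<le> 1" if "i \<in> insert None (Some ` I)" for i k
  proof (cases i)
    case (Some i')
    then have "\<bar>L k i'\<bar> \<le> N (L k)"
      unfolding N_def using that I by (intro member_le_sum) auto
    then have "\<theta> k * \<bar>L k i'\<bar> \<le> \<theta> k * N (L k)"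
      using \<theta>(1)[of k] by simp
    then show ?thesis
      using \<theta>[of k] Some by (simp add: abs_mult)
  qed (use \<theta>[of k] in simp)
  obtain r \<mu> where r: "strict_mono (r :: nat \<Rightarrow> nat)"
    and \<mu>: "\<And>i. i \<in> insert None (Some ` I) \<Longrightarrow>
      (\<lambda>k. case i of None \<Rightarrow> \<theta> (r k) | Some i' \<Rightarrow> \<theta> (r k) * L (r k) i') \<longlonglongrightarrow> \<mu> i"
    using bounded_coords_convergent_subseq[of "insert None (Some ` I)"
        "\<lambda>k i. case i of None \<Rightarrow> \<theta> k | Some i' \<Rightarrow> \<theta> k * L k i'" 1] I bound by blast
  define t where "t = \<mu> None"
  define l where "l i = \<mu> (Some i)" for i
  have t: "(\<lambda>k. \<theta> (r k)) \<longlonglongrightarrow> t" and l: "\<And>i. i \<in> I \<Longrightarrow> (\<lambda>k. \<theta> (r k) * L (r k) i) \<longlonglongrightarrow> l i"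
    using \<mu>[of None] \<mu>[of "Some _"] by (simp_all add: t_def l_def)
  have lS: "l \<in> S"
  proof (rule coord_closedD[OF S(1) _ l])
    show "(\<lambda>i. \<theta> (r k) * L (r k) i) \<in> S" for k
      using S(2) L[of "r k"] \<theta>(1)[of "r k"] by (simp add: fun_cone_def F_def)
  qed
  have ylim: "(\<lambda>k. y (r k) i) \<longlonglongrightarrow> y' i" if "i \<in> insert None (Some ` J)" for i
    using LIMSEQ_subseq_LIMSEQ[OF lim[rule_format, OF that] r] by (simp add: comp_def)
  have lM: "(\<Sum>i\<in>I. l i * M i j) = t * y' (Some j)" if j: "j \<in> J" for j
  proof (rule LIMSEQ_unique)
    show "(\<lambda>k. \<Sum>i\<in>I. (\<theta> (r k) * L (r k) i) * M i j) \<longlonglongrightarrow> (\<Sum>i\<in>I. l i * M i j)"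
      using l by (intro tendsto_intros) auto
    have "(\<Sum>i\<in>I. (\<theta> (r k) * L (r k) i) * M i j) = \<theta> (r k) * y (r k) (Some j)" for k
      using L[of "r k"] j by (simp add: F_def mult.assoc flip: sum_distrib_left)
    then show "(\<lambda>k. \<Sum>i\<in>I. (\<theta> (r k) * L (r k) i) * M i j) \<longlonglongrightarrow> t * y' (Some j)"
      using t ylim[of "Some j"] j by (simp add: tendsto_mult)
  qed
  have lb: "(\<Sum>i\<in>I. l i * b i) \<le> t * y' None"
  proof (rule LIMSEQ_le)
    show "(\<lambda>k. \<Sum>i\<in>I. (\<theta> (r k) * L (r k) i) * b i) \<longlonglongrightarrow> (\<Sum>i\<in>I. l i * b i)"
      using l by (intro tendsto_intros) auto
    show "(\<lambda>k. \<theta> (r k) * y (r k) None) \<longlonglongrightarrow> t * y' None"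
      using t ylim[of None] by (intro tendsto_intros) auto
    have "(\<Sum>i\<in>I. (\<theta> (r k) * L (r k) i) * b i) \<le> \<theta> (r k) * y (r k) None" for k
      using L[of "r k"] \<theta>(1)[of "r k"] by (simp add: F_def mult.assoc flip: sum_distrib_left)
    then show "\<exists>n. \<forall>k\<ge>n. (\<Sum>i\<in>I. (\<theta> (r k) * L (r k) i) * b i) \<le> \<theta> (r k) * y (r k) None"
      by blast
  qed
  have "0 \<le> t"
    using \<theta>(1) by (intro LIMSEQ_le_const[OF t]) (meson less_imp_le)
  moreover have "t \<noteq> 0"
  proof
    assume t0: "t = 0"
    have lM0: "(\<Sum>i\<in>I. l i * M i j) = 0" if "j \<in> J" for j
      using lM[OF that] t0 by simp
    have lb0: "(\<Sum>i\<in>I. l i * b i) = 0"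
      using lb kern[OF lS lM0] t0 by simp
    have l0: "l i = 0" if "i \<in> I - T" for i
      using kern0[OF lS lM0 lb0 that] by blast
    \<comment> \<open>The scaled norms are 1 - \<theta>, so if the scale tends to 0 the limit
      direction is not zero.\<close>
    have "N l = 1"
    proof (rule LIMSEQ_unique)
      have "(\<lambda>k. \<Sum>i\<in>I. \<bar>\<theta> (r k) * L (r k) i\<bar>) \<longlonglongrightarrow> N l"
        unfolding N_def using l by (intro tendsto_intros) auto
      moreover have "(\<Sum>i\<in>I. \<bar>\<theta> (r k) * L (r k) i\<bar>) = 1 - \<theta> (r k)" for k
        using \<theta>[of "r k"] by (simp add: abs_mult N_def flip: sum_distrib_left)
      ultimately show "(\<lambda>k. 1 - \<theta> (r k)) \<longlonglongrightarrow> N l"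
        by simp
      show "(\<lambda>k. 1 - \<theta> (r k)) \<longlonglongrightarrow> 1"
        using tendsto_diff[OF tendsto_const[of 1] t] t0 by simp
    qed
    have "\<forall>\<^sub>F k in sequentially. l i / 2 \<le> \<theta> (r k) * L (r k) i" if i: "i \<in> T" for i
    proof (cases "l i = 0")
      case True
      have "0 \<le> \<theta> (r k) * L (r k) i" for k
        using pos[OF _ i, of "L (r k)"] L[of "r k"] \<theta>(1)[of "r k"] by (simp add: F_def)
      with True show ?thesis
        by simp
    next
      case False
      then have "l i / 2 < l i"
        using pos[OF lS i] by simp
      then have "\<forall>\<^sub>F k in sequentially. l i / 2 < \<theta> (r k) * L (r k) i"
        using l[of i] i sub by (intro order_tendstoD(1)[of _ "l i"]) auto
      then show ?thesis
        by (rule eventually_mono) simp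
    qed
    then have "\<forall>\<^sub>F k in sequentially. \<forall>i\<in>T. l i / 2 \<le> \<theta> (r k) * L (r k) i"
      using finite_subset[OF sub I] by (simp add: eventually_ball_finite)
    moreover have "\<forall>\<^sub>F k in sequentially. \<theta> (r k) < 1/4"
      using t0 by (intro order_tendstoD(2)[OF t]) simp
    ultimately have "\<forall>\<^sub>F k in sequentially. (\<forall>i\<in>T. l i / 2 \<le> \<theta> (r k) * L (r k) i) \<and> \<theta> (r k) < 1/4"
      by (rule eventually_conj)
    then obtain k0 where "\<forall>i\<in>T. l i / 2 \<le> \<theta> (r k0) * L (r k0) i" and small: "\<theta> (r k0) < 1/4"
      by (auto dest: eventually_happens)
    then have ge: "\<theta> (r k0) * L (r k0) i \<ge> l i / 2" if "i \<in> T" for i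
      using that by blast
    \<comment> \<open>By \<open>ge\<close>, this is a multiple of l that the coordinates in
      \<open>T\<close> can lose and stay nonnegative: eventually they keep at least half of their
      limit. The bound \<theta> < 1/4 makes it larger than 2.\<close>
    define u where "u = inverse (2 * \<theta> (r k0))"
    have u: "2 < u"
      using small \<theta>(1)[of "r k0"] by (simp add: u_def field_simps)
    define l' where "l' i = L (r k0) i - u * l i" for i
    have geL: "u * l i \<le> L (r k0) i" if "i \<in> T" for i
      using ge[OF that] \<theta>(1)[of "r k0"] by (simp add: u_def field_simps)
    have Lk: "L (r k0) \<in> S"
      using L[of "r k0"] by (simp add: F_def)
    \<comment> \<open>Since l vanishes off \<open>T\<close>, the subtraction changes coordinates in
      \<open>T\<close> only, where \<open>repl\<close> asks for nonnegativity.\<close>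
    have l'S: "l' \<in> S"
      by (rule repl[OF Lk]) (use l0 geL in \<open>auto simp: l'_def\<close>)
    have lin: "(\<Sum>i\<in>I. l' i * c i) = (\<Sum>i\<in>I. L (r k0) i * c i) - u * (\<Sum>i\<in>I. l i * c i)" for c
      by (simp add: l'_def left_diff_distrib sum_subtractf sum_distrib_left mult.assoc)
    have "l' \<in> F (y (r k0))"
      using L[of "r k0"] l'S by (simp add: F_def lin lM0 lb0)
    then have "N (L (r k0)) \<le> N l' + 1"
      by (rule Lmin)
    \<comment> \<open>No sign changes occur, so absolute values subtract exactly and the norm falls
      by u times \<open>N l\<close>, which is u.\<close>
    moreover have "\<bar>l' i\<bar> = \<bar>L (r k0) i\<bar> - u * \<bar>l i\<bar>" if "i \<in> I" for i
    proof (cases "i \<in> T")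
      case True
      then show ?thesis
        using geL[OF True] pos[OF lS True] pos[OF Lk True] by (simp add: l'_def)
    next
      case False
      then show ?thesis
        using l0[of i] that by (simp add: l'_def)
    qed
    then have "N l' = N (L (r k0)) - u * N l"
      by (simp add: N_def sum_subtractf sum_distrib_left)
    ultimately show False
      using u \<open>N l = 1\<close> by simp
  qed
  ultimately have t: "0 < t"
    by simp
  have scal: "(\<Sum>i\<in>I. (l i / t) * c i) = (\<Sum>i\<in>I. l i * c i) / t" for c
    by (simp add: sum_divide_distrib)
  have "(\<lambda>i. inverse t * l i) \<in> S"
    using S(2) lS t by (simp add: fun_cone_def)
  then have "(\<lambda>i. l i / t) \<in> S"
    by (simp add: divide_inverse mult.commute)
  then show "y' \<in> ?G"
    using lM lb t unfolding mem_Collect_eq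
    by (intro bexI[of _ "\<lambda>i. l i / t"] conjI ballI) (simp_all only: scal, simp_all add: field_simps)
qed

text \<open>If (g, v) were outside the closed cone \<open>G\<close> of attainable pairs, a
  separating functional (x, \<sigma>) would put \<sigma> b + M x into \<open>K\<close> by the
  bipolar theorem. Either -x/\<sigma> is then a feasible point with value above v, or \<sigma> = 0
  and -x is a recession direction along which the objective is unbounded. Both contradict
  \<open>bounded\<close>.\<close>

theorem refined_conic_duality:
  fixes M :: "'i \<Rightarrow> 'j \<Rightarrow> real" and b :: "'i \<Rightarrow> real"
  assumes I: "finite I" and J: "finite J" and K: "coord_closed I K" "fun_cone K"
    and sub: "T \<subseteq> I"
    and pos: "\<And>l i. \<lbrakk>l \<in> fun_dual I K; i \<in> T\<rbrakk> \<Longrightarrow> 0 \<le> l i"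
    and repl: "\<And>l l'. \<lbrakk>l \<in> fun_dual I K; \<And>i. i \<in> I - T \<Longrightarrow> l' i = l i; \<And>i. i \<in> T \<Longrightarrow> 0 \<le> l' i\<rbrakk>
      \<Longrightarrow> l' \<in> fun_dual I K"
    and feas: "(\<lambda>i. b i - (\<Sum>j\<in>J. M i j * z0 j)) \<in> K"
    and strict: "\<And>l i. \<lbrakk>l \<in> fun_dual I K; (\<Sum>i\<in>I. l i * (b i - (\<Sum>j\<in>J. M i j * z0 j))) = 0; i \<in> I - T\<rbrakk>
      \<Longrightarrow> l i = 0"
    and bounded: "\<And>z. (\<lambda>i. b i - (\<Sum>j\<in>J. M i j * z j)) \<in> K \<Longrightarrow> (\<Sum>j\<in>J. g j * z j) \<le> v"
  shows "\<exists>l\<in>fun_dual I K. (\<forall>j\<in>J. (\<Sum>i\<in>I. l i * M i j) = g j) \<and> (\<Sum>i\<in>I. l i * b i) \<le> v"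
proof -
  let ?S = "fun_dual I K"
  define G where "G = {y. \<exists>l\<in>?S. (\<forall>j\<in>J. (\<Sum>i\<in>I. l i * M i j) = y (Some j)) \<and> (\<Sum>i\<in>I. l i * b i) \<le> y None}"
  have pair: "(\<Sum>i\<in>I. l i * (b i - (\<Sum>j\<in>J. M i j * z j)))
      = (\<Sum>i\<in>I. l i * b i) - (\<Sum>j\<in>J. (\<Sum>i\<in>I. l i * M i j) * z j)" for l z
  proof -
    have "(\<Sum>i\<in>I. l i * (\<Sum>j\<in>J. M i j * z j)) = (\<Sum>i\<in>I. \<Sum>j\<in>J. l i * M i j * z j)"
      by (simp add: sum_distrib_left mult.assoc)
    also have "\<dots> = (\<Sum>j\<in>J. (\<Sum>i\<in>I. l i * M i j) * z j)"
      by (subst sum.swap) (simp add: sum_distrib_right)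
    finally show ?thesis
      by (simp add: right_diff_distrib sum_subtractf)
  qed
  have J': "finite (insert None (Some ` J))"
    using J by simp
  have Gcl: "coord_closed (insert None (Some ` J)) G"
    unfolding G_def
    thm coord_closed_dual_image[where T = T and S = "fun_dual I K" and M = M and b = b and J = J and I = I]
  proof (rule coord_closed_dual_image[where T = T])
    show "finite I" "T \<subseteq> I" "coord_closed I ?S" "fun_cone ?S"
      by (fact I sub coord_closed_fun_dual fun_cone_fun_dual)+
    show "0 \<le> l i" if "l \<in> ?S" "i \<in> T" for l i
      using pos that by blast
    show "l' \<in> ?S" if "l \<in> ?S" "\<And>i. i \<in> I - T \<Longrightarrow> l' i = l i" "\<And>i. i \<in> T \<Longrightarrow> 0 \<le> l' i" for l l'
      using repl that by blast
  next
    \<comment> \<open>For a multiplier in the kernel of the adjoint, pairing with b equals pairing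
      with the slack at \<open>z0\<close>. Slater-type information about the slack thus becomes the
      kernel conditions of closedness.\<close>
    fix l assume l: "l \<in> ?S" "\<And>j. j \<in> J \<Longrightarrow> (\<Sum>i\<in>I. l i * M i j) = 0"
    then have eq: "(\<Sum>i\<in>I. l i * (b i - (\<Sum>j\<in>J. M i j * z0 j))) = (\<Sum>i\<in>I. l i * b i)"
      by (simp add: pair)
    show "0 \<le> (\<Sum>i\<in>I. l i * b i)"
      using l(1) feas unfolding eq[symmetric] by (simp add: fun_dual_def)
    show "l i = 0" if "(\<Sum>i\<in>I. l i * b i) = 0" "i \<in> I - T" for i
      using strict[OF l(1) _ that(2)] that(1) eq by simp
  qed
  have Gc: "fun_cone G"
    unfolding fun_cone_def
  proof (intro conjI ballI allI impI)
    show "(\<lambda>_. 0) \<in> G"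
      unfolding G_def using fun_cone_fun_dual[of I K]
      by (auto simp: fun_cone_def intro!: bexI[of _ "\<lambda>_. 0"])
  next
    fix x y assume "x \<in> G" "y \<in> G"
    then obtain l l' where "l \<in> ?S" "\<forall>j\<in>J. (\<Sum>i\<in>I. l i * M i j) = x (Some j)" "(\<Sum>i\<in>I. l i * b i) \<le> x None"
      "l' \<in> ?S" "\<forall>j\<in>J. (\<Sum>i\<in>I. l' i * M i j) = y (Some j)" "(\<Sum>i\<in>I. l' i * b i) \<le> y None"
      unfolding G_def by blast
    then show "(\<lambda>i. x i + y i) \<in> G"
      unfolding G_def using fun_cone_fun_dual[of I K]
      by (auto simp: fun_cone_def distrib_right sum.distrib intro!: bexI[of _ "\<lambda>i. l i + l' i"])
  next
    fix x and t :: real assume "x \<in> G" and t: "0 \<le> t"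
    then obtain l where "l \<in> ?S" "\<forall>j\<in>J. (\<Sum>i\<in>I. l i * M i j) = x (Some j)" "(\<Sum>i\<in>I. l i * b i) \<le> x None"
      unfolding G_def by blast
    then show "(\<lambda>i. t * x i) \<in> G"
      unfolding G_def using fun_cone_fun_dual[of I K] t
      by (auto simp: fun_cone_def mult.assoc mult_left_mono simp flip: sum_distrib_left
          intro!: bexI[of _ "\<lambda>i. t * l i"])
  qed
  define w where "w j = (case j of None \<Rightarrow> v | Some j' \<Rightarrow> g j')" for j
  have "w \<in> G"
  proof (rule ccontr)
    assume "w \<notin> G"
    from closed_cone_separation[OF J' Gcl Gc this]
    obtain z where z: "z \<in> fun_dual (insert None (Some ` J)) G" "(\<Sum>j\<in>insert None (Some ` J). z j * w j) < 0"
      by blast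
    define x where "x j = z (Some j)" for j
    define \<sigma> where "\<sigma> = z None"
    have split: "(\<Sum>j\<in>insert None (Some ` J). z j * y j) = \<sigma> * y None + (\<Sum>j\<in>J. x j * y (Some j))" for y
      using J by (simp add: x_def \<sigma>_def sum.reindex)
    have neg: "\<sigma> * v + (\<Sum>j\<in>J. g j * x j) < 0"
      using z(2) unfolding split by (simp add: w_def mult.commute)
    have nonneg: "0 \<le> \<sigma> * (\<Sum>i\<in>I. l i * b i) + (\<Sum>j\<in>J. (\<Sum>i\<in>I. l i * M i j) * x j)" if "l \<in> ?S" for l
    proof -
      define y where "y j = (case j of None \<Rightarrow> (\<Sum>i\<in>I. l i * b i) | Some j' \<Rightarrow> (\<Sum>i\<in>I. l i * M i j'))" for j
      have "y \<in> G"
        unfolding G_def y_def using that by auto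
      then have "0 \<le> (\<Sum>j\<in>insert None (Some ` J). z j * y j)"
        using z(1) by (simp add: fun_dual_def)
      then show ?thesis
        unfolding split by (simp add: y_def mult.commute)
    qed
    \<comment> \<open>The last coordinate of \<open>G\<close> may grow freely; testing the
      functional on that direction fixes the sign of \<sigma>.\<close>
    have "(\<lambda>j. if j = None then 1 else 0) \<in> G"
      unfolding G_def using fun_cone_fun_dual[of I K]
      by (auto simp: fun_cone_def intro!: bexI[of _ "\<lambda>_. 0"])
    then have "0 \<le> (\<Sum>j\<in>insert None (Some ` J). z j * (if j = None then 1 else 0))"
      using z(1) by (simp add: fun_dual_def)
    then have \<sigma>: "0 \<le> \<sigma>"
      unfolding split by simp
    have mem: "(\<lambda>i. \<sigma> * b i + (\<Sum>j\<in>J. M i j * x j)) \<in> K"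
    proof (rule fun_dual_fun_dual[OF I K])
      fix l assume l: "l \<in> ?S"
      have "(\<Sum>i\<in>I. l i * (\<Sum>j\<in>J. M i j * x j)) = (\<Sum>j\<in>J. (\<Sum>i\<in>I. l i * M i j) * x j)"
        using pair[of l x] by (simp add: right_diff_distrib sum_subtractf)
      then show "0 \<le> (\<Sum>i\<in>I. l i * (\<sigma> * b i + (\<Sum>j\<in>J. M i j * x j)))"
        using nonneg[OF l] by (simp add: distrib_left sum.distrib sum_distrib_left mult.left_commute)
    qed
    show False
    proof (cases "\<sigma> = 0")
      case True
      \<comment> \<open>Moving from \<open>z0\<close> by -t x adds t M x, an element of
        \<open>K\<close>, to the slack, so every such point is feasible.\<close>
      have step: "(\<Sum>j\<in>J. g j * z0 j) - t * (\<Sum>j\<in>J. g j * x j) \<le> v" if t: "0 \<le> t" for t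
      proof -
        have "(\<lambda>i. t * (\<Sum>j\<in>J. M i j * x j)) \<in> K"
          using mem K(2) t True by (simp add: fun_cone_def)
        then have "(\<lambda>i. (b i - (\<Sum>j\<in>J. M i j * z0 j)) + t * (\<Sum>j\<in>J. M i j * x j)) \<in> K"
          using feas K(2) by (auto simp: fun_cone_def)
        then have "(\<lambda>i. b i - (\<Sum>j\<in>J. M i j * (z0 j - t * x j))) \<in> K"
          by (simp add: algebra_simps sum_subtractf sum_distrib_left)
        from bounded[OF this] show ?thesis
          by (simp add: right_diff_distrib sum_subtractf sum_distrib_left mult.left_commute)
      qed
      define \<gamma> where "\<gamma> = - (\<Sum>j\<in>J. g j * x j)"
      have "0 < \<gamma>"
        using neg True by (simp add: \<gamma>_def)
      moreover have "0 \<le> v - (\<Sum>j\<in>J. g j * z0 j)"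
        using bounded[OF feas] by simp
      \<comment> \<open>This step length makes the objective reach v + 1.\<close>
      ultimately show False
        using step[of "(v - (\<Sum>j\<in>J. g j * z0 j) + 1) / \<gamma>"] by (simp add: \<gamma>_def field_simps)
    next
      case False
      then have \<sigma>: "0 < \<sigma>"
        using \<sigma> by simp
      have "(\<lambda>i. inverse \<sigma> * (\<sigma> * b i + (\<Sum>j\<in>J. M i j * x j))) \<in> K"
        using mem K(2) \<sigma> by (simp add: fun_cone_def)
      also have "(\<lambda>i. inverse \<sigma> * (\<sigma> * b i + (\<Sum>j\<in>J. M i j * x j)))
          = (\<lambda>i. b i - (\<Sum>j\<in>J. M i j * (- inverse \<sigma> * x j)))"
        using \<sigma> by (simp add: distrib_left sum_distrib_left sum_negf mult.left_commute flip: mult.assoc)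
      finally have "(\<Sum>j\<in>J. g j * (- inverse \<sigma> * x j)) \<le> v"
        by (rule bounded)
      then have "- inverse \<sigma> * (\<Sum>j\<in>J. g j * x j) \<le> v"
        by (simp add: sum_distrib_left sum_negf mult.left_commute)
      then show False
        using neg \<sigma> by (simp add: field_simps)
    qed
  qed
  then show ?thesis
    unfolding G_def by (auto simp: w_def)
qed

subsection \<open>A minimax theorem\<close>

definition concave_on_vec :: "real vec set \<Rightarrow> (real vec \<Rightarrow> real) \<Rightarrow> bool" where
  "concave_on_vec S f \<longleftrightarrow> convex_fun_vec S (\<lambda>x. - f x)"

lemma concave_on_vecD:
  assumes "concave_on_vec S f" "x \<in> S" "y \<in> S" "0 \<le> t" "t \<le> 1"
  shows "(1 - t) * f x + t * f y \<le> f ((1 - t) \<cdot>\<^sub>v x + t \<cdot>\<^sub>v y)"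
  using assms unfolding concave_on_vec_def convex_fun_vec_def by (auto simp: algebra_simps)

lemma convex_fun_vecD:
  assumes "convex_fun_vec S f" "x \<in> S" "y \<in> S" "0 \<le> t" "t \<le> 1"
  shows "f ((1 - t) \<cdot>\<^sub>v x + t \<cdot>\<^sub>v y) \<le> (1 - t) * f x + t * f y"
  using assms unfolding convex_fun_vec_def by auto

lemma convex_set_vecD:
  assumes "convex_set_vec S" "x \<in> S" "y \<in> S" "0 \<le> t" "t \<le> 1"
  shows "(1 - t) \<cdot>\<^sub>v x + t \<cdot>\<^sub>v y \<in> S"
  using assms unfolding convex_set_vec_def by auto

lemma concave_on_vec_subset:
  "\<lbrakk>concave_on_vec S f; S' \<subseteq> S; convex_set_vec S'\<rbrakk> \<Longrightarrow> concave_on_vec S' f"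
  unfolding concave_on_vec_def convex_fun_vec_def by blast

lemma convex_set_vec_superlevel:
  assumes "concave_on_vec S f"
  shows "convex_set_vec {x\<in>S. v \<le> f x}"
  unfolding convex_set_vec_def
proof (intro ballI)
  fix x y and t :: real
  assume xy: "x \<in> {x\<in>S. v \<le> f x}" "y \<in> {x\<in>S. v \<le> f x}" and t: "t \<in> {0..1}"
  then have "v \<le> (1 - t) * f x + t * f y"
    using convex_bound_le[of "- f x" "- v" "- f y" "1 - t" t] by simp
  also have "\<dots> \<le> f ((1 - t) \<cdot>\<^sub>v x + t \<cdot>\<^sub>v y)"
    using xy t by (intro concave_on_vecD[OF assms]) auto
  finally show "(1 - t) \<cdot>\<^sub>v x + t \<cdot>\<^sub>v y \<in> {x\<in>S. v \<le> f x}"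
    using assms xy t by (auto simp: concave_on_vec_def convex_fun_vec_def intro!: convex_set_vecD)
qed

lemma compactin_attains_sup:
  assumes "compactin T X" "X \<noteq> {}" "continuous_map T euclideanreal f"
  shows "\<exists>x\<in>X. \<forall>y\<in>X. f y \<le> f x"
  using compact_attains_sup[of "f ` X"] image_compactin[OF assms(1,3)] assms(2) by auto

text \<open>A two-function theorem of the alternative. The pairs dominated by some (f x, g x) form a
  convex set in the plane; if no x served both functions, a line would separate it from a quadrant,
  and the normalised normal would be a weight t violating \<open>comb\<close>.\<close>

lemma common_superlevel_point:
  assumes X: "compactin T X" "X \<noteq> {}"
    and cont: "continuous_map T euclideanreal f" "continuous_map T euclideanreal g"
    and conc: "concave_on_vec X f" "concave_on_vec X g"
    and comb: "\<And>t. \<lbrakk>0 \<le> t; t \<le> 1\<rbrakk> \<Longrightarrow> \<exists>x\<in>X. v \<le> (1 - t) * f x + t * g x"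
  shows "\<exists>x\<in>X. v \<le> f x \<and> v \<le> g x"
proof (rule ccontr)
  assume none: "\<not> ?thesis"
  obtain x0 where x0: "x0 \<in> X" "\<And>x. x \<in> X \<Longrightarrow> min (f x) (g x) \<le> min (f x0) (g x0)"
    using compactin_attains_sup[OF X continuous_map_real_min[OF cont]] by auto
  have "min (f x0) (g x0) < v"
    using none x0(1) by force
  \<comment> \<open>The hyperplane separates only weakly. Placing the quadrant at a level strictly
    below v, yet above the best common value, restores the strict inequality needed at the
    end.\<close>
  then obtain v' where v': "min (f x0) (g x0) < v'" "v' < v"
    using dense by blast
  \<comment> \<open>Concavity does not make the image of (f, g) convex, but it does so for the
    downward closure of the image.\<close>
  define S where "S = {p. \<exists>x\<in>X. fst p \<le> f x \<and> snd p \<le> g x}"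
  define U where "U = {p. v' \<le> fst p \<and> v' \<le> snd p}"
  have "convex S"
  proof (rule convexI)
    fix p q and a b :: real
    assume pq: "p \<in> S" "q \<in> S" and ab: "0 \<le> a" "0 \<le> b" "a + b = 1"
    then obtain x y where x: "x \<in> X" "fst p \<le> f x" "snd p \<le> g x"
      and y: "y \<in> X" "fst q \<le> f y" "snd q \<le> g y"
      by (auto simp: S_def)
    have a: "a = 1 - b"
      using ab by simp
    have "a * fst p + b * fst q \<le> (1 - b) * f x + b * f y" "a * snd p + b * snd q \<le> (1 - b) * g x + b * g y"
      unfolding a[symmetric] using x y ab by (auto intro!: add_mono mult_left_mono)
    moreover have "(1 - b) * f x + b * f y \<le> f ((1 - b) \<cdot>\<^sub>v x + b \<cdot>\<^sub>v y)"
      "(1 - b) * g x + b * g y \<le> g ((1 - b) \<cdot>\<^sub>v x + b \<cdot>\<^sub>v y)"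
      using x y ab conc by (auto intro!: concave_on_vecD)
    moreover have "(1 - b) \<cdot>\<^sub>v x + b \<cdot>\<^sub>v y \<in> X"
      using x y ab conc by (auto simp: concave_on_vec_def convex_fun_vec_def intro!: convex_set_vecD)
    ultimately show "a *\<^sub>R p + b *\<^sub>R q \<in> S"
      unfolding S_def by force
  qed
  moreover have "convex U"
    unfolding U_def
  proof (rule convexI)
    fix p q :: "real \<times> real" and a b :: real
    assume "p \<in> {p. v' \<le> fst p \<and> v' \<le> snd p}" "q \<in> {p. v' \<le> fst p \<and> v' \<le> snd p}"
      and ab: "0 \<le> a" "0 \<le> b" "a + b = 1"
    then show "a *\<^sub>R p + b *\<^sub>R q \<in> {p. v' \<le> fst p \<and> v' \<le> snd p}"
      using convex_bound_le[of "- fst p" "- v'" "- fst q" a b]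
        convex_bound_le[of "- snd p" "- v'" "- snd q" a b] by simp
  qed
  moreover have "(f x0, g x0) \<in> S" "(v', v') \<in> U"
    using x0(1) by (auto simp: S_def U_def)
  moreover have "S \<inter> U = {}"
    using x0 v' by (fastforce simp: S_def U_def)
  ultimately obtain ab c where ab: "ab \<noteq> 0" "\<And>p. p \<in> S \<Longrightarrow> inner ab p \<le> c" "\<And>p. p \<in> U \<Longrightarrow> c \<le> inner ab p"
    using separating_hyperplane_sets[of S U] by blast
  obtain \<alpha> \<beta> where ab_eq: "ab = (\<alpha>, \<beta>)"
    by (cases ab)
  have S: "\<alpha> * f x + \<beta> * g x \<le> c" if "x \<in> X" for x
    using ab(2)[of "(f x, g x)"] that by (auto simp: ab_eq S_def)
  have U: "c \<le> \<alpha> * (v' + p) + \<beta> * (v' + q)" if "0 \<le> p" "0 \<le> q" for p q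
    using ab(3)[of "(v' + p, v' + q)"] that by (auto simp: ab_eq U_def)
  \<comment> \<open>A linear function bounded below on a ray has nonnegative slope. The quadrant
    contains rays in both coordinate directions, so both entries of the normal are
    nonnegative.\<close>
  have nonneg: "0 \<le> \<gamma>" if "\<And>p. 0 \<le> p \<Longrightarrow> c \<le> d + \<gamma> * p" for \<gamma> d :: real
  proof (rule ccontr)
    assume neg: "\<not> 0 \<le> \<gamma>"
    define p where "p = (d - c + 1) / (- \<gamma>)"
    have "c \<le> d"
      using that[of 0] by simp
    then have "0 \<le> p"
      using neg by (simp add: p_def divide_nonneg_neg divide_nonneg_pos)
    moreover have "\<gamma> * p = - (d - c + 1)"
      using neg by (simp add: p_def)
    ultimately show False
      using that[of p] by linarith
  qed
  have "0 \<le> \<alpha>"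
    by (rule nonneg[of "\<alpha> * v' + \<beta> * v'"]) (use U[of _ 0] in \<open>simp add: algebra_simps\<close>)
  moreover have "0 \<le> \<beta>"
    by (rule nonneg[of "\<alpha> * v' + \<beta> * v'"]) (use U[of 0] in \<open>simp add: algebra_simps\<close>)
  ultimately have pos: "0 < \<alpha> + \<beta>" "0 \<le> \<alpha>" "0 \<le> \<beta>"
    using ab(1) by (auto simp: ab_eq zero_prod_def)
  define t where "t = \<beta> / (\<alpha> + \<beta>)"
  have t: "0 \<le> t" "t \<le> 1" "(\<alpha> + \<beta>) * t = \<beta>"
    using pos by (auto simp: t_def)
  then obtain x where x: "x \<in> X" "v \<le> (1 - t) * f x + t * g x"
    using comb by blast
  have "(\<alpha> + \<beta>) * v \<le> (\<alpha> + \<beta>) * ((1 - t) * f x + t * g x)"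
    using x(2) pos by (intro mult_left_mono) auto
  also have "\<dots> = (\<alpha> + \<beta> - (\<alpha> + \<beta>) * t) * f x + ((\<alpha> + \<beta>) * t) * g x"
    by (simp add: algebra_simps)
  also have "\<dots> \<le> c"
    using S[OF x(1)] unfolding t(3) by simp
  also have "c \<le> (\<alpha> + \<beta>) * v'"
    using U[of 0 0] by (simp add: algebra_simps)
  finally show False
    using v'(2) pos by simp
qed

text \<open>By compactness it suffices to serve finitely many y. They are treated one at a time: the
  superlevel set of the first is a smaller compact convex set, and
  \<open>common_superlevel_point\<close> shows that each remaining y can still be served inside it.
  Hence the induction generalises over \<open>Z\<close>.\<close>

theorem minimax_point:
  assumes X: "compactin T X" "X = topspace T" and Y: "Y \<noteq> {}"
    and cont: "\<And>y. y \<in> Y \<Longrightarrow> continuous_map T euclideanreal (\<lambda>x. \<phi> x y)"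
    and conc: "\<And>y. y \<in> Y \<Longrightarrow> concave_on_vec X (\<lambda>x. \<phi> x y)"
    and conv: "\<And>x. x \<in> X \<Longrightarrow> convex_fun_vec Y (\<phi> x)"
    and ge: "\<And>y. y \<in> Y \<Longrightarrow> \<exists>x\<in>X. v \<le> \<phi> x y"
  shows "\<exists>x\<in>X. \<forall>y\<in>Y. v \<le> \<phi> x y"
proof -
  have fin: "\<exists>x\<in>Z. \<forall>y\<in>F. v \<le> \<phi> x y"
    if "finite F" "F \<subseteq> Y" "closedin T Z" "convex_set_vec Z" "\<And>y. y \<in> Y \<Longrightarrow> \<exists>x\<in>Z. v \<le> \<phi> x y" for F Z
    using that
  proof (induction F arbitrary: Z rule: finite_induct)
    case empty
    then show ?case
      using Y by blast
  next
    case (insert y0 F)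
    have ZX: "Z \<subseteq> X"
      using closedin_subset[OF insert.prems(2)] X(2) by simp
    have Zc: "compactin T Z"
      using closed_compactin[OF X(1) ZX insert.prems(2)] .
    have y0: "y0 \<in> Y"
      using insert.prems(1) by simp
    define Z' where "Z' = {x\<in>Z. v \<le> \<phi> x y0}"
    have "Z' = Z \<inter> {x\<in>topspace T. \<phi> x y0 \<in> {v..}}"
      using ZX X(2) by (auto simp: Z'_def)
    then have "closedin T Z'"
      using insert.prems(2) closedin_continuous_map_preimage[OF cont[OF y0], of "{v..}"]
      by (auto intro!: closedin_Int)
    moreover have "convex_set_vec Z'"
      unfolding Z'_def
      by (rule convex_set_vec_superlevel[OF concave_on_vec_subset[OF conc[OF y0] ZX insert.prems(3)]])
    moreover have "\<exists>x\<in>Z'. v \<le> \<phi> x y" if y: "y \<in> Y" for y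
    proof -
      have "\<exists>x\<in>Z. v \<le> \<phi> x y0 \<and> v \<le> \<phi> x y"
      proof (rule common_superlevel_point[OF Zc])
        show "Z \<noteq> {}"
          using insert.prems(4)[OF y0] by blast
        show "concave_on_vec Z (\<lambda>x. \<phi> x y0)" "concave_on_vec Z (\<lambda>x. \<phi> x y)"
          using conc[OF y0] conc[OF y] ZX insert.prems(3) by (auto intro: concave_on_vec_subset)
        fix t :: real assume t: "0 \<le> t" "t \<le> 1"
        obtain x1 where "x1 \<in> X"
          using insert.prems(4)[OF y0] ZX by blast
        then have "convex_set_vec Y"
          using conv by (auto simp: convex_fun_vec_def)
        \<comment> \<open>An x serving the intermediate point of \<open>Y\<close> serves the
          weighted sum, by convexity in y; this is where weights on functions become points of
          \<open>Y\<close>.\<close>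
        from convex_set_vecD[OF this y0 y t]
        obtain x where x: "x \<in> Z" "v \<le> \<phi> x ((1 - t) \<cdot>\<^sub>v y0 + t \<cdot>\<^sub>v y)"
          using insert.prems(4) by blast
        then show "\<exists>x\<in>Z. v \<le> (1 - t) * \<phi> x y0 + t * \<phi> x y"
          using convex_fun_vecD[OF conv y0 y t] ZX by (meson order_trans subsetD)
      qed (use cont y0 y in auto)
      then show ?thesis
        by (auto simp: Z'_def)
    qed
    ultimately have "\<exists>x\<in>Z'. \<forall>y\<in>F. v \<le> \<phi> x y"
      using insert.IH insert.prems(1) by simp
    then show ?case
      by (auto simp: Z'_def)
  qed
  have Xconv: "convex_set_vec X"
    using conc Y by (auto simp: concave_on_vec_def convex_fun_vec_def)
  have Xcl: "closedin T X"
    by (simp add: X(2))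
  define C where "C y = {x\<in>topspace T. \<phi> x y \<in> {v..}}" for y
  have "compact_space T"
    using X by (simp add: compact_space_def)
  moreover have "\<forall>S\<in>C ` Y. closedin T S"
    unfolding C_def using closedin_continuous_map_preimage[OF cont, of _ "{v..}"] by auto
  moreover have "\<forall>\<F>. finite \<F> \<and> \<F> \<subseteq> C ` Y \<longrightarrow> \<Inter>\<F> \<noteq> {}"
  proof (intro allI impI, elim conjE)
    fix \<F> assume "finite \<F>" "\<F> \<subseteq> C ` Y"
    then obtain F where F: "F \<subseteq> Y" "finite F" "\<F> = C ` F"
      by (meson finite_subset_image)
    obtain x where "x \<in> X" "\<forall>y\<in>F. v \<le> \<phi> x y"
      using fin[OF F(2,1) Xcl Xconv ge] by blast
    then have "x \<in> \<Inter>\<F>"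
      using X(2) by (auto simp: F(3) C_def)
    then show "\<Inter>\<F> \<noteq> {}"
      by blast
  qed
  ultimately have "\<Inter>(C ` Y) \<noteq> {}"
    unfolding compact_space_fip by blast
  then show ?thesis
    using Y X(2) by (auto simp: C_def)
qed

subsection \<open>Coordinates of vectors\<close>

lemma topspace_eucl_top [simp]: "topspace (eucl_top n) = carrier_vec n"
  by (simp add: eucl_top_def Metric_space.topspace_mtopology[OF Metric_space_eucl])

lemma scalar_prod_sum: "x \<in> carrier_vec n \<Longrightarrow> y \<bullet> x = (\<Sum>i<n. y $ i * x $ i)"
  by (simp add: scalar_prod_def atLeast0LessThan)

lemma component_le_eucl_dist: "i < n \<Longrightarrow> \<bar>x $ i - y $ i\<bar> \<le> eucl_dist n x y"
  using member_le_L2_set[of "{..<n}" i "\<lambda>i. \<bar>x $ i - y $ i\<bar>"]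
  by (simp add: eucl_dist_def L2_set_def)

lemma eucl_dist_le_sum: "eucl_dist n x y \<le> (\<Sum>i<n. \<bar>x $ i - y $ i\<bar>)"
  unfolding eucl_dist_def by (rule L2_set_le_sum_abs)

lemma continuous_map_real_iff:
  "continuous_map T euclideanreal f \<longleftrightarrow>
    (\<forall>x \<in> topspace T. \<forall>\<epsilon>>0. \<exists>U. openin T U \<and> x \<in> U \<and> (\<forall>y\<in>U. \<bar>f y - f x\<bar> < \<epsilon>))"
  using Met_TC.continuous_map_to_metric[of T f] by (simp add: dist_real_def abs_minus_commute)

lemma openin_eucl_ball:
  assumes "x \<in> carrier_vec n"
  shows "openin (eucl_top n) {y \<in> carrier_vec n. eucl_dist n x y < \<epsilon>}"
proof -
  have "{y \<in> carrier_vec n. eucl_dist n x y < \<epsilon>} = Metric_space.mball (carrier_vec n) (eucl_dist n) x \<epsilon>"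
    using assms by (auto simp: Metric_space.in_mball[OF Metric_space_eucl])
  then show ?thesis
    by (simp add: eucl_top_def Metric_space.openin_mball[OF Metric_space_eucl])
qed

lemma eucl_dist_self [simp]: "eucl_dist n x x = 0"
  by (simp add: eucl_dist_def L2_set_def)

lemma continuous_map_component:
  assumes "i < n"
  shows "continuous_map (eucl_top n) euclideanreal (\<lambda>x. x $ i)"
  unfolding continuous_map_real_iff
proof (intro ballI allI impI)
  fix x and \<epsilon> :: real assume "x \<in> topspace (eucl_top n)" "0 < \<epsilon>"
  then show "\<exists>U. openin (eucl_top n) U \<and> x \<in> U \<and> (\<forall>y\<in>U. \<bar>y $ i - x $ i\<bar> < \<epsilon>)"
    using component_le_eucl_dist[OF assms, of x] openin_eucl_ball[of x n \<epsilon>]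
    by (intro exI[of _ "{y \<in> carrier_vec n. eucl_dist n x y < \<epsilon>}"])
      (auto simp: abs_minus_commute intro: le_less_trans)
qed

lemma continuous_map_scalar_prod: "continuous_map (eucl_top n) euclideanreal (\<lambda>x. p \<bullet> x)"
proof (rule continuous_map_eq)
  show "continuous_map (eucl_top n) euclideanreal (\<lambda>x. \<Sum>i<n. p $ i * x $ i)"
    by (intro continuous_map_sum continuous_map_real_mult_left continuous_map_component) auto
qed (simp add: scalar_prod_sum)

lemma compactin_eucl_component_bound:
  assumes "compactin (eucl_top n) X"
  shows "\<exists>b\<ge>0. \<forall>x\<in>X. \<forall>i<n. \<bar>x $ i\<bar> \<le> b"
proof -
  have "\<exists>b\<ge>0. \<forall>x\<in>X. \<bar>x $ i\<bar> \<le> b" if "i < n" for i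
  proof -
    have "compact ((\<lambda>x. x $ i) ` X)"
      using image_compactin[OF assms continuous_map_component[OF that]] by simp
    then obtain b where "\<forall>y\<in>(\<lambda>x. x $ i) ` X. norm y \<le> b"
      using compact_imp_bounded bounded_iff by metis
    then show ?thesis
      by (intro exI[of _ "max b 0"]) force
  qed
  then obtain b where b: "\<And>i. i < n \<Longrightarrow> 0 \<le> b i" "\<And>i x. \<lbrakk>i < n; x \<in> X\<rbrakk> \<Longrightarrow> \<bar>x $ i\<bar> \<le> b i"
    by metis
  have "b i \<le> sum b {..<n}" if "i < n" for i
    by (rule member_le_sum) (use b that in auto)
  then show ?thesis
    using b by (intro exI[of _ "sum b {..<n}"]) (meson lessThan_iff order_trans sum_nonneg)
qed

text \<open>Passage from the metric topology to coordinates: the sum of the coordinate differences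
  dominates the Euclidean distance, and closed sets of a metric space are sequentially
  closed.\<close>

lemma coord_closed_of_closedin:
  assumes "closedin (eucl_top k) K"
  shows "coord_closed {..<k} {f. vec k f \<in> K}"
  unfolding coord_closed_def
proof (intro allI impI)
  fix x :: "nat \<Rightarrow> nat \<Rightarrow> real" and l
  assume x: "\<forall>j. x j \<in> {f. vec k f \<in> K}" and lim: "\<forall>i\<in>{..<k}. (\<lambda>j. x j i) \<longlonglongrightarrow> l i"
  interpret E: Metric_space "carrier_vec k" "eucl_dist k"
    by (rule Metric_space_eucl)
  have "(\<lambda>j. \<Sum>i<k. \<bar>x j i - l i\<bar>) \<longlonglongrightarrow> (\<Sum>i<k. \<bar>l i - l i\<bar>)"
    using lim by (intro tendsto_sum tendsto_rabs tendsto_diff tendsto_const) simp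
  then have "(\<lambda>j. \<Sum>i<k. \<bar>x j i - l i\<bar>) \<longlonglongrightarrow> 0"
    by simp
  then have "(\<lambda>j. eucl_dist k (vec k (x j)) (vec k l)) \<longlonglongrightarrow> 0"
  proof (rule Lim_null_comparison[rotated], intro always_eventually allI)
    show "norm (eucl_dist k (vec k (x j)) (vec k l)) \<le> (\<Sum>i<k. \<bar>x j i - l i\<bar>)" for j
      using eucl_dist_le_sum[of k "vec k (x j)" "vec k l"] E.nonneg[of "vec k (x j)" "vec k l"] by simp
  qed
  then have "limitin E.mtopology (\<lambda>j. vec k (x j)) (vec k l) sequentially"
    unfolding E.limitin_metric_dist_null by simp
  moreover have "range (\<lambda>j. vec k (x j)) \<subseteq> K"
    using x by blast
  ultimately show "l \<in> {f. vec k f \<in> K}"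
    using assms unfolding eucl_top_def E.metric_closedin_iff_sequentially_closed by blast
qed

subsection \<open>Regular cones\<close>

lemma regular_coneD:
  assumes "regular_cone k K"
  shows regular_cone_carrier: "K \<subseteq> carrier_vec k"
    and regular_cone_zero: "0\<^sub>v k \<in> K"
    and regular_cone_smult: "\<And>x t. \<lbrakk>x \<in> K; 0 \<le> t\<rbrakk> \<Longrightarrow> t \<cdot>\<^sub>v x \<in> K"
    and regular_cone_add: "\<And>x y. \<lbrakk>x \<in> K; y \<in> K\<rbrakk> \<Longrightarrow> x + y \<in> K"
    and regular_cone_closed: "closedin (eucl_top k) K"
proof -
  show c: "K \<subseteq> carrier_vec k" "closedin (eucl_top k) K"
    using assms by (auto simp: regular_cone_def)
  show s: "t \<cdot>\<^sub>v x \<in> K" if "x \<in> K" "0 \<le> t" for x t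
    using assms that by (auto simp: regular_cone_def)
  obtain x where "x \<in> K"
    using assms by (auto simp: regular_cone_def)
  moreover have "0 \<cdot>\<^sub>v x = 0\<^sub>v k"
    using c(1) \<open>x \<in> K\<close> by (intro eq_vecI) auto
  ultimately show "0\<^sub>v k \<in> K"
    using s[of x 0] by simp
  fix x y assume xy: "x \<in> K" "y \<in> K"
  have "convex_set_vec K"
    using assms by (simp add: regular_cone_def)
  \<comment> \<open>Closure under addition is twice the midpoint: convexity provides the midpoint
    and homogeneity the factor.\<close>
  from convex_set_vecD[OF this xy, of "1/2"]
  have "2 \<cdot>\<^sub>v ((1/2) \<cdot>\<^sub>v x + (1/2) \<cdot>\<^sub>v y) \<in> K"
    by (intro s) auto
  moreover have "2 \<cdot>\<^sub>v ((1/2) \<cdot>\<^sub>v x + (1/2) \<cdot>\<^sub>v y) = x + y"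
  proof (intro eq_vecI)
    have xc: "dim_vec x = k" "dim_vec y = k"
      using xy c(1) by auto
    then show "dim_vec (2 \<cdot>\<^sub>v ((1/2) \<cdot>\<^sub>v x + (1/2) \<cdot>\<^sub>v y)) = dim_vec (x + y)"
      by simp
    show "(2 \<cdot>\<^sub>v ((1/2) \<cdot>\<^sub>v x + (1/2) \<cdot>\<^sub>v y)) $ i = (x + y) $ i" if "i < dim_vec (x + y)" for i
      using that xc by simp
  qed
  ultimately show "x + y \<in> K"
    by simp
qed

lemma regular_cone_dim_unique:
  assumes "regular_cone k K" "K \<subseteq> carrier_vec k'"
  shows "k = k'"
proof -
  have "dim_vec (0\<^sub>v k :: real vec) = k'"
    using subsetD[OF assms(2) regular_cone_zero[OF assms(1)]] by (rule carrier_vecD)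
  then show ?thesis
    by simp
qed

lemma cone_family_regular:
  assumes "cone_family \<K>" "K \<in> \<K>" "K \<subseteq> carrier_vec k"
  shows "regular_cone k K"
proof -
  have "\<forall>K\<in>\<K>. \<exists>k. regular_cone k K"
    using assms(1) unfolding cone_family_def by (elim conjE)
  then obtain k' where k': "regular_cone k' K"
    using assms(2) by (elim ballE exE) auto
  then show ?thesis
    using regular_cone_dim_unique[OF k' assms(3)] by simp
qed

lemma cone_family_dual:
  assumes "cone_family \<K>" "K \<in> \<K>" "K \<subseteq> carrier_vec k"
  shows "dual_cone k K \<in> \<K>"
proof -
  have "\<forall>K\<in>\<K>. \<forall>k. regular_cone k K \<longrightarrow> dual_cone k K \<in> \<K>"
    using assms(1) unfolding cone_family_def by (elim conjE)
  then show ?thesis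
    using cone_family_regular[OF assms] assms(2) by simp
qed

lemma dual_coneD: "\<lbrakk>\<delta> \<in> dual_cone k K; x \<in> K\<rbrakk> \<Longrightarrow> 0 \<le> \<delta> \<bullet> x"
  by (simp add: dual_cone_def)

lemma dual_cone_carrier: "\<delta> \<in> dual_cone k K \<Longrightarrow> \<delta> \<in> carrier_vec k"
  by (simp add: dual_cone_def)

text \<open>A functional that is nonnegative on \<open>L\<close> and zero at an interior point w
  must vanish: from w one can move a little along -d inside \<open>L\<close>, where the functional
  takes the value -t |d|^2.\<close>

lemma interior_dual_zero:
  assumes w: "w \<in> eucl_top l interior_of L" and d: "d \<in> carrier_vec l"
    and nonneg: "\<And>x. x \<in> L \<Longrightarrow> 0 \<le> d \<bullet> x" and zero: "d \<bullet> w = 0"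
  shows "d = 0\<^sub>v l"
proof -
  interpret E: Metric_space "carrier_vec l" "eucl_dist l"
    by (rule Metric_space_eucl)
  obtain \<epsilon> where \<epsilon>: "0 < \<epsilon>" "E.mball w \<epsilon> \<subseteq> L" and wc: "w \<in> carrier_vec l"
  proof -
    have "w \<in> E.mtopology interior_of L"
      using w by (simp only: eucl_top_def)
    then have "w \<in> carrier_vec l \<and> (\<exists>\<epsilon>>0. E.mball w \<epsilon> \<subseteq> L)"
      by (simp only: E.in_interior_of_mball)
    then show ?thesis
      using that by blast
  qed
  define N where "N = L2_set (\<lambda>i. d $ i) {..<l}"
  have N: "0 \<le> N"
    by (simp add: N_def L2_set_nonneg)
  \<comment> \<open>The summand 1 covers d = 0 as well; the displacement t N is then below half the
    radius of the ball.\<close>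
  define t where "t = \<epsilon> / (2 * (N + 1))"
  have t: "0 < t"
    using \<epsilon>(1) N by (simp add: t_def)
  define u where "u = w - t \<cdot>\<^sub>v d"
  have uc: "u \<in> carrier_vec l"
    using wc d by (simp add: u_def)
  have "eucl_dist l w u = t * N"
    unfolding N_def eucl_dist_def L2_set_right_distrib[OF less_imp_le[OF t]]
    by (rule L2_set_cong) (use wc d in \<open>auto simp: u_def\<close>)
  also have "\<dots> < \<epsilon>"
  proof -
    have "t * (N + 1) = \<epsilon> / 2"
      using N by (simp add: t_def field_simps)
    then show ?thesis
      using t \<epsilon>(1) by (simp add: distrib_left)
  qed
  finally have "u \<in> L"
    using \<epsilon>(2) wc uc by auto
  then have "0 \<le> d \<bullet> u"
    by (rule nonneg)
  also have "d \<bullet> u = (\<Sum>i<l. d $ i * w $ i - t * (d $ i * d $ i))"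
    using wc d by (simp add: u_def scalar_prod_sum[OF uc[unfolded u_def]] algebra_simps)
  also have "\<dots> = - t * (d \<bullet> d)"
    using zero by (simp add: scalar_prod_sum[OF wc] scalar_prod_sum[OF d] sum_subtractf sum_distrib_left sum_negf)
  finally have "t * (d \<bullet> d) \<le> 0"
    by simp
  then have "d \<bullet> d \<le> 0"
    using t by (metis mult_pos_pos not_le)
  moreover have "d \<bullet> d = (\<Sum>i<l. (d $ i)^2)"
    by (simp add: scalar_prod_sum[OF d] power2_eq_square)
  moreover have "0 \<le> (\<Sum>i<l. (d $ i)^2)"
    by (intro sum_nonneg zero_le_power2)
  ultimately have zero: "(\<Sum>i<l. (d $ i)^2) = 0"
    by linarith
  have "\<forall>i\<in>{..<l}. (d $ i)^2 = 0"
    using zero by (subst (asm) sum_nonneg_eq_0_iff) (intro finite_lessThan zero_le_power2)+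
  then have "d $ i = 0\<^sub>v l $ i" if "i < l" for i
    using that by simp
  then show ?thesis
    by (intro eq_vecI) (simp_all only: carrier_vecD[OF d] index_zero_vec)
qed

lemma orthant_carrier: "orthant r \<subseteq> carrier_vec r"
  by (auto simp: orthant_def less_eq_vec_def intro: carrier_vecI)

text \<open>The coordinates below \<open>r\<close> form the polyhedral part of the constraint.\<close>

lemma ess_strictly_feasible_dual_cone:
  assumes feas: "ess_strictly_feasible K A b" and A: "dim_row A = k"
  obtains r x where "r \<le> k" "x \<in> carrier_vec (dim_col A)" "b - A *\<^sub>v x \<in> K"
    and "\<And>\<delta> i. \<lbrakk>\<delta> \<in> dual_cone k K; i < r\<rbrakk> \<Longrightarrow> 0 \<le> \<delta> $ i"
    and "\<And>\<delta> \<delta>'. \<lbrakk>\<delta> \<in> dual_cone k K; \<delta>' \<in> carrier_vec k; \<And>i. i < r \<Longrightarrow> 0 \<le> \<delta>' $ i;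
      \<And>i. \<lbrakk>r \<le> i; i < k\<rbrakk> \<Longrightarrow> \<delta>' $ i = \<delta> $ i\<rbrakk> \<Longrightarrow> \<delta>' \<in> dual_cone k K"
    and "\<And>\<delta> i. \<lbrakk>\<delta> \<in> dual_cone k K; \<delta> \<bullet> (b - A *\<^sub>v x) = 0; r \<le> i; i < k\<rbrakk> \<Longrightarrow> \<delta> $ i = 0"
proof -
  obtain r l L x where rl: "r + l = k" and L: "regular_cone l L" and K: "K = orthant r \<times>\<^sub>v L"
    and x: "x \<in> carrier_vec (dim_col A)" "b - A *\<^sub>v x \<in> orthant r \<times>\<^sub>v (eucl_top l interior_of L)"
    using feas[unfolded ess_strictly_feasible_def A] by (elim exE conjE bexE) (rule that)
  obtain u w where uw: "b - A *\<^sub>v x = u @\<^sub>v w" "u \<in> orthant r" "w \<in> eucl_top l interior_of L"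
    using x(2) unfolding vec_prod_def mem_Collect_eq by (elim exE conjE) (rule that)
  have wL: "w \<in> L"
    by (rule subsetD[OF interior_of_subset uw(3)])
  note Lc = regular_cone_carrier[OF L] and L0 = regular_cone_zero[OF L]
  have O0: "0\<^sub>v r \<in> orthant r"
    by (simp add: orthant_def)
  have split: "\<delta> \<bullet> (u @\<^sub>v w) = vec_first \<delta> r \<bullet> u + vec_last \<delta> l \<bullet> w"
    if "\<delta> \<in> carrier_vec k" "u \<in> carrier_vec r" "w \<in> carrier_vec l" for \<delta> u w :: "real vec"
  proof -
    have "vec_first \<delta> r @\<^sub>v vec_last \<delta> l = \<delta>"
      by (rule vec_first_last_append) (use that(1) rl in simp)
    moreover have "(vec_first \<delta> r @\<^sub>v vec_last \<delta> l) \<bullet> (u @\<^sub>v w) = vec_first \<delta> r \<bullet> u + vec_last \<delta> l \<bullet> w"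
      by (rule scalar_prod_append[OF vec_first_carrier vec_last_carrier that(2,3)])
    ultimately show ?thesis
      by (simp only:)
  qed
  have KI: "u @\<^sub>v w \<in> K" if "u \<in> orthant r" "w \<in> L" for u w
    unfolding K vec_prod_def using that by blast
  \<comment> \<open>Padding with the zero of the other factor tests each part of \<delta>
    separately, here and in \<open>last\<close>.\<close>
  have first: "0 \<le> vec_first \<delta> r \<bullet> u" if \<delta>: "\<delta> \<in> dual_cone k K" and u: "u \<in> orthant r" for \<delta> u
  proof -
    have "u \<in> carrier_vec r"
      using u orthant_carrier by blast
    then show ?thesis
      using dual_coneD[OF \<delta> KI[OF u L0]] split[OF dual_cone_carrier[OF \<delta>], of u "0\<^sub>v l"] by simp
  qed
  have last: "0 \<le> vec_last \<delta> l \<bullet> w" if \<delta>: "\<delta> \<in> dual_cone k K" and w: "w \<in> L" for \<delta> w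
  proof -
    have "w \<in> carrier_vec l"
      using w Lc by blast
    then show ?thesis
      using dual_coneD[OF \<delta> KI[OF O0 w]] split[OF dual_cone_carrier[OF \<delta>], of "0\<^sub>v r" w] by simp
  qed
  have coord: "vec_first \<delta> r $ i = \<delta> $ i" if "i < r" for \<delta> :: "real vec" and i
    using that by (simp add: vec_first_def)
  have coord': "vec_last \<delta> l $ i = \<delta> $ (r + i)" if "i < l" "\<delta> \<in> carrier_vec k" for \<delta> :: "real vec" and i
    using that rl by (auto simp: vec_last_def)
  have nonneg: "0 \<le> \<delta> $ i" if \<delta>: "\<delta> \<in> dual_cone k K" and i: "i < r" for \<delta> i
  proof -
    \<comment> \<open>Unit vectors of the orthant read off the individual signs of the polyhedral
      multipliers.\<close>
    have "unit_vec r i \<in> orthant r"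
      by (auto simp: orthant_def less_eq_vec_def unit_vec_def)
    from first[OF \<delta> this] show ?thesis
      using i by (simp add: coord)
  qed
  show thesis
  proof (rule that[of r x])
    show "r \<le> k"
      using rl by simp
    show "x \<in> carrier_vec (dim_col A)" "b - A *\<^sub>v x \<in> K"
      using x(1) uw(1,2) KI wL by auto
    show "0 \<le> \<delta> $ i" if "\<delta> \<in> dual_cone k K" "i < r" for \<delta> i
      using nonneg that .
    show "\<delta>' \<in> dual_cone k K" if \<delta>: "\<delta> \<in> dual_cone k K" and \<delta>': "\<delta>' \<in> carrier_vec k"
      and pos: "\<And>i. i < r \<Longrightarrow> 0 \<le> \<delta>' $ i" and eq: "\<And>i. \<lbrakk>r \<le> i; i < k\<rbrakk> \<Longrightarrow> \<delta>' $ i = \<delta> $ i" for \<delta> \<delta>'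
      unfolding dual_cone_def
    proof (intro CollectI conjI ballI)
      fix x assume "x \<in> K"
      then obtain u w where u: "x = u @\<^sub>v w" "u \<in> orthant r" "w \<in> L"
        by (auto simp: K vec_prod_def)
      have uc: "u \<in> carrier_vec r" and wc: "w \<in> carrier_vec l"
        using u orthant_carrier Lc by blast+
      have "vec_last \<delta>' l = vec_last \<delta> l"
        using dual_cone_carrier[OF \<delta>] \<delta>' eq rl by (intro eq_vecI) (simp_all add: coord')
      moreover have "0 \<le> vec_first \<delta>' r \<bullet> u"
        using u(2) pos uc by (auto simp: scalar_prod_sum[OF uc] coord orthant_def less_eq_vec_def
            intro!: sum_nonneg)
      ultimately show "0 \<le> \<delta>' \<bullet> x"
        using last[OF \<delta> u(3)] split[OF \<delta>' uc wc] u(1) by simp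
    qed fact
    show "\<delta> $ i = 0" if \<delta>: "\<delta> \<in> dual_cone k K" and zero: "\<delta> \<bullet> (b - A *\<^sub>v x) = 0" and i: "r \<le> i" "i < k" for \<delta> i
    proof -
      have uc: "u \<in> carrier_vec r" and wc: "w \<in> carrier_vec l"
        using uw wL orthant_carrier Lc by blast+
      \<comment> \<open>Both summands are nonnegative, so the second vanishes as well; as w is
        interior to \<open>L\<close>, the part of \<delta> belonging to \<open>L\<close> is
        zero.\<close>
      have "vec_first \<delta> r \<bullet> u + vec_last \<delta> l \<bullet> w = 0"
        using zero uw(1) split[OF dual_cone_carrier[OF \<delta>] uc wc] by simp
      then have "vec_last \<delta> l \<bullet> w = 0"
        using first[OF \<delta> uw(2)] last[OF \<delta> wL] by simp
      then have "vec_last \<delta> l = 0\<^sub>v l"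
        using interior_dual_zero[OF uw(3), of "vec_last \<delta> l"] last[OF \<delta>] by simp
      moreover have i': "i - r < l" "r + (i - r) = i"
        using i rl by linarith+
      ultimately show ?thesis
        using coord'[OF i'(1) dual_cone_carrier[OF \<delta>]] unfolding i'(2) by simp
    qed
  qed
qed

subsection \<open>Conic duality for the supremum over the first variable\<close>

lemma mult_mat_vec_index_sum:
  fixes A :: "real mat"
  shows "\<lbrakk>A \<in> carrier_mat k n; x \<in> carrier_vec n; i < k\<rbrakk> \<Longrightarrow> (A *\<^sub>v x) $ i = (\<Sum>j<n. A $$ (i, j) * x $ j)"
  by (simp add: scalar_prod_sum)

lemma transpose_mult_vec_index_sum:
  fixes A :: "real mat"
  shows "\<lbrakk>A \<in> carrier_mat k n; \<delta> \<in> carrier_vec k; j < n\<rbrakk>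
    \<Longrightarrow> (transpose_mat A *\<^sub>v \<delta>) $ j = (\<Sum>i<k. \<delta> $ i * A $$ (i, j))"
  by (simp add: scalar_prod_sum mult.commute)

text \<open>\<open>append_cols\<close> is a four-block matrix whose lower blocks have no rows, so
  the block product rule leaves an empty vector at the end, which is dropped here.\<close>

lemma append_cols_mult_vec:
  assumes "A \<in> carrier_mat k n" "B \<in> carrier_mat k l" "x \<in> carrier_vec n" "y \<in> carrier_vec l"
  shows "(A @\<^sub>c B) *\<^sub>v (x @\<^sub>v y) = A *\<^sub>v x + B *\<^sub>v y"
proof -
  have dim: "dim_col A = n" "dim_col B = l"
    using assms by auto
  have "0\<^sub>m 0 n *\<^sub>v x + 0\<^sub>m 0 l *\<^sub>v y = vNil"
    by (intro eq_vecI) auto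
  moreover have "A *\<^sub>v x + B *\<^sub>v y = (A *\<^sub>v x + B *\<^sub>v y) @\<^sub>v vNil"
    by (intro eq_vecI) auto
  ultimately show ?thesis
    using four_block_mat_mult_vec[OF assms(1,2) zero_carrier_mat zero_carrier_mat assms(3,4), of 0]
    unfolding append_cols_def dim by simp
qed

lemma append_cols_dim:
  assumes "A \<in> carrier_mat k n" "B \<in> carrier_mat k l"
  shows "A @\<^sub>c B \<in> carrier_mat k (n + l)"
  using assms by (auto simp: append_cols_def)

lemma mat_of_cols_single_mult_vec:
  fixes \<pi> :: "real vec"
  assumes "\<pi> \<in> carrier_vec k" "v \<in> carrier_vec 1"
  shows "mat_of_cols k [\<pi>] *\<^sub>v v = (v $ 0) \<cdot>\<^sub>v \<pi>"
  using assms by (intro eq_vecI) (simp_all add: scalar_prod_sum mat_of_cols_index mult.commute)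

text \<open>The product of the two cones, indexed by a sum type: \<open>Inl\<close> for the
  constraint of \<psi>, \<open>Inr\<close> for the representation of X. Values at indices beyond k
  and k' are unconstrained.\<close>

definition pair_cone :: "nat \<Rightarrow> real vec set \<Rightarrow> nat \<Rightarrow> real vec set \<Rightarrow> (nat + nat \<Rightarrow> real) set" where
  "pair_cone k K k' K' = {f. vec k (\<lambda>i. f (Inl i)) \<in> K \<and> vec k' (\<lambda>i. f (Inr i)) \<in> K'}"

lemma sum_Plus_lessThan:
  fixes f :: "nat + 'b \<Rightarrow> 'c :: comm_monoid_add"
  assumes "finite B"
  shows "sum f ({..<k} <+> B) = (\<Sum>i<k. f (Inl i)) + (\<Sum>i\<in>B. f (Inr i))"
  using sum.Plus[OF finite_lessThan assms, of f k] by (simp add: comp_def)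

lemma coord_closed_pair_cone:
  assumes "regular_cone k K" "regular_cone k' K'"
  shows "coord_closed ({..<k} <+> {..<k'}) (pair_cone k K k' K')"
  unfolding coord_closed_def
proof (intro allI impI)
  fix x :: "nat \<Rightarrow> nat + nat \<Rightarrow> real" and l
  assume x: "\<forall>j. x j \<in> pair_cone k K k' K'"
    and lim: "\<forall>i\<in>{..<k} <+> {..<k'}. (\<lambda>j. x j i) \<longlonglongrightarrow> l i"
  have "(\<lambda>i. l (Inl i)) \<in> {f. vec k f \<in> K}"
    by (rule coord_closedD[OF coord_closed_of_closedin[OF regular_cone_closed[OF assms(1)]],
          of "\<lambda>j i. x j (Inl i)"]) (use x lim in \<open>auto simp: pair_cone_def\<close>)
  moreover have "(\<lambda>i. l (Inr i)) \<in> {f. vec k' f \<in> K'}"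
    by (rule coord_closedD[OF coord_closed_of_closedin[OF regular_cone_closed[OF assms(2)]],
          of "\<lambda>j i. x j (Inr i)"]) (use x lim in \<open>auto simp: pair_cone_def\<close>)
  ultimately show "l \<in> pair_cone k K k' K'"
    by (simp add: pair_cone_def)
qed

lemma fun_cone_pair_cone:
  assumes K: "regular_cone k K" and K': "regular_cone k' K'"
  shows "fun_cone (pair_cone k K k' K')"
  unfolding fun_cone_def
proof (intro conjI ballI allI impI)
  have z: "vec k (\<lambda>_. 0) = 0\<^sub>v k" for k
    by (intro eq_vecI) auto
  show "(\<lambda>_. 0) \<in> pair_cone k K k' K'"
    using regular_cone_zero[OF K] regular_cone_zero[OF K'] by (simp add: pair_cone_def z)
next
  have z: "vec k (\<lambda>i. f i + g i) = vec k f + vec k g" for k and f g :: "nat \<Rightarrow> real"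
    by (intro eq_vecI) auto
  show "(\<lambda>i. x i + y i) \<in> pair_cone k K k' K'" if "x \<in> pair_cone k K k' K'" "y \<in> pair_cone k K k' K'" for x y
    using that regular_cone_add[OF K] regular_cone_add[OF K'] by (simp add: pair_cone_def z)
next
  have z: "vec k (\<lambda>i. t * f i) = t \<cdot>\<^sub>v vec k f" for k t and f :: "nat \<Rightarrow> real"
    by (intro eq_vecI) auto
  show "(\<lambda>i. t * x i) \<in> pair_cone k K k' K'" if "x \<in> pair_cone k K k' K'" "0 \<le> t" for x t
    using that regular_cone_smult[OF K] regular_cone_smult[OF K'] by (simp add: pair_cone_def z)
qed

lemma sum_pair_scalar_prod:
  "(\<Sum>i\<in>{..<k} <+> {..<k'}. l i * f i) =
    vec k (\<lambda>i. l (Inl i)) \<bullet> vec k (\<lambda>i. f (Inl i)) + vec k' (\<lambda>i. l (Inr i)) \<bullet> vec k' (\<lambda>i. f (Inr i))"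
  by (simp add: sum_Plus_lessThan scalar_prod_sum[OF vec_carrier])

lemma vec_index_id: "x \<in> carrier_vec k \<Longrightarrow> vec k (($) x) = x"
  by (intro eq_vecI) auto

text \<open>The dual of a product is the product of the duals: since each cone contains zero, the
  factors can be tested one by one.\<close>

lemma fun_dual_pair_cone:
  assumes K: "regular_cone k K" and K': "regular_cone k' K'"
  shows "l \<in> fun_dual ({..<k} <+> {..<k'}) (pair_cone k K k' K') \<longleftrightarrow>
    vec k (\<lambda>i. l (Inl i)) \<in> dual_cone k K \<and> vec k' (\<lambda>i. l (Inr i)) \<in> dual_cone k' K'"
proof (intro iffI conjI)
  assume l: "l \<in> fun_dual ({..<k} <+> {..<k'}) (pair_cone k K k' K')"
  have *: "0 \<le> vec k (\<lambda>i. l (Inl i)) \<bullet> x + vec k' (\<lambda>i. l (Inr i)) \<bullet> x'" if "x \<in> K" "x' \<in> K'" for x x'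
  proof -
    have c: "vec k (($) x) = x" "vec k' (($) x') = x'"
      using that regular_cone_carrier[OF K] regular_cone_carrier[OF K'] by (auto intro!: vec_index_id)
    then have "case_sum (($) x) (($) x') \<in> pair_cone k K k' K'"
      using that by (simp add: pair_cone_def)
    then show ?thesis
      using l by (auto simp: fun_dual_def sum_pair_scalar_prod c dest!: bspec)
  qed
  show "vec k (\<lambda>i. l (Inl i)) \<in> dual_cone k K"
    using *[OF _ regular_cone_zero[OF K']] by (simp add: dual_cone_def)
  show "vec k' (\<lambda>i. l (Inr i)) \<in> dual_cone k' K'"
    using *[OF regular_cone_zero[OF K]] by (simp add: dual_cone_def)
next
  assume "vec k (\<lambda>i. l (Inl i)) \<in> dual_cone k K \<and> vec k' (\<lambda>i. l (Inr i)) \<in> dual_cone k' K'"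
  then show "l \<in> fun_dual ({..<k} <+> {..<k'}) (pair_cone k K k' K')"
    by (simp add: fun_dual_def sum_pair_scalar_prod pair_cone_def dual_cone_def)
qed

text \<open>This is \<open>refined_conic_duality\<close> for the maximisation of p.x - (f.y + t)
  over (f, t, u, x, \<xi>). Each block of columns yields one dual equation, in this order: P with y,
  \<pi> with -1, Q with 0, R and A with p, B with 0.\<close>

theorem sup_dual_attained:
  fixes v :: real
  assumes cone: "regular_cone k K" "regular_cone kX KX"
    and data_X: "A \<in> carrier_mat kX n" "B \<in> carrier_mat kX a" "c \<in> carrier_vec kX"
    and data: "P \<in> carrier_mat k m" "\<pi> \<in> carrier_vec k" "Q \<in> carrier_mat k l"
      "R \<in> carrier_mat k n" "s \<in> carrier_vec k"
    and X: "X = {x \<in> carrier_vec n. \<exists>\<xi>\<in>carrier_vec a. A *\<^sub>v x + B *\<^sub>v \<xi> \<le>\<^bsub>KX\<^esub> c}"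
    and feas_X: "ess_strictly_feasible KX (A @\<^sub>c B) c"
    and feas: "\<forall>x\<in>X. ess_strictly_feasible K (P @\<^sub>c mat_of_cols k [\<pi>] @\<^sub>c Q) (s - R *\<^sub>v x)"
    and p: "p \<in> carrier_vec n" and y: "y \<in> carrier_vec m"
    and bound: "\<And>f t u x. \<lbrakk>f \<in> carrier_vec m; u \<in> carrier_vec l; x \<in> X;
      P *\<^sub>v f + t \<cdot>\<^sub>v \<pi> + Q *\<^sub>v u + R *\<^sub>v x \<le>\<^bsub>K\<^esub> s\<rbrakk> \<Longrightarrow> p \<bullet> x - (f \<bullet> y + t) \<le> v"
  shows "\<exists>\<delta>\<in>dual_cone k K. \<exists>\<epsilon>\<in>dual_cone kX KX.
    transpose_mat R *\<^sub>v \<delta> + transpose_mat A *\<^sub>v \<epsilon> = p \<and> transpose_mat B *\<^sub>v \<epsilon> = 0\<^sub>v a \<and>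
    transpose_mat P *\<^sub>v \<delta> + y = 0\<^sub>v m \<and> \<pi> \<bullet> \<delta> = - 1 \<and> transpose_mat Q *\<^sub>v \<delta> = 0\<^sub>v l \<and>
    s \<bullet> \<delta> + c \<bullet> \<epsilon> \<le> v"
proof -
  define I where "I = {..<k} <+> {..<kX}"
  define J where "J = {..<m} <+> {..<1::nat} <+> {..<l} <+> {..<n} <+> {..<a}"
  \<comment> \<open>Rows \<open>Inl\<close> couple (f, t, u, x) through the constraint of \<psi>,
    rows \<open>Inr\<close> couple (x, \<xi>) through X; only the x columns meet both, whence the
    sum in the equation for p.\<close>
  define M where "M = case_sum
    (\<lambda>i. case_sum (\<lambda>j. P $$ (i, j)) (case_sum (\<lambda>j::nat. \<pi> $ i) (case_sum (\<lambda>j. Q $$ (i, j))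
      (case_sum (\<lambda>j. R $$ (i, j)) (\<lambda>j::nat. 0)))))
    (\<lambda>i. case_sum (\<lambda>j::nat. 0) (case_sum (\<lambda>j::nat. 0) (case_sum (\<lambda>j::nat. 0)
      (case_sum (\<lambda>j. A $$ (i, j)) (\<lambda>j. B $$ (i, j))))))"
  define b where "b = case_sum (($) s) (($) c)"
  define g where "g = case_sum (\<lambda>j. - y $ j) (case_sum (\<lambda>j::nat. - 1) (case_sum (\<lambda>j::nat. 0)
      (case_sum (($) p) (\<lambda>j::nat. 0))))"
  define Ff where "Ff z = vec m (\<lambda>j. z (Inl j))" for z :: "nat + nat + nat + nat + nat \<Rightarrow> real"
  define Ft where "Ft z = z (Inr (Inl 0))" for z :: "nat + nat + nat + nat + nat \<Rightarrow> real"
  define Fu where "Fu z = vec l (\<lambda>j. z (Inr (Inr (Inl j))))" for z :: "nat + nat + nat + nat + nat \<Rightarrow> real"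
  define Fx where "Fx z = vec n (\<lambda>j. z (Inr (Inr (Inr (Inl j)))))" for z :: "nat + nat + nat + nat + nat \<Rightarrow> real"
  define F\<xi> where "F\<xi> z = vec a (\<lambda>j. z (Inr (Inr (Inr (Inr j)))))" for z :: "nat + nat + nat + nat + nat \<Rightarrow> real"
  note F_defs = Ff_def Ft_def Fu_def Fx_def F\<xi>_def
  have Fc [simp]: "Ff z \<in> carrier_vec m" "Fu z \<in> carrier_vec l" "Fx z \<in> carrier_vec n" "F\<xi> z \<in> carrier_vec a" for z
    by (simp_all add: F_defs)
  have sumJ: "(\<Sum>j\<in>J. h j) = (\<Sum>j<m. h (Inl j)) + (h (Inr (Inl 0)) + ((\<Sum>j<l. h (Inr (Inr (Inl j))))
      + ((\<Sum>j<n. h (Inr (Inr (Inr (Inl j))))) + (\<Sum>j<a. h (Inr (Inr (Inr (Inr j))))))))" for h :: "_ \<Rightarrow> real"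
    by (simp add: J_def sum_Plus_lessThan)
  have rowK: "vec k (\<lambda>i. b (Inl i) - (\<Sum>j\<in>J. M (Inl i) j * z j))
      = s - (P *\<^sub>v Ff z + Ft z \<cdot>\<^sub>v \<pi> + Q *\<^sub>v Fu z + R *\<^sub>v Fx z)" for z
  proof (rule eq_vecI)
    have d: "dim_vec s = k" "dim_row P = k" "dim_vec \<pi> = k" "dim_row Q = k" "dim_row R = k"
      using data by auto
    show "vec k (\<lambda>i. b (Inl i) - (\<Sum>j\<in>J. M (Inl i) j * z j)) $ i
        = (s - (P *\<^sub>v Ff z + Ft z \<cdot>\<^sub>v \<pi> + Q *\<^sub>v Fu z + R *\<^sub>v Fx z)) $ i"
      if "i < dim_vec (s - (P *\<^sub>v Ff z + Ft z \<cdot>\<^sub>v \<pi> + Q *\<^sub>v Fu z + R *\<^sub>v Fx z))" for i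
    proof -
      have i: "i < k"
        using that d by simp
      show ?thesis
        using i d by (simp add: mult_mat_vec_index_sum[OF data(1) Fc(1) i] mult_mat_vec_index_sum[OF data(3) Fc(2) i]
            mult_mat_vec_index_sum[OF data(4) Fc(3) i] del: index_mult_mat_vec)
          (simp add: b_def sumJ M_def F_defs mult.commute)
    qed
  qed (use data in simp)
  have rowX: "vec kX (\<lambda>i. b (Inr i) - (\<Sum>j\<in>J. M (Inr i) j * z j)) = c - (A *\<^sub>v Fx z + B *\<^sub>v F\<xi> z)" for z
  proof (rule eq_vecI)
    have d: "dim_vec c = kX" "dim_row A = kX" "dim_row B = kX"
      using data_X by auto
    show "vec kX (\<lambda>i. b (Inr i) - (\<Sum>j\<in>J. M (Inr i) j * z j)) $ i = (c - (A *\<^sub>v Fx z + B *\<^sub>v F\<xi> z)) $ i"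
      if "i < dim_vec (c - (A *\<^sub>v Fx z + B *\<^sub>v F\<xi> z))" for i
    proof -
      have i: "i < kX"
        using that d by simp
      show ?thesis
        using i d by (simp add: mult_mat_vec_index_sum[OF data_X(1) Fc(3) i] mult_mat_vec_index_sum[OF data_X(2) Fc(4) i]
            del: index_mult_mat_vec) (simp add: b_def sumJ M_def F_defs)
    qed
  qed (use data_X in simp)
  have obj: "(\<Sum>j\<in>J. g j * z j) = p \<bullet> Fx z - (Ff z \<bullet> y + Ft z)" for z
    unfolding scalar_prod_sum[OF Fc(3)] scalar_prod_sum[OF y] sumJ g_def
    by (simp add: F_defs sum_negf mult.commute)
  have mem: "(\<lambda>i. b i - (\<Sum>j\<in>J. M i j * z j)) \<in> pair_cone k K kX KX \<longleftrightarrow>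
      P *\<^sub>v Ff z + Ft z \<cdot>\<^sub>v \<pi> + Q *\<^sub>v Fu z + R *\<^sub>v Fx z \<le>\<^bsub>K\<^esub> s \<and> A *\<^sub>v Fx z + B *\<^sub>v F\<xi> z \<le>\<^bsub>KX\<^esub> c" for z
    by (simp add: pair_cone_def rowK rowX conic_le_def)
  note dual = fun_dual_pair_cone[OF cone, folded I_def]

  have dimX: "dim_row (A @\<^sub>c B) = kX" "dim_col (A @\<^sub>c B) = n + a"
    using append_cols_dim[OF data_X(1,2)] by auto
  obtain r2 zX where r2: "r2 \<le> kX" and zX: "zX \<in> carrier_vec (n + a)" "c - (A @\<^sub>c B) *\<^sub>v zX \<in> KX"
    and posX: "\<And>\<delta> i. \<lbrakk>\<delta> \<in> dual_cone kX KX; i < r2\<rbrakk> \<Longrightarrow> 0 \<le> \<delta> $ i"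
    and replX: "\<And>\<delta> \<delta>'. \<lbrakk>\<delta> \<in> dual_cone kX KX; \<delta>' \<in> carrier_vec kX; \<And>i. i < r2 \<Longrightarrow> 0 \<le> \<delta>' $ i;
      \<And>i. \<lbrakk>r2 \<le> i; i < kX\<rbrakk> \<Longrightarrow> \<delta>' $ i = \<delta> $ i\<rbrakk> \<Longrightarrow> \<delta>' \<in> dual_cone kX KX"
    and strictX: "\<And>\<delta> i. \<lbrakk>\<delta> \<in> dual_cone kX KX; \<delta> \<bullet> (c - (A @\<^sub>c B) *\<^sub>v zX) = 0; r2 \<le> i; i < kX\<rbrakk> \<Longrightarrow> \<delta> $ i = 0"
    using ess_strictly_feasible_dual_cone[OF feas_X dimX(1), unfolded dimX(2)] by blast
  \<comment> \<open>The x-part of the slack point for X lies in X, so it is a legitimate place to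
    invoke the strict feasibility of the constraint of \<psi>.\<close>
  define x0 where "x0 = vec_first zX n"
  define \<xi>0 where "\<xi>0 = vec_last zX a"
  have zX_eq: "(A @\<^sub>c B) *\<^sub>v zX = A *\<^sub>v x0 + B *\<^sub>v \<xi>0"
    using append_cols_mult_vec[OF data_X(1,2) vec_first_carrier vec_last_carrier, of zX zX]
      vec_first_last_append[OF zX(1)] by (simp add: x0_def \<xi>0_def)
  have x0: "x0 \<in> X"
    unfolding X conic_le_def using zX(2) by (auto simp: zX_eq x0_def \<xi>0_def intro!: bexI[of _ \<xi>0])
  have x0c: "x0 \<in> carrier_vec n"
    by (simp add: x0_def)
  have one: "mat_of_cols k [\<pi>] \<in> carrier_mat k 1"
    using mat_of_cols_carrier(1)[of k "[\<pi>]"] by simp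
  note dimPQ = append_cols_dim[OF one data(3)]
  have dimK: "dim_row (P @\<^sub>c mat_of_cols k [\<pi>] @\<^sub>c Q) = k" "dim_col (P @\<^sub>c mat_of_cols k [\<pi>] @\<^sub>c Q) = m + (1 + l)"
    using append_cols_dim[OF data(1) dimPQ] by auto
  obtain r1 zK where r1: "r1 \<le> k" and zK: "zK \<in> carrier_vec (m + (1 + l))"
      "(s - R *\<^sub>v x0) - (P @\<^sub>c mat_of_cols k [\<pi>] @\<^sub>c Q) *\<^sub>v zK \<in> K"
    and posK: "\<And>\<delta> i. \<lbrakk>\<delta> \<in> dual_cone k K; i < r1\<rbrakk> \<Longrightarrow> 0 \<le> \<delta> $ i"
    and replK: "\<And>\<delta> \<delta>'. \<lbrakk>\<delta> \<in> dual_cone k K; \<delta>' \<in> carrier_vec k; \<And>i. i < r1 \<Longrightarrow> 0 \<le> \<delta>' $ i;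
      \<And>i. \<lbrakk>r1 \<le> i; i < k\<rbrakk> \<Longrightarrow> \<delta>' $ i = \<delta> $ i\<rbrakk> \<Longrightarrow> \<delta>' \<in> dual_cone k K"
    and strictK: "\<And>\<delta> i. \<lbrakk>\<delta> \<in> dual_cone k K;
      \<delta> \<bullet> ((s - R *\<^sub>v x0) - (P @\<^sub>c mat_of_cols k [\<pi>] @\<^sub>c Q) *\<^sub>v zK) = 0; r1 \<le> i; i < k\<rbrakk> \<Longrightarrow> \<delta> $ i = 0"
    using ess_strictly_feasible_dual_cone[OF bspec[OF feas x0] dimK(1), unfolded dimK(2)] by blast
  define f0 where "f0 = vec_first zK m"
  define tu0 where "tu0 = vec_last zK (1 + l)"
  define t0 where "t0 = vec_first tu0 1 $ 0"
  define u0 where "u0 = vec_last tu0 l"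
  have tu0: "vec_first tu0 1 @\<^sub>v u0 = tu0"
    unfolding u0_def by (rule vec_first_last_append) (simp add: tu0_def)
  have zK_eq: "(P @\<^sub>c mat_of_cols k [\<pi>] @\<^sub>c Q) *\<^sub>v zK = P *\<^sub>v f0 + (t0 \<cdot>\<^sub>v \<pi> + Q *\<^sub>v u0)"
  proof -
    have "zK = f0 @\<^sub>v tu0"
      unfolding f0_def tu0_def by (rule vec_first_last_append[OF zK(1), symmetric])
    then have "(P @\<^sub>c mat_of_cols k [\<pi>] @\<^sub>c Q) *\<^sub>v zK = P *\<^sub>v f0 + (mat_of_cols k [\<pi>] @\<^sub>c Q) *\<^sub>v tu0"
      using append_cols_mult_vec[OF data(1) dimPQ, of f0 tu0] by (simp add: f0_def tu0_def)
    also have "(mat_of_cols k [\<pi>] @\<^sub>c Q) *\<^sub>v tu0 = t0 \<cdot>\<^sub>v \<pi> + Q *\<^sub>v u0"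
      using append_cols_mult_vec[OF one data(3), of "vec_first tu0 1" u0]
        mat_of_cols_single_mult_vec[OF data(2), of "vec_first tu0 1"]
      unfolding tu0 by (simp add: u0_def t0_def)
    finally show ?thesis .
  qed
  have slackK: "(s - R *\<^sub>v x0) - (P @\<^sub>c mat_of_cols k [\<pi>] @\<^sub>c Q) *\<^sub>v zK
      = s - (P *\<^sub>v f0 + t0 \<cdot>\<^sub>v \<pi> + Q *\<^sub>v u0 + R *\<^sub>v x0)"
    unfolding zK_eq
  proof (rule eq_vecI)
    have d: "dim_vec s = k" "dim_row P = k" "dim_vec \<pi> = k" "dim_row Q = k" "dim_row R = k"
      using data by auto
    show "(s - R *\<^sub>v x0 - (P *\<^sub>v f0 + (t0 \<cdot>\<^sub>v \<pi> + Q *\<^sub>v u0))) $ i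
        = (s - (P *\<^sub>v f0 + t0 \<cdot>\<^sub>v \<pi> + Q *\<^sub>v u0 + R *\<^sub>v x0)) $ i"
      if "i < dim_vec (s - (P *\<^sub>v f0 + t0 \<cdot>\<^sub>v \<pi> + Q *\<^sub>v u0 + R *\<^sub>v x0))" for i
      using that d by (simp del: index_mult_mat_vec)
  qed (use data in simp)

  define z0 where "z0 = case_sum (($) f0) (case_sum (\<lambda>j::nat. t0) (case_sum (($) u0) (case_sum (($) x0) (($) \<xi>0))))"
  have z0: "Ff z0 = f0" "Ft z0 = t0" "Fu z0 = u0" "Fx z0 = x0" "F\<xi> z0 = \<xi>0"
    by (simp_all add: F_defs z0_def f0_def u0_def x0_def \<xi>0_def vec_index_id)
  \<comment> \<open>The polyhedral coordinates of both constraints together; off this set each of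
    the two slacks is interior.\<close>
  define T where "T = Inl ` {..<r1} \<union> Inr ` {..<r2}"
  have "\<exists>l\<in>fun_dual I (pair_cone k K kX KX). (\<forall>j\<in>J. (\<Sum>i\<in>I. l i * M i j) = g j) \<and> (\<Sum>i\<in>I. l i * b i) \<le> v"
  proof (rule refined_conic_duality[where T = T and ?z0.0 = z0])
    show "finite I" "finite J"
      by (simp_all add: I_def J_def)
    show "coord_closed I (pair_cone k K kX KX)" "fun_cone (pair_cone k K kX KX)"
      unfolding I_def using coord_closed_pair_cone[OF cone] fun_cone_pair_cone[OF cone] by auto
    show "T \<subseteq> I"
      using r1 r2 by (auto simp: T_def I_def)
    show "0 \<le> l i" if "l \<in> fun_dual I (pair_cone k K kX KX)" "i \<in> T" for l i
      using that posK[of "vec k (\<lambda>i. l (Inl i))"] posX[of "vec kX (\<lambda>i. l (Inr i))"] r1 r2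
      unfolding dual by (auto simp: T_def)
    show "l' \<in> fun_dual I (pair_cone k K kX KX)"
      if l: "l \<in> fun_dual I (pair_cone k K kX KX)" and eq: "\<And>i. i \<in> I - T \<Longrightarrow> l' i = l i"
        and ge: "\<And>i. i \<in> T \<Longrightarrow> 0 \<le> l' i" for l l'
      unfolding dual
    proof
      show "vec k (\<lambda>i. l' (Inl i)) \<in> dual_cone k K"
      proof (rule replK)
        show "vec k (\<lambda>i. l (Inl i)) \<in> dual_cone k K"
          using l dual by simp
        show "0 \<le> vec k (\<lambda>i. l' (Inl i)) $ i" if "i < r1" for i
          using that r1 ge[of "Inl i"] by (simp add: T_def)
        show "vec k (\<lambda>i. l' (Inl i)) $ i = vec k (\<lambda>i. l (Inl i)) $ i" if "r1 \<le> i" "i < k" for i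
          using that eq[of "Inl i"] unfolding T_def I_def by (simp add: image_iff Plus_def)
      qed simp
      show "vec kX (\<lambda>i. l' (Inr i)) \<in> dual_cone kX KX"
      proof (rule replX)
        show "vec kX (\<lambda>i. l (Inr i)) \<in> dual_cone kX KX"
          using l dual by simp
        show "0 \<le> vec kX (\<lambda>i. l' (Inr i)) $ i" if "i < r2" for i
          using that r2 ge[of "Inr i"] by (simp add: T_def)
        show "vec kX (\<lambda>i. l' (Inr i)) $ i = vec kX (\<lambda>i. l (Inr i)) $ i" if "r2 \<le> i" "i < kX" for i
          using that eq[of "Inr i"] unfolding T_def I_def by (simp add: image_iff Plus_def)
      qed simp
    qed
    show "(\<lambda>i. b i - (\<Sum>j\<in>J. M i j * z0 j)) \<in> pair_cone k K kX KX"
      unfolding mem z0 conic_le_def using zK(2) zX(2) unfolding slackK zX_eq by blast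
    show "l i = 0"
      if l: "l \<in> fun_dual I (pair_cone k K kX KX)"
        and zero: "(\<Sum>i\<in>I. l i * (b i - (\<Sum>j\<in>J. M i j * z0 j))) = 0" and i: "i \<in> I - T" for l i
    proof -
      define \<delta> where "\<delta> = vec k (\<lambda>i. l (Inl i))"
      define \<epsilon> where "\<epsilon> = vec kX (\<lambda>i. l (Inr i))"
      have d: "\<delta> \<in> dual_cone k K" "\<epsilon> \<in> dual_cone kX KX"
        using l dual by (simp_all add: \<delta>_def \<epsilon>_def)
      have "\<delta> \<bullet> (s - (P *\<^sub>v f0 + t0 \<cdot>\<^sub>v \<pi> + Q *\<^sub>v u0 + R *\<^sub>v x0)) + \<epsilon> \<bullet> (c - (A *\<^sub>v x0 + B *\<^sub>v \<xi>0)) = 0"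
        using zero unfolding I_def sum_pair_scalar_prod rowK rowX z0 \<delta>_def \<epsilon>_def .
      \<comment> \<open>Two nonnegative pairings with sum zero both vanish, which reduces the joint
        condition to the two separate ones.\<close>
      moreover have "0 \<le> \<delta> \<bullet> (s - (P *\<^sub>v f0 + t0 \<cdot>\<^sub>v \<pi> + Q *\<^sub>v u0 + R *\<^sub>v x0))" "0 \<le> \<epsilon> \<bullet> (c - (A *\<^sub>v x0 + B *\<^sub>v \<xi>0))"
        using dual_coneD[OF d(1) zK(2)] dual_coneD[OF d(2) zX(2)] unfolding slackK zX_eq by auto
      ultimately have "\<delta> \<bullet> (s - (P *\<^sub>v f0 + t0 \<cdot>\<^sub>v \<pi> + Q *\<^sub>v u0 + R *\<^sub>v x0)) = 0" "\<epsilon> \<bullet> (c - (A *\<^sub>v x0 + B *\<^sub>v \<xi>0)) = 0"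
        by linarith+
      then have "\<delta> $ i = 0" if "r1 \<le> i" "i < k" for i
        using strictK[OF d(1) _ that] unfolding slackK by blast
      moreover have "\<epsilon> $ i = 0" if "r2 \<le> i" "i < kX" for i
        using strictX[OF d(2) _ that] \<open>\<epsilon> \<bullet> (c - (A *\<^sub>v x0 + B *\<^sub>v \<xi>0)) = 0\<close> unfolding zX_eq by blast
      ultimately show ?thesis
        using i by (cases i) (auto simp: I_def T_def \<delta>_def \<epsilon>_def image_iff not_less)
    qed
    show "(\<Sum>j\<in>J. g j * z j) \<le> v" if z: "(\<lambda>i. b i - (\<Sum>j\<in>J. M i j * z j)) \<in> pair_cone k K kX KX" for z
      unfolding obj
    proof (rule bound)
      show "Fx z \<in> X"
        unfolding X using z[unfolded mem] Fc(3,4)[of z] by blast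
    qed (use z[unfolded mem] in auto)
  qed
  then obtain L where L: "L \<in> fun_dual I (pair_cone k K kX KX)" "\<And>j. j \<in> J \<Longrightarrow> (\<Sum>i\<in>I. L i * M i j) = g j"
    "(\<Sum>i\<in>I. L i * b i) \<le> v"
    by blast
  define \<delta> where "\<delta> = vec k (\<lambda>i. L (Inl i))"
  define \<epsilon> where "\<epsilon> = vec kX (\<lambda>i. L (Inr i))"
  have d: "\<delta> \<in> dual_cone k K" "\<epsilon> \<in> dual_cone kX KX"
    using L(1) dual by (simp_all add: \<delta>_def \<epsilon>_def)
  have dc: "\<delta> \<in> carrier_vec k" "\<epsilon> \<in> carrier_vec kX"
    by (simp_all add: \<delta>_def \<epsilon>_def)
  have col: "(\<Sum>i<k. \<delta> $ i * M (Inl i) j) + (\<Sum>i<kX. \<epsilon> $ i * M (Inr i) j) = g j" if "j \<in> J" for j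
    using L(2)[OF that] by (simp add: I_def sum_Plus_lessThan \<delta>_def \<epsilon>_def)
  show ?thesis
  proof (intro bexI[OF _ d(1)] bexI[OF _ d(2)] conjI)
    show "transpose_mat R *\<^sub>v \<delta> + transpose_mat A *\<^sub>v \<epsilon> = p"
    proof (rule eq_vecI)
      fix j assume "j < dim_vec p"
      then have j: "j < n"
        using p by simp
      show "(transpose_mat R *\<^sub>v \<delta> + transpose_mat A *\<^sub>v \<epsilon>) $ j = p $ j"
        using col[of "Inr (Inr (Inr (Inl j)))"] j data_X data(4)
        by (simp add: J_def InlI InrI M_def g_def transpose_mult_vec_index_sum[OF data(4) dc(1) j]
            transpose_mult_vec_index_sum[OF data_X(1) dc(2) j] del: index_mult_mat_vec)
    qed (use p data_X in simp)
    show "transpose_mat B *\<^sub>v \<epsilon> = 0\<^sub>v a"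
    proof (rule eq_vecI)
      fix j assume "j < dim_vec (0\<^sub>v a :: real vec)"
      then have j: "j < a"
        by simp
      show "(transpose_mat B *\<^sub>v \<epsilon>) $ j = 0\<^sub>v a $ j"
        using col[of "Inr (Inr (Inr (Inr j)))"] j
        by (simp add: J_def InlI InrI M_def g_def transpose_mult_vec_index_sum[OF data_X(2) dc(2) j] del: index_mult_mat_vec)
    qed (use data_X in simp)
    show "transpose_mat P *\<^sub>v \<delta> + y = 0\<^sub>v m"
    proof (rule eq_vecI)
      fix j assume "j < dim_vec (0\<^sub>v m :: real vec)"
      then have j: "j < m"
        by simp
      show "(transpose_mat P *\<^sub>v \<delta> + y) $ j = 0\<^sub>v m $ j"
        using col[of "Inl j"] j y
        by (simp add: J_def InlI InrI M_def g_def transpose_mult_vec_index_sum[OF data(1) dc(1) j] del: index_mult_mat_vec)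
    qed (use y in simp)
    show "\<pi> \<bullet> \<delta> = - 1"
      using col[of "Inr (Inl 0)"]
      by (simp add: J_def InlI InrI M_def g_def scalar_prod_sum[OF dc(1)] mult.commute)
    show "transpose_mat Q *\<^sub>v \<delta> = 0\<^sub>v l"
    proof (rule eq_vecI)
      fix j assume "j < dim_vec (0\<^sub>v l :: real vec)"
      then have j: "j < l"
        by simp
      show "(transpose_mat Q *\<^sub>v \<delta>) $ j = 0\<^sub>v l $ j"
        using col[of "Inr (Inr (Inl j))"] j
        by (simp add: J_def InlI InrI M_def g_def transpose_mult_vec_index_sum[OF data(3) dc(1) j] del: index_mult_mat_vec)
    qed (use data in simp)
    have "(\<Sum>i\<in>I. L i * b i) = s \<bullet> \<delta> + c \<bullet> \<epsilon>"
      unfolding scalar_prod_sum[OF dc(1)] scalar_prod_sum[OF dc(2)]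
      by (simp add: I_def sum_Plus_lessThan b_def \<delta>_def \<epsilon>_def mult.commute)
    then show "s \<bullet> \<delta> + c \<bullet> \<epsilon> \<le> v"
      using L(3) by simp
  qed
qed

subsection \<open>Systems equivalent to a single conic constraint\<close>

text \<open>Written as a slack b - (...), so that a family of such forms is literally s - (P f + t
  \<pi> + Q u + R x) row by row. This is why a plain coordinate gets the coefficient -1
  below.\<close>

definition affine_form ::
    "nat \<Rightarrow> nat \<Rightarrow> nat \<Rightarrow> (real vec \<Rightarrow> real \<Rightarrow> real vec \<Rightarrow> real vec \<Rightarrow> real) \<Rightarrow> bool" where
  "affine_form m l n E \<longleftrightarrow> (\<exists>g \<gamma> w r b. \<forall>f t u x. E f t u x =
     b - ((\<Sum>j<m. g j * f $ j) + t * \<gamma> + (\<Sum>j<l. w j * u $ j) + (\<Sum>j<n. r j * x $ j)))"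

lemma affine_formI:
  "(\<And>f t u x. E f t u x =
     b - ((\<Sum>j<m. g j * f $ j) + t * \<gamma> + (\<Sum>j<l. w j * u $ j) + (\<Sum>j<n. r j * x $ j)))
   \<Longrightarrow> affine_form m l n E"
  unfolding affine_form_def by (intro exI allI)

lemma affine_formE:
  assumes "affine_form m l n E"
  obtains g \<gamma> w r b where "\<And>f t u x. E f t u x =
     b - ((\<Sum>j<m. g j * f $ j) + t * \<gamma> + (\<Sum>j<l. w j * u $ j) + (\<Sum>j<n. r j * x $ j))"
proof -
  from assms obtain g \<gamma> w r b where *: "\<forall>f t u x. E f t u x =
     b - ((\<Sum>j<m. g j * f $ j) + t * \<gamma> + (\<Sum>j<l. w j * u $ j) + (\<Sum>j<n. r j * x $ j))"
    unfolding affine_form_def by (elim exE) (rule that)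
  show thesis
    by (rule that) (rule *[rule_format])
qed

lemma sum_neg_indicator:
  fixes f :: "nat \<Rightarrow> real"
  assumes "j < m"
  shows "(\<Sum>i<m. (if i = j then - 1 else 0) * f i) = - f j"
proof -
  have "(\<Sum>i<m. (if i = j then - 1 else 0) * f i) = (\<Sum>i<m. if i = j then - f i else 0)"
    by (rule sum.cong) simp_all
  then show ?thesis
    using assms by simp
qed

lemma affine_form_const: "affine_form m l n (\<lambda>f t u x. b)"
  by (rule affine_formI[where b = b and \<gamma> = 0 and g = "\<lambda>_. 0" and w = "\<lambda>_. 0" and r = "\<lambda>_. 0"]) simp

lemma affine_form_f: "j < m \<Longrightarrow> affine_form m l n (\<lambda>f t u x. f $ j)"
  by (rule affine_formI[where b = 0 and \<gamma> = 0 and g = "\<lambda>i. if i = j then - 1 else 0" and w = "\<lambda>_. 0" and r = "\<lambda>_. 0"])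
    (simp add: sum_neg_indicator)

lemma affine_form_t: "affine_form m l n (\<lambda>f t u x. t)"
  by (rule affine_formI[where b = 0 and \<gamma> = "- 1" and g = "\<lambda>_. 0" and w = "\<lambda>_. 0" and r = "\<lambda>_. 0"]) simp

lemma affine_form_u: "j < l \<Longrightarrow> affine_form m l n (\<lambda>f t u x. u $ j)"
  by (rule affine_formI[where b = 0 and \<gamma> = 0 and w = "\<lambda>i. if i = j then - 1 else 0" and g = "\<lambda>_. 0" and r = "\<lambda>_. 0"])
    (simp add: sum_neg_indicator)

lemma affine_form_x: "j < n \<Longrightarrow> affine_form m l n (\<lambda>f t u x. x $ j)"
  by (rule affine_formI[where b = 0 and \<gamma> = 0 and r = "\<lambda>i. if i = j then - 1 else 0" and w = "\<lambda>_. 0" and g = "\<lambda>_. 0"])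
    (simp add: sum_neg_indicator)

lemma affine_form_add:
  assumes "affine_form m l n E" "affine_form m l n E'"
  shows "affine_form m l n (\<lambda>f t u x. E f t u x + E' f t u x)"
proof -
  obtain g \<gamma> w r b where 1: "\<And>f t u x. E f t u x =
     b - ((\<Sum>j<m. g j * f $ j) + t * \<gamma> + (\<Sum>j<l. w j * u $ j) + (\<Sum>j<n. r j * x $ j))"
    by (rule affine_formE[OF assms(1)], rule that)
  obtain g' \<gamma>' w' r' b' where 2: "\<And>f t u x. E' f t u x =
     b' - ((\<Sum>j<m. g' j * f $ j) + t * \<gamma>' + (\<Sum>j<l. w' j * u $ j) + (\<Sum>j<n. r' j * x $ j))"
    by (rule affine_formE[OF assms(2)], rule that)
  show ?thesis
    by (rule affine_formI[where b = "b + b'" and \<gamma> = "\<gamma> + \<gamma>'" and g = "\<lambda>i. g i + g' i"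
          and w = "\<lambda>i. w i + w' i" and r = "\<lambda>i. r i + r' i"])
      (simp add: 1 2 distrib_right distrib_left sum.distrib)
qed

lemma affine_form_cmult:
  assumes "affine_form m l n E"
  shows "affine_form m l n (\<lambda>f t u x. a * E f t u x)"
proof -
  obtain g \<gamma> w r b where 1: "\<And>f t u x. E f t u x =
     b - ((\<Sum>j<m. g j * f $ j) + t * \<gamma> + (\<Sum>j<l. w j * u $ j) + (\<Sum>j<n. r j * x $ j))"
    by (rule affine_formE[OF assms], rule that)
  show ?thesis
    by (rule affine_formI[where b = "a * b" and \<gamma> = "a * \<gamma>" and g = "\<lambda>i. a * g i"
          and w = "\<lambda>i. a * w i" and r = "\<lambda>i. a * r i"])
      (simp add: 1 right_diff_distrib distrib_left sum_distrib_left mult.assoc mult.left_commute)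
qed

lemma affine_form_diff:
  assumes "affine_form m l n E" "affine_form m l n E'"
  shows "affine_form m l n (\<lambda>f t u x. E f t u x - E' f t u x)"
  using affine_form_add[OF assms(1) affine_form_cmult[OF assms(2), of "- 1"]] by simp

lemma affine_form_sum:
  assumes "\<And>i. i < N \<Longrightarrow> affine_form m l n (E i)"
  shows "affine_form m l n (\<lambda>f t u x. \<Sum>i<(N::nat). E i f t u x)"
  using assms by (induction N) (simp_all add: affine_form_const affine_form_add)

section \<open>Closure properties of conic systems\<close>

lemma conic_system_cong:
  assumes "conic_system \<K> m l n F"
    and "\<And>f t u x. \<lbrakk>f \<in> carrier_vec m; u \<in> carrier_vec l; x \<in> carrier_vec n\<rbrakk> \<Longrightarrow> F f t u x \<longleftrightarrow> G f t u x"
  shows "conic_system \<K> m l n G"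
proof -
  obtain k K P \<pi> Q R s where *: "K \<in> \<K>" "K \<subseteq> carrier_vec k"
      "P \<in> carrier_mat k m" "\<pi> \<in> carrier_vec k" "Q \<in> carrier_mat k l"
      "R \<in> carrier_mat k n" "s \<in> carrier_vec k"
    and F: "\<forall>f\<in>carrier_vec m. \<forall>t. \<forall>u\<in>carrier_vec l. \<forall>x\<in>carrier_vec n.
           F f t u x \<longleftrightarrow> P *\<^sub>v f + t \<cdot>\<^sub>v \<pi> + Q *\<^sub>v u + R *\<^sub>v x \<le>\<^bsub>K\<^esub> s"
    using assms(1) unfolding conic_system_def by (elim exE conjE) (rule that)
  have "\<forall>f\<in>carrier_vec m. \<forall>t. \<forall>u\<in>carrier_vec l. \<forall>x\<in>carrier_vec n.
           G f t u x \<longleftrightarrow> P *\<^sub>v f + t \<cdot>\<^sub>v \<pi> + Q *\<^sub>v u + R *\<^sub>v x \<le>\<^bsub>K\<^esub> s"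
    using F assms(2) by simp
  with * show ?thesis
    unfolding conic_system_def by (intro exI conjI)
qed

lemma affine_conic_system:
  assumes K: "K \<in> \<K>" "K \<subseteq> carrier_vec k" and E: "\<And>i. i < k \<Longrightarrow> affine_form m l n (E i)"
  shows "conic_system \<K> m l n (\<lambda>f t u x. vec k (\<lambda>i. E i f t u x) \<in> K)"
proof -
  have "\<forall>i\<in>{..<k}. \<exists>g \<gamma> w r b. \<forall>f t u x. E i f t u x =
     b - ((\<Sum>j<m. g j * f $ j) + t * \<gamma> + (\<Sum>j<l. w j * u $ j) + (\<Sum>j<n. r j * x $ j))"
    using E unfolding affine_form_def by simp
  then obtain g \<gamma> w r b where eq: "\<And>i f t u x. i < k \<Longrightarrow> E i f t u x =
     b i - ((\<Sum>j<m. g i j * f $ j) + t * \<gamma> i + (\<Sum>j<l. w i j * u $ j) + (\<Sum>j<n. r i j * x $ j))"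
    unfolding bchoice_iff lessThan_iff by blast
  let ?P = "mat k m (\<lambda>(i, j). g i j)" and ?Q = "mat k l (\<lambda>(i, j). w i j)" and ?R = "mat k n (\<lambda>(i, j). r i j)"
  have row: "vec k b - (?P *\<^sub>v f + t \<cdot>\<^sub>v vec k \<gamma> + ?Q *\<^sub>v u + ?R *\<^sub>v x) = vec k (\<lambda>i. E i f t u x)"
    if c: "f \<in> carrier_vec m" "u \<in> carrier_vec l" "x \<in> carrier_vec n" for f t u x
  proof (rule eq_vecI)
    fix i assume "i < dim_vec (vec k (\<lambda>i. E i f t u x))"
    then have i: "i < k"
      by simp
    show "(vec k b - (?P *\<^sub>v f + t \<cdot>\<^sub>v vec k \<gamma> + ?Q *\<^sub>v u + ?R *\<^sub>v x)) $ i = vec k (\<lambda>i. E i f t u x) $ i"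
      using i by (simp add: mult_mat_vec_index_sum[OF mat_carrier c(1) i] mult_mat_vec_index_sum[OF mat_carrier c(2) i]
          mult_mat_vec_index_sum[OF mat_carrier c(3) i] eq[OF i] del: index_mult_mat_vec)
  qed simp
  show ?thesis
    unfolding conic_system_def
  proof (intro exI conjI ballI allI)
    show "K \<in> \<K>" "K \<subseteq> carrier_vec k"
      by (fact K)+
    show "?P \<in> carrier_mat k m" "vec k \<gamma> \<in> carrier_vec k" "?Q \<in> carrier_mat k l" "?R \<in> carrier_mat k n" "vec k b \<in> carrier_vec k"
      by simp_all
    show "(vec k (\<lambda>i. E i f t u x) \<in> K) = (?P *\<^sub>v f + t \<cdot>\<^sub>v vec k \<gamma> + ?Q *\<^sub>v u + ?R *\<^sub>v x \<le>\<^bsub>K\<^esub> vec k b)"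
      if c: "f \<in> carrier_vec m" "u \<in> carrier_vec l" "x \<in> carrier_vec n" for f t u x
      unfolding conic_le_def row[OF c] ..
  qed
qed

text \<open>Both constraints are read as vectors of affine forms in a cone; stacking the rows gives
  one vector in the product cone, which the family contains. Fixed dimensions make the splitting of
  such a vector unique.\<close>

lemma conic_system_conj:
  assumes fam: "cone_family \<K>" and F: "conic_system \<K> m l n F" and G: "conic_system \<K> m l n G"
  shows "conic_system \<K> m l n (\<lambda>f t u x. F f t u x \<and> G f t u x)"
proof -
  have aff: "\<exists>k K E. K \<in> \<K> \<and> K \<subseteq> carrier_vec k \<and> (\<forall>i<k. affine_form m l n (E i)) \<and>
      (\<forall>f\<in>carrier_vec m. \<forall>t. \<forall>u\<in>carrier_vec l. \<forall>x\<in>carrier_vec n. F f t u x \<longleftrightarrow> vec k (\<lambda>i. E i f t u x) \<in> K)"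
    if sys: "conic_system \<K> m l n F" for F
  proof -
    obtain k K P \<pi> Q R s where K: "K \<in> \<K>" "K \<subseteq> carrier_vec k"
      and d: "P \<in> carrier_mat k m" "\<pi> \<in> carrier_vec k" "Q \<in> carrier_mat k l"
        "R \<in> carrier_mat k n" "s \<in> carrier_vec k"
      and F: "\<forall>f\<in>carrier_vec m. \<forall>t. \<forall>u\<in>carrier_vec l. \<forall>x\<in>carrier_vec n.
             F f t u x \<longleftrightarrow> P *\<^sub>v f + t \<cdot>\<^sub>v \<pi> + Q *\<^sub>v u + R *\<^sub>v x \<le>\<^bsub>K\<^esub> s"
      using sys unfolding conic_system_def by (elim exE conjE) (rule that)
    define E where "E i f t u x = s $ i - ((\<Sum>j<m. P $$ (i, j) * f $ j) + t * \<pi> $ i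
      + (\<Sum>j<l. Q $$ (i, j) * u $ j) + (\<Sum>j<n. R $$ (i, j) * x $ j))" for i and f u x :: "real vec" and t
    have row: "vec k (\<lambda>i. E i f t u x) = s - (P *\<^sub>v f + t \<cdot>\<^sub>v \<pi> + Q *\<^sub>v u + R *\<^sub>v x)"
      if c: "f \<in> carrier_vec m" "u \<in> carrier_vec l" "x \<in> carrier_vec n" for f t u x
    proof (rule eq_vecI)
      have dd: "dim_vec s = k" "dim_row P = k" "dim_vec \<pi> = k" "dim_row Q = k" "dim_row R = k"
        using d by auto
      fix i assume "i < dim_vec (s - (P *\<^sub>v f + t \<cdot>\<^sub>v \<pi> + Q *\<^sub>v u + R *\<^sub>v x))"
      then have i: "i < k"
        using dd by simp
      show "vec k (\<lambda>i. E i f t u x) $ i = (s - (P *\<^sub>v f + t \<cdot>\<^sub>v \<pi> + Q *\<^sub>v u + R *\<^sub>v x)) $ i"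
        using i dd by (simp add: mult_mat_vec_index_sum[OF d(1) c(1) i] mult_mat_vec_index_sum[OF d(3) c(2) i]
            mult_mat_vec_index_sum[OF d(4) c(3) i] E_def del: index_mult_mat_vec)
    qed (use d in simp)
    have "affine_form m l n (E i)" for i
      unfolding E_def by (rule affine_formI) (rule refl)
    moreover have "\<forall>f\<in>carrier_vec m. \<forall>t. \<forall>u\<in>carrier_vec l. \<forall>x\<in>carrier_vec n. F f t u x \<longleftrightarrow> vec k (\<lambda>i. E i f t u x) \<in> K"
      using F by (simp add: row conic_le_def)
    ultimately show ?thesis
      using K by (intro exI[of _ k] exI[of _ K] exI[of _ E]) simp
  qed
  obtain k1 K1 E1 where 1: "K1 \<in> \<K>" "K1 \<subseteq> carrier_vec k1" "\<forall>i<k1. affine_form m l n (E1 i)"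
    and F: "\<forall>f\<in>carrier_vec m. \<forall>t. \<forall>u\<in>carrier_vec l. \<forall>x\<in>carrier_vec n. F f t u x \<longleftrightarrow> vec k1 (\<lambda>i. E1 i f t u x) \<in> K1"
    using aff[OF F] by (elim exE conjE) (rule that)
  obtain k2 K2 E2 where 2: "K2 \<in> \<K>" "K2 \<subseteq> carrier_vec k2" "\<forall>i<k2. affine_form m l n (E2 i)"
    and G: "\<forall>f\<in>carrier_vec m. \<forall>t. \<forall>u\<in>carrier_vec l. \<forall>x\<in>carrier_vec n. G f t u x \<longleftrightarrow> vec k2 (\<lambda>i. E2 i f t u x) \<in> K2"
    using aff[OF G] by (elim exE conjE) (rule that)
  define E where "E i = (if i < k1 then E1 i else E2 (i - k1))" for i
  have E: "affine_form m l n (E i)" if "i < k1 + k2" for i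
    using that 1(3) 2(3) by (simp add: E_def)
  have prod: "K1 \<times>\<^sub>v K2 \<in> \<K>"
    using fam 1(1) 2(1) unfolding cone_family_def by simp
  have sub: "K1 \<times>\<^sub>v K2 \<subseteq> carrier_vec (k1 + k2)"
    using 1(2) 2(2) by (auto simp: vec_prod_def)
  have split: "vec (k1 + k2) (\<lambda>i. E i f t u x) = vec k1 (\<lambda>i. E1 i f t u x) @\<^sub>v vec k2 (\<lambda>i. E2 i f t u x)" for f t u x
    by (intro eq_vecI) (auto simp: E_def)
  have mem: "v1 @\<^sub>v v2 \<in> K1 \<times>\<^sub>v K2 \<longleftrightarrow> v1 \<in> K1 \<and> v2 \<in> K2"
    if "v1 \<in> carrier_vec k1" "v2 \<in> carrier_vec k2" for v1 v2
  proof
    assume "v1 @\<^sub>v v2 \<in> K1 \<times>\<^sub>v K2"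
    then obtain w1 w2 where w: "v1 @\<^sub>v v2 = w1 @\<^sub>v w2" "w1 \<in> K1" "w2 \<in> K2"
      by (auto simp: vec_prod_def)
    then show "v1 \<in> K1 \<and> v2 \<in> K2"
      using append_vec_eq[OF that(1) subsetD[OF 1(2) w(2)], of v2 w2] by simp
  qed (auto simp: vec_prod_def)
  show ?thesis
  proof (rule conic_system_cong[OF affine_conic_system[OF prod sub E]])
    show "(vec (k1 + k2) (\<lambda>i. E i f t u x) \<in> K1 \<times>\<^sub>v K2) = (F f t u x \<and> G f t u x)"
      if "f \<in> carrier_vec m" "u \<in> carrier_vec l" "x \<in> carrier_vec n" for f t u x
      unfolding split mem[OF vec_carrier vec_carrier] using that F G by simp
  qed
qed

lemma conic_system_nonneg:
  assumes "cone_family \<K>" "affine_form m l n E"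
  shows "conic_system \<K> m l n (\<lambda>f t u x. 0 \<le> E f t u x)"
proof (rule conic_system_cong[OF affine_conic_system])
  show "orthant 1 \<in> \<K>"
    using assms(1) unfolding cone_family_def by (elim conjE)
  show "(vec 1 (\<lambda>i. E f t u x) \<in> orthant 1) = (0 \<le> E f t u x)" for f t u x
    by (simp add: orthant_def less_eq_vec_def)
qed (use orthant_carrier assms(2) in auto)

text \<open>A linear equality is two opposite inequalities, each conic over the half-line
  \<open>orthant 1\<close> of the family.\<close>

lemma conic_system_eq0:
  assumes "cone_family \<K>" "affine_form m l n E"
  shows "conic_system \<K> m l n (\<lambda>f t u x. E f t u x = 0)"
proof (rule conic_system_cong[OF conic_system_conj[OF assms(1) conic_system_nonneg[OF assms]]])
  show "conic_system \<K> m l n (\<lambda>f t u x. 0 \<le> - 1 * E f t u x)"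
    by (rule conic_system_nonneg[OF assms(1) affine_form_cmult[OF assms(2)]])
qed auto

lemma conic_system_all_eq0:
  assumes "cone_family \<K>" "\<And>i. i < N \<Longrightarrow> affine_form m l n (E i)"
  shows "conic_system \<K> m l n (\<lambda>f t u x. \<forall>i<(N::nat). E i f t u x = 0)"
  using assms(2)
proof (induction N)
  case 0
  \<comment> \<open>An empty list of equations still requires a cone of the family; the true
    inequality 0 \<le> 0 supplies one.\<close>
  show ?case
    by (rule conic_system_cong[OF conic_system_nonneg[OF assms(1) affine_form_const[of _ _ _ 0]]]) simp
next
  case (Suc N)
  show ?case
    by (rule conic_system_cong[OF conic_system_conj[OF assms(1) Suc.IH conic_system_eq0[OF assms(1), of _ _ _ "E N"]]])
      (use Suc.prems in \<open>auto simp: less_Suc_eq\<close>)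
qed

text \<open>\<open>conic_system\<close> provides a single vector of auxiliary variables, so
  \<alpha>, \<delta> and \<epsilon> are concatenated into u. In its remaining slots \<beta> acts as
  f, \<tau> as t, and the parameter p as x. The dual cones belong to the family, and every other
  condition is an affine equation or membership in \<open>KY\<close>.\<close>

lemma conjugate_conic_system:
  assumes family: "cone_family \<K>"
    and cone_X: "KX \<in> \<K>" "KX \<subseteq> carrier_vec kX"
    and cone_Y: "KY \<in> \<K>" "KY \<subseteq> carrier_vec kY"
    and cone: "K \<in> \<K>" "K \<subseteq> carrier_vec k"
    and data_X: "A \<in> carrier_mat kX n" "B \<in> carrier_mat kX a" "c \<in> carrier_vec kX"
    and data_Y: "C \<in> carrier_mat kY m" "D \<in> carrier_mat kY h" "e \<in> carrier_vec kY"
    and data: "P \<in> carrier_mat k m" "\<pi> \<in> carrier_vec k" "Q \<in> carrier_mat k l"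
      "R \<in> carrier_mat k n" "s \<in> carrier_vec k"
  shows "conic_system \<K> m (h + (k + kX)) n
    (\<lambda>\<beta> \<tau> u p. \<exists>\<alpha>\<in>carrier_vec h. \<exists>\<delta>\<in>carrier_vec k. \<exists>\<epsilon>\<in>carrier_vec kX. u = \<alpha> @\<^sub>v \<delta> @\<^sub>v \<epsilon> \<and>
      0\<^sub>v k \<le>\<^bsub>dual_cone k K\<^esub> \<delta> \<and> 0\<^sub>v kX \<le>\<^bsub>dual_cone kX KX\<^esub> \<epsilon> \<and>
      \<tau> = s \<bullet> \<delta> + c \<bullet> \<epsilon> \<and>
      transpose_mat R *\<^sub>v \<delta> + transpose_mat A *\<^sub>v \<epsilon> = p \<and>
      transpose_mat B *\<^sub>v \<epsilon> = 0\<^sub>v a \<and>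
      transpose_mat P *\<^sub>v \<delta> + \<beta> = 0\<^sub>v m \<and>
      \<pi> \<bullet> \<delta> = - 1 \<and>
      transpose_mat Q *\<^sub>v \<delta> = 0\<^sub>v l \<and>
      0\<^sub>v kY \<le>\<^bsub>KY\<^esub> D *\<^sub>v \<alpha> - C *\<^sub>v \<beta> + e)"
proof -
  let ?L = "h + (k + kX)"
  \<comment> \<open>Offsets of the blocks inside u: \<alpha> occupies the first h entries, \<delta>
    the next k and \<epsilon> the last kX.\<close>
  define d where "d i u = u $ (h + i)" for i and u :: "real vec"
  define \<omega> where "\<omega> i u = u $ (h + (k + i))" for i and u :: "real vec"
  have aff_d: "affine_form m ?L n (\<lambda>\<beta> \<tau> u p. d i u)" if "i < k" for i
    unfolding d_def by (rule affine_form_u) (use that in simp)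
  have aff_o: "affine_form m ?L n (\<lambda>\<beta> \<tau> u p. \<omega> i u)" if "i < kX" for i
    unfolding \<omega>_def by (rule affine_form_u) (use that in simp)
  have aff_\<alpha>: "affine_form m ?L n (\<lambda>\<beta> \<tau> u p. u $ i)" if "i < h" for i
    by (rule affine_form_u) (use that in simp)
  have lin_d: "affine_form m ?L n (\<lambda>\<beta> \<tau> u p. \<Sum>i<k. w i * d i u)" for w
    by (intro affine_form_sum affine_form_cmult aff_d)
  have lin_o: "affine_form m ?L n (\<lambda>\<beta> \<tau> u p. \<Sum>i<kX. w i * \<omega> i u)" for w
    by (intro affine_form_sum affine_form_cmult aff_o)
  note conj = conic_system_conj[OF family]
  have dual_sub: "dual_cone k K \<subseteq> carrier_vec k" for k K
    by (auto simp: dual_cone_def)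
  have 1: "conic_system \<K> m ?L n (\<lambda>\<beta> \<tau> u p. vec k (\<lambda>i. d i u) \<in> dual_cone k K)"
    by (rule affine_conic_system[OF cone_family_dual[OF family cone] dual_sub aff_d])
  have 2: "conic_system \<K> m ?L n (\<lambda>\<beta> \<tau> u p. vec kX (\<lambda>i. \<omega> i u) \<in> dual_cone kX KX)"
    by (rule affine_conic_system[OF cone_family_dual[OF family cone_X] dual_sub aff_o])
  have 3: "conic_system \<K> m ?L n (\<lambda>\<beta> \<tau> u p. \<tau> - ((\<Sum>i<k. s $ i * d i u) + (\<Sum>i<kX. c $ i * \<omega> i u)) = 0)"
    by (intro conic_system_eq0 family affine_form_diff affine_form_add affine_form_t lin_d lin_o)
  have 4: "conic_system \<K> m ?L n (\<lambda>\<beta> \<tau> u p. \<forall>j<n.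
      ((\<Sum>i<k. R $$ (i, j) * d i u) + (\<Sum>i<kX. A $$ (i, j) * \<omega> i u)) - p $ j = 0)"
    by (intro conic_system_all_eq0 family affine_form_diff affine_form_add affine_form_x lin_d lin_o)
  have 5: "conic_system \<K> m ?L n (\<lambda>\<beta> \<tau> u p. \<forall>j<a. (\<Sum>i<kX. B $$ (i, j) * \<omega> i u) = 0)"
    by (intro conic_system_all_eq0 family lin_o)
  have 6: "conic_system \<K> m ?L n (\<lambda>\<beta> \<tau> u p. \<forall>j<m. (\<Sum>i<k. P $$ (i, j) * d i u) + \<beta> $ j = 0)"
    by (intro conic_system_all_eq0 family affine_form_add affine_form_f lin_d)
  have 7: "conic_system \<K> m ?L n (\<lambda>\<beta> \<tau> u p. (\<Sum>i<k. \<pi> $ i * d i u) + 1 = 0)"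
    by (intro conic_system_eq0 family affine_form_add affine_form_const lin_d)
  have 8: "conic_system \<K> m ?L n (\<lambda>\<beta> \<tau> u p. \<forall>j<l. (\<Sum>i<k. Q $$ (i, j) * d i u) = 0)"
    by (intro conic_system_all_eq0 family lin_d)
  have 9: "conic_system \<K> m ?L n (\<lambda>\<beta> \<tau> u p.
      vec kY (\<lambda>i. (\<Sum>j<h. D $$ (i, j) * u $ j) - (\<Sum>j<m. C $$ (i, j) * \<beta> $ j) + e $ i) \<in> KY)"
    by (rule affine_conic_system[OF cone_Y])
      (intro affine_form_diff affine_form_add affine_form_const affine_form_sum affine_form_cmult affine_form_f aff_\<alpha>)
  show ?thesis
  proof (rule conic_system_cong[OF conj[OF 1 conj[OF 2 conj[OF 3 conj[OF 4 conj[OF 5 conj[OF 6 conj[OF 7 conj[OF 8 9]]]]]]]]],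
      goal_cases)
    case (1 \<beta> \<tau> u p)
    define \<alpha> where "\<alpha> = vec_first u h"
    define \<delta> where "\<delta> = vec k (\<lambda>i. d i u)"
    define \<epsilon> where "\<epsilon> = vec kX (\<lambda>i. \<omega> i u)"
    have c: "\<alpha> \<in> carrier_vec h" "\<delta> \<in> carrier_vec k" "\<epsilon> \<in> carrier_vec kX"
      by (simp_all add: \<alpha>_def \<delta>_def \<epsilon>_def)
    have du: "dim_vec u = h + (k + kX)"
      using 1(2) by simp
    have u: "u = \<alpha> @\<^sub>v \<delta> @\<^sub>v \<epsilon>"
      by (rule eq_vecI) (auto simp: du \<alpha>_def \<delta>_def \<epsilon>_def d_def \<omega>_def vec_first_def add.commute add.left_commute)
    \<comment> \<open>The block lengths determine the splitting of u, so the existential quantifiers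
      amount to conditions on coordinates of u.\<close>
    have uniq: "\<alpha>' = \<alpha> \<and> \<delta>' = \<delta> \<and> \<epsilon>' = \<epsilon>"
      if "\<alpha>' \<in> carrier_vec h" "\<delta>' \<in> carrier_vec k" "\<epsilon>' \<in> carrier_vec kX" "u = \<alpha>' @\<^sub>v \<delta>' @\<^sub>v \<epsilon>'" for \<alpha>' \<delta>' \<epsilon>'
    proof -
      have "\<alpha>' @\<^sub>v \<delta>' @\<^sub>v \<epsilon>' = \<alpha> @\<^sub>v \<delta> @\<^sub>v \<epsilon>"
        using that(4) u by (rule trans[OF sym])
      then show ?thesis
        unfolding append_vec_eq[OF that(1) c(1)] append_vec_eq[OF that(2) c(2)] .
    qed
    have e3: "\<tau> = s \<bullet> \<delta> + c \<bullet> \<epsilon> \<longleftrightarrow> \<tau> - ((\<Sum>i<k. s $ i * d i u) + (\<Sum>i<kX. c $ i * \<omega> i u)) = 0"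
      unfolding scalar_prod_sum[OF c(2)] scalar_prod_sum[OF c(3)] by (simp add: \<delta>_def \<epsilon>_def)
    have T: "(transpose_mat M *\<^sub>v \<delta>) $ j = (\<Sum>i<k. M $$ (i, j) * d i u)" if "M \<in> carrier_mat k N" "j < N" for M N j
      unfolding transpose_mult_vec_index_sum[OF that(1) c(2) that(2)] by (simp add: \<delta>_def mult.commute)
    have TX: "(transpose_mat M *\<^sub>v \<epsilon>) $ j = (\<Sum>i<kX. M $$ (i, j) * \<omega> i u)" if "M \<in> carrier_mat kX N" "j < N" for M N j
      unfolding transpose_mult_vec_index_sum[OF that(1) c(3) that(2)] by (simp add: \<epsilon>_def mult.commute)
    have veq: "v = w \<longleftrightarrow> (\<forall>j<N. v $ j = w $ j)" if "v \<in> carrier_vec N" "w \<in> carrier_vec N" for v w :: "real vec" and N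
      using that by (auto intro: eq_vecI)
    have e4: "transpose_mat R *\<^sub>v \<delta> + transpose_mat A *\<^sub>v \<epsilon> = p \<longleftrightarrow>
        (\<forall>j<n. ((\<Sum>i<k. R $$ (i, j) * d i u) + (\<Sum>i<kX. A $$ (i, j) * \<omega> i u)) - p $ j = 0)"
    proof -
      have "transpose_mat R *\<^sub>v \<delta> + transpose_mat A *\<^sub>v \<epsilon> \<in> carrier_vec n"
        using data_X(1) data(4) by (intro carrier_vecI) simp
      moreover have "(transpose_mat R *\<^sub>v \<delta> + transpose_mat A *\<^sub>v \<epsilon>) $ j
          = (\<Sum>i<k. R $$ (i, j) * d i u) + (\<Sum>i<kX. A $$ (i, j) * \<omega> i u)" if "j < n" for j
        using data_X(1) that unfolding T[OF data(4) that, symmetric] TX[OF data_X(1) that, symmetric]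
        by (intro index_add_vec) simp
      ultimately show ?thesis
        using veq[OF _ 1(3)] by simp
    qed
    have e5: "transpose_mat B *\<^sub>v \<epsilon> = 0\<^sub>v a \<longleftrightarrow> (\<forall>j<a. (\<Sum>i<kX. B $$ (i, j) * \<omega> i u) = 0)"
    proof -
      have "transpose_mat B *\<^sub>v \<epsilon> \<in> carrier_vec a"
        using data_X(2) by (intro carrier_vecI) simp
      then show ?thesis
        using veq[OF _ zero_carrier_vec, of _ a] TX[OF data_X(2)] by (simp del: index_mult_mat_vec)
    qed
    have e6: "transpose_mat P *\<^sub>v \<delta> + \<beta> = 0\<^sub>v m \<longleftrightarrow> (\<forall>j<m. (\<Sum>i<k. P $$ (i, j) * d i u) + \<beta> $ j = 0)"
    proof -
      have "transpose_mat P *\<^sub>v \<delta> + \<beta> \<in> carrier_vec m"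
        using 1(1) by (intro carrier_vecI) simp
      moreover have "(transpose_mat P *\<^sub>v \<delta> + \<beta>) $ j = (\<Sum>i<k. P $$ (i, j) * d i u) + \<beta> $ j" if "j < m" for j
        using 1(1) that unfolding T[OF data(1) that, symmetric] by (intro index_add_vec) simp
      ultimately show ?thesis
        using veq[OF _ zero_carrier_vec, of _ m] by simp
    qed
    have e7: "\<pi> \<bullet> \<delta> = - 1 \<longleftrightarrow> (\<Sum>i<k. \<pi> $ i * d i u) + 1 = 0"
      unfolding scalar_prod_sum[OF c(2)] by (auto simp: \<delta>_def)
    have e8: "transpose_mat Q *\<^sub>v \<delta> = 0\<^sub>v l \<longleftrightarrow> (\<forall>j<l. (\<Sum>i<k. Q $$ (i, j) * d i u) = 0)"
    proof -
      have "transpose_mat Q *\<^sub>v \<delta> \<in> carrier_vec l"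
        using data(3) by (intro carrier_vecI) simp
      then show ?thesis
        using veq[OF _ zero_carrier_vec, of _ l] T[OF data(3)] by (simp del: index_mult_mat_vec)
    qed
    have e9: "D *\<^sub>v \<alpha> - C *\<^sub>v \<beta> + e
        = vec kY (\<lambda>i. (\<Sum>j<h. D $$ (i, j) * u $ j) - (\<Sum>j<m. C $$ (i, j) * \<beta> $ j) + e $ i)"
    proof (rule eq_vecI)
      fix i assume "i < dim_vec (vec kY (\<lambda>i. (\<Sum>j<h. D $$ (i, j) * u $ j) - (\<Sum>j<m. C $$ (i, j) * \<beta> $ j) + e $ i))"
      then have i: "i < kY"
        by simp
      have "(\<Sum>j<h. D $$ (i, j) * \<alpha> $ j) = (\<Sum>j<h. D $$ (i, j) * u $ j)"
        by (simp add: \<alpha>_def vec_first_def)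
      then show "(D *\<^sub>v \<alpha> - C *\<^sub>v \<beta> + e) $ i
          = vec kY (\<lambda>i. (\<Sum>j<h. D $$ (i, j) * u $ j) - (\<Sum>j<m. C $$ (i, j) * \<beta> $ j) + e $ i) $ i"
        using i data_Y by (simp add: mult_mat_vec_index_sum[OF data_Y(2) c(1) i]
            mult_mat_vec_index_sum[OF data_Y(1) 1(1) i] del: index_mult_mat_vec)
    qed (use data_Y in simp)
    have e9c: "D *\<^sub>v \<alpha> - C *\<^sub>v \<beta> + e \<in> carrier_vec kY"
      unfolding e9 by simp
    have z: "w - 0\<^sub>v N = w" if "w \<in> carrier_vec N" for w :: "real vec" and N
      using that by (intro eq_vecI) auto
    have sys: "(0\<^sub>v k \<le>\<^bsub>dual_cone k K\<^esub> \<delta> \<and> 0\<^sub>v kX \<le>\<^bsub>dual_cone kX KX\<^esub> \<epsilon> \<and>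
        \<tau> = s \<bullet> \<delta> + c \<bullet> \<epsilon> \<and> transpose_mat R *\<^sub>v \<delta> + transpose_mat A *\<^sub>v \<epsilon> = p \<and>
        transpose_mat B *\<^sub>v \<epsilon> = 0\<^sub>v a \<and> transpose_mat P *\<^sub>v \<delta> + \<beta> = 0\<^sub>v m \<and> \<pi> \<bullet> \<delta> = - 1 \<and>
        transpose_mat Q *\<^sub>v \<delta> = 0\<^sub>v l \<and> 0\<^sub>v kY \<le>\<^bsub>KY\<^esub> D *\<^sub>v \<alpha> - C *\<^sub>v \<beta> + e) \<longleftrightarrow>
      (vec k (\<lambda>i. d i u) \<in> dual_cone k K \<and> vec kX (\<lambda>i. \<omega> i u) \<in> dual_cone kX KX \<and>
        \<tau> - ((\<Sum>i<k. s $ i * d i u) + (\<Sum>i<kX. c $ i * \<omega> i u)) = 0 \<and>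
        (\<forall>j<n. ((\<Sum>i<k. R $$ (i, j) * d i u) + (\<Sum>i<kX. A $$ (i, j) * \<omega> i u)) - p $ j = 0) \<and>
        (\<forall>j<a. (\<Sum>i<kX. B $$ (i, j) * \<omega> i u) = 0) \<and>
        (\<forall>j<m. (\<Sum>i<k. P $$ (i, j) * d i u) + \<beta> $ j = 0) \<and>
        (\<Sum>i<k. \<pi> $ i * d i u) + 1 = 0 \<and>
        (\<forall>j<l. (\<Sum>i<k. Q $$ (i, j) * d i u) = 0) \<and>
        vec kY (\<lambda>i. (\<Sum>j<h. D $$ (i, j) * u $ j) - (\<Sum>j<m. C $$ (i, j) * \<beta> $ j) + e $ i) \<in> KY)" (is "?S \<longleftrightarrow> _")
      unfolding e3 e4 e5 e6 e7 e8 conic_le_def z[OF c(2)] z[OF c(3)] z[OF e9c] unfolding e9 \<delta>_def \<epsilon>_def by (rule refl)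
    show ?case (is "?L = ?E")
      unfolding sys[symmetric]
    proof (rule iffI)
      assume *: "?S"
      show ?E
        by (intro bexI[OF _ c(1)] bexI[OF _ c(2)] bexI[OF _ c(3)] conjI[OF u] *)
    next
      assume ?E
      then show ?S
      proof (elim bexE conjE, goal_cases)
        case (1 \<alpha>' \<delta>' \<epsilon>')
        from uniq[OF 1(1-4)] have "\<alpha>' = \<alpha>" "\<delta>' = \<delta>" "\<epsilon>' = \<epsilon>"
          by simp_all
        then show ?case
          using 1(5-) by (intro conjI) simp_all
      qed
    qed
  qed
qed

subsection \<open>Saddle points and the conjugate function\<close>

lemma convex_set_vec_carrier: "convex_set_vec (carrier_vec n)"
  by (simp add: convex_set_vec_def)

lemma scalar_prod_comb_right:
  fixes p x y :: "real vec"
  assumes "p \<in> carrier_vec n" "x \<in> carrier_vec n" "y \<in> carrier_vec n"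
  shows "p \<bullet> ((1 - t) \<cdot>\<^sub>v x + t \<cdot>\<^sub>v y) = (1 - t) * (p \<bullet> x) + t * (p \<bullet> y)"
  using assms by (simp add: scalar_prod_add_distrib[of _ n])

lemma scalar_prod_comb_left:
  fixes p :: "real vec"
  assumes "p \<in> carrier_vec n" "q \<in> carrier_vec n" "x \<in> carrier_vec n"
  shows "((1 - t) \<cdot>\<^sub>v p + t \<cdot>\<^sub>v q) \<bullet> x = (1 - t) * (p \<bullet> x) + t * (q \<bullet> x)"
  using assms by (simp add: add_scalar_prod_distrib[of _ n])

text \<open>Each coordinate difference is at most the Euclidean distance, so summation costs a
  factor n; any finite constant suffices for continuity.\<close>

lemma scalar_prod_diff_le:
  assumes "x \<in> carrier_vec n" and b: "\<And>i. i < n \<Longrightarrow> \<bar>x $ i\<bar> \<le> b"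
  shows "p \<bullet> x - p' \<bullet> x \<le> (real n * b) * eucl_dist n p p'"
proof -
  have "p \<bullet> x - p' \<bullet> x = (\<Sum>i<n. (p $ i - p' $ i) * x $ i)"
    by (simp add: scalar_prod_sum[OF assms(1)] left_diff_distrib sum_subtractf)
  also have "\<dots> \<le> (\<Sum>i<n. eucl_dist n p p' * b)"
  proof (rule sum_mono)
    fix i assume "i \<in> {..<n}"
    then have "\<bar>(p $ i - p' $ i) * x $ i\<bar> \<le> eucl_dist n p p' * b"
      unfolding abs_mult using component_le_eucl_dist[of i n p p'] b[of i]
      by (intro mult_mono) auto
    then show "(p $ i - p' $ i) * x $ i \<le> eucl_dist n p p' * b"
      by linarith
  qed
  finally show ?thesis
    by (simp add: mult.commute mult.left_commute)
qed

locale compact_convex_concave =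
  fixes n m :: nat and X Y :: "real vec set" and \<psi> :: "real vec \<Rightarrow> real vec \<Rightarrow> real"
  assumes X: "X \<subseteq> carrier_vec n" "X \<noteq> {}" "convex_set_vec X" "compactin (eucl_top n) X"
    and Y: "Y \<subseteq> carrier_vec m" "Y \<noteq> {}" "convex_set_vec Y" "compactin (eucl_top m) Y"
    and saddle: "cont_convex_concave n X m Y \<psi>"
begin

abbreviation "TX \<equiv> subtopology (eucl_top n) X"
abbreviation "TY \<equiv> subtopology (eucl_top m) Y"
abbreviation "\<phi> \<equiv> conj_payoff \<psi>"
abbreviation "V \<equiv> conjugate_fun X Y \<psi>"

section \<open>The payoff in each variable separately\<close>

lemma topspaces: "topspace TX = X" "topspace TY = Y"
  using X(1) Y(1) by auto

lemma compact_TX: "compactin TX X" and compact_TY: "compactin TY Y"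
  using X(4) Y(4) by (simp_all add: compactin_subtopology)

lemma continuous_\<psi>_x: "y \<in> Y \<Longrightarrow> continuous_map TX euclideanreal (\<lambda>x. \<psi> x y)"
proof -
  assume y: "y \<in> Y"
  have "continuous_map TX (prod_topology TX TY) (\<lambda>x. (x, y))"
    unfolding continuous_map_pairwise comp_def using y topspaces(2) by simp
  moreover have "continuous_map (prod_topology TX TY) euclideanreal (\<lambda>(x, y). \<psi> x y)"
    using saddle unfolding cont_convex_concave_def by (elim conjE)
  ultimately show ?thesis
    using continuous_map_compose[of TX "prod_topology TX TY" "\<lambda>x. (x, y)"] by (force simp: comp_def)
qed

lemma continuous_\<psi>_y: "x \<in> X \<Longrightarrow> continuous_map TY euclideanreal (\<psi> x)"
proof -
  assume x: "x \<in> X"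
  have "continuous_map TY (prod_topology TX TY) (\<lambda>y. (x, y))"
    unfolding continuous_map_pairwise comp_def using x topspaces(1) by simp
  moreover have "continuous_map (prod_topology TX TY) euclideanreal (\<lambda>(x, y). \<psi> x y)"
    using saddle unfolding cont_convex_concave_def by (elim conjE)
  ultimately show ?thesis
    using continuous_map_compose[of TY "prod_topology TX TY" "\<lambda>y. (x, y)"] by (force simp: comp_def)
qed

lemma continuous_payoff_x: "y \<in> Y \<Longrightarrow> continuous_map TX euclideanreal (\<lambda>x. \<phi> p q x y)"
  unfolding conj_payoff_def
  by (intro continuous_map_diff continuous_map_add continuous_\<psi>_x
      continuous_map_from_subtopology[OF continuous_map_scalar_prod]) auto

lemma continuous_payoff_y: "x \<in> X \<Longrightarrow> continuous_map TY euclideanreal (\<phi> p q x)"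
  unfolding conj_payoff_def
  by (intro continuous_map_diff continuous_map_add continuous_\<psi>_y
      continuous_map_from_subtopology[OF continuous_map_scalar_prod]) auto

lemma convex_\<psi>: "\<lbrakk>y \<in> Y; x \<in> X; x' \<in> X; 0 \<le> t; t \<le> 1\<rbrakk>
    \<Longrightarrow> \<psi> ((1 - t) \<cdot>\<^sub>v x + t \<cdot>\<^sub>v x') y \<le> (1 - t) * \<psi> x y + t * \<psi> x' y"
  using saddle convex_fun_vecD[of X "\<lambda>x. \<psi> x y"] by (simp add: cont_convex_concave_def)

lemma concave_\<psi>: "\<lbrakk>x \<in> X; y \<in> Y; y' \<in> Y; 0 \<le> t; t \<le> 1\<rbrakk>
    \<Longrightarrow> (1 - t) * \<psi> x y + t * \<psi> x y' \<le> \<psi> x ((1 - t) \<cdot>\<^sub>v y + t \<cdot>\<^sub>v y')"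
  using saddle convex_fun_vecD[of Y "\<lambda>y. - \<psi> x y" y y' t] by (simp add: cont_convex_concave_def)

lemma concave_payoff_x:
  assumes "p \<in> carrier_vec n" "y \<in> Y"
  shows "concave_on_vec X (\<lambda>x. \<phi> p q x y)"
  unfolding concave_on_vec_def convex_fun_vec_def conj_payoff_def
proof (intro conjI X(3) ballI)
  fix x x' and t :: real assume x: "x \<in> X" "x' \<in> X" and t: "t \<in> {0..1}"
  have c: "x \<in> carrier_vec n" "x' \<in> carrier_vec n"
    using x X(1) by auto
  show "- (p \<bullet> ((1 - t) \<cdot>\<^sub>v x + t \<cdot>\<^sub>v x') + q \<bullet> y - \<psi> ((1 - t) \<cdot>\<^sub>v x + t \<cdot>\<^sub>v x') y)
    \<le> (1 - t) * - (p \<bullet> x + q \<bullet> y - \<psi> x y) + t * - (p \<bullet> x' + q \<bullet> y - \<psi> x' y)"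
    using convex_\<psi>[OF assms(2) x, of t] t
    unfolding scalar_prod_comb_right[OF assms(1) c] by (simp add: algebra_simps)
qed

lemma convex_payoff_y:
  assumes "q \<in> carrier_vec m" "x \<in> X"
  shows "convex_fun_vec Y (\<phi> p q x)"
  unfolding convex_fun_vec_def conj_payoff_def
proof (intro conjI Y(3) ballI)
  fix y y' and t :: real assume y: "y \<in> Y" "y' \<in> Y" and t: "t \<in> {0..1}"
  have c: "y \<in> carrier_vec m" "y' \<in> carrier_vec m"
    using y Y(1) by auto
  show "p \<bullet> x + q \<bullet> ((1 - t) \<cdot>\<^sub>v y + t \<cdot>\<^sub>v y') - \<psi> x ((1 - t) \<cdot>\<^sub>v y + t \<cdot>\<^sub>v y')
    \<le> (1 - t) * (p \<bullet> x + q \<bullet> y - \<psi> x y) + t * (p \<bullet> x + q \<bullet> y' - \<psi> x y')"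
    using concave_\<psi>[OF assms(2) y, of t] t
    unfolding scalar_prod_comb_right[OF assms(1) c] by (simp add: algebra_simps)
qed

lemma payoff_attains_inf:
  assumes "x \<in> X"
  shows "\<exists>y\<in>Y. (\<forall>y'\<in>Y. \<phi> p q x y \<le> \<phi> p q x y') \<and> (INF y\<in>Y. \<phi> p q x y) = \<phi> p q x y"
proof -
  have "continuous_map TY euclideanreal (\<lambda>y. - \<phi> p q x y)"
    using continuous_payoff_y[OF assms] by (rule continuous_map_minus)
  from compactin_attains_sup[OF compact_TY Y(2) this]
  obtain y where y: "y \<in> Y" "\<forall>y'\<in>Y. \<phi> p q x y \<le> \<phi> p q x y'"
    by auto
  moreover have "(INF y\<in>Y. \<phi> p q x y) = \<phi> p q x y"
    by (rule cInf_eq_minimum) (use y in auto)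
  ultimately show ?thesis
    by blast
qed

lemma payoff_attains_sup:
  assumes "y \<in> Y"
  shows "\<exists>x\<in>X. \<forall>x'\<in>X. \<phi> p q x' y \<le> \<phi> p q x y"
  using compactin_attains_sup[OF compact_TX X(2) continuous_payoff_x[OF assms]] .

text \<open>The max-min value is used as the level in two applications of
  \<open>minimax_point\<close>: once to find x, and once with the roles exchanged and the sign of
  the payoff reversed to find y.\<close>

theorem saddle_point:
  assumes p: "p \<in> carrier_vec n" and q: "q \<in> carrier_vec m"
  shows "\<exists>x\<in>X. \<exists>y\<in>Y. (\<forall>y'\<in>Y. V p q \<le> \<phi> p q x y') \<and> (\<forall>x'\<in>X. \<phi> p q x' y \<le> V p q)"
proof -
  define g where "g x = (INF y\<in>Y. \<phi> p q x y)" for x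
  have V: "V p q = (SUP x\<in>X. g x)"
    by (simp add: conjugate_fun_def g_def)
  have g_le: "g x \<le> \<phi> p q x y" if "x \<in> X" "y \<in> Y" for x y
    using payoff_attains_inf[OF that(1), of p q] that(2) unfolding g_def by auto
  have bound: "\<exists>x\<in>X. \<forall>x'\<in>X. g x' \<le> \<phi> p q x y" if y: "y \<in> Y" for y
    using payoff_attains_sup[OF y, of p q] g_le[OF _ y] by (meson order_trans)
  \<comment> \<open>A real supremum is informative only on a set bounded above; the maximum over x
    at any single y supplies a bound.\<close>
  have le_V: "g x \<le> V p q" if "x \<in> X" for x
  proof -
    obtain y where y: "y \<in> Y"
      using Y(2) by blast
    obtain x1 where "\<forall>x'\<in>X. g x' \<le> \<phi> p q x1 y"
      using bound[OF y] by blast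
    then have "bdd_above (g ` X)"
      by (auto intro: bdd_aboveI)
    then show ?thesis
      unfolding V using that by (rule cSUP_upper[rotated])
  qed
  \<comment> \<open>For a fixed y, a maximiser over X dominates every inner minimum, hence their
    supremum.\<close>
  have "\<exists>x\<in>X. V p q \<le> \<phi> p q x y" if y: "y \<in> Y" for y
  proof -
    obtain x where x: "x \<in> X" "\<forall>x'\<in>X. g x' \<le> \<phi> p q x y"
      using bound[OF y] by blast
    then have "V p q \<le> \<phi> p q x y"
      unfolding V by (intro cSUP_least[OF X(2)]) simp
    with x(1) show ?thesis
      by blast
  qed
  then obtain x where x: "x \<in> X" "\<forall>y\<in>Y. V p q \<le> \<phi> p q x y"
    using minimax_point[where T = TX and X = X and Y = Y and \<phi> = "\<phi> p q" and v = "V p q", OF compact_TX topspaces(1)[symmetric] Y(2)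
        continuous_payoff_x concave_payoff_x[OF p] convex_payoff_y[OF q]] by blast
  have "\<exists>y\<in>Y. - V p q \<le> - \<phi> p q x y" if x: "x \<in> X" for x
    using payoff_attains_inf[OF x, of p q] le_V[OF x] unfolding g_def by force
  moreover have "continuous_map TY euclideanreal (\<lambda>y. - \<phi> p q x y)" if "x \<in> X" for x
    using continuous_payoff_y[OF that] by (rule continuous_map_minus)
  moreover have "concave_on_vec Y (\<lambda>y. - \<phi> p q x y)" if "x \<in> X" for x
    using convex_payoff_y[OF q that] by (simp add: concave_on_vec_def)
  moreover have "convex_fun_vec X (\<lambda>x. - \<phi> p q x y)" if "y \<in> Y" for y
    using concave_payoff_x[OF p that] by (simp add: concave_on_vec_def)
  ultimately obtain y where y: "y \<in> Y" "\<forall>x\<in>X. - V p q \<le> - \<phi> p q x y"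
    using minimax_point[where T = TY and X = Y and Y = X and \<phi> = "\<lambda>y x. - \<phi> p q x y" and v = "- V p q",
        OF compact_TY topspaces(2)[symmetric] X(2)] by blast
  then have "\<forall>x\<in>X. \<phi> p q x y \<le> V p q"
    by simp
  then show ?thesis
    using x y(1) by blast
qed

text \<open>The saddle x has inner minimum at least V, while the saddle y caps every inner minimum
  at V; so the outer supremum is attained at this x.\<close>

lemma conjugate_attained_everywhere:
  assumes p: "p \<in> carrier_vec n" and q: "q \<in> carrier_vec m"
  shows "conjugate_attained X Y \<psi> p q"
proof -
  obtain x y where xy: "x \<in> X" "y \<in> Y" "\<And>y'. y' \<in> Y \<Longrightarrow> V p q \<le> \<phi> p q x y'"
    "\<And>x'. x' \<in> X \<Longrightarrow> \<phi> p q x' y \<le> V p q"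
    using saddle_point[OF p q] by blast
  have "V p q \<le> (INF y\<in>Y. \<phi> p q x y)"
    using xy(3) by (intro cINF_greatest Y(2))
  moreover have "(INF y\<in>Y. \<phi> p q x' y) \<le> V p q" if x': "x' \<in> X" for x'
  proof -
    obtain y' where "\<forall>z\<in>Y. \<phi> p q x' y' \<le> \<phi> p q x' z" "(INF y\<in>Y. \<phi> p q x' y) = \<phi> p q x' y'"
      using payoff_attains_inf[OF x'] by blast
    then show ?thesis
      using xy(2) xy(4)[OF x'] by force
  qed
  ultimately have "is_arg_max (\<lambda>x. INF y\<in>Y. \<phi> p q x y) (\<lambda>x. x \<in> X) x"
    using xy(1) unfolding is_arg_max_def by (meson not_less order_trans)
  moreover have "\<exists>y. is_arg_min (\<phi> p q x) (\<lambda>y. y \<in> Y) y" if "x \<in> X" for x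
    using payoff_attains_inf[OF that, of p q] unfolding is_arg_min_def by (meson not_less)
  ultimately show ?thesis
    unfolding conjugate_attained_def by blast
qed

text \<open>With x taken from the saddle point of (p, q) and y from that of (p', q'), both values
  are compared at the same pair (x, y). There \<psi> cancels and only linear terms remain.\<close>

lemma conjugate_diff_le:
  assumes "p \<in> carrier_vec n" "q \<in> carrier_vec m" "p' \<in> carrier_vec n" "q' \<in> carrier_vec m"
    and bX: "\<And>x i. \<lbrakk>x \<in> X; i < n\<rbrakk> \<Longrightarrow> \<bar>x $ i\<bar> \<le> b" and bY: "\<And>y i. \<lbrakk>y \<in> Y; i < m\<rbrakk> \<Longrightarrow> \<bar>y $ i\<bar> \<le> b'"
  shows "V p q - V p' q' \<le> (real n * b) * eucl_dist n p p' + (real m * b') * eucl_dist m q q'"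
proof -
  obtain x where x: "x \<in> X" "\<And>y'. y' \<in> Y \<Longrightarrow> V p q \<le> \<phi> p q x y'"
    using saddle_point[OF assms(1,2)] by blast
  obtain y where y: "y \<in> Y" "\<And>x'. x' \<in> X \<Longrightarrow> \<phi> p' q' x' y \<le> V p' q'"
    using saddle_point[OF assms(3,4)] by blast
  have c: "x \<in> carrier_vec n" "y \<in> carrier_vec m"
    using x(1) y(1) X(1) Y(1) by auto
  have "V p q - V p' q' \<le> \<phi> p q x y - \<phi> p' q' x y"
    using x(2)[OF y(1)] y(2)[OF x(1)] by linarith
  also have "\<dots> = (p \<bullet> x - p' \<bullet> x) + (q \<bullet> y - q' \<bullet> y)"
    by (simp add: conj_payoff_def)
  also have "\<dots> \<le> (real n * b) * eucl_dist n p p' + (real m * b') * eucl_dist m q q'"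
    by (intro add_mono scalar_prod_diff_le c bX[OF x(1)] bY[OF y(1)])
  finally show ?thesis .
qed

lemma continuous_conjugate:
  "continuous_map (prod_topology (eucl_top n) (eucl_top m)) euclideanreal (\<lambda>(p, q). V p q)"
  unfolding continuous_map_real_iff
proof (intro ballI allI impI)
  fix z and \<epsilon> :: real assume z: "z \<in> topspace (prod_topology (eucl_top n) (eucl_top m))" and \<epsilon>: "0 < \<epsilon>"
  obtain p q where pq: "z = (p, q)" "p \<in> carrier_vec n" "q \<in> carrier_vec m"
    using z by auto
  obtain b where b: "0 \<le> b" "\<And>x i. \<lbrakk>x \<in> X; i < n\<rbrakk> \<Longrightarrow> \<bar>x $ i\<bar> \<le> b"
    using compactin_eucl_component_bound[OF X(4)] by blast
  obtain b' where b': "0 \<le> b'" "\<And>y i. \<lbrakk>y \<in> Y; i < m\<rbrakk> \<Longrightarrow> \<bar>y $ i\<bar> \<le> b'"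
    using compactin_eucl_component_bound[OF Y(4)] by blast
  \<comment> \<open>The summand 1 keeps c positive even if both bounds or dimensions vanish. With r
    = \<epsilon>/(2c), each of the two terms stays below \<epsilon>/2.\<close>
  define c where "c = real n * b + real m * b' + 1"
  have c: "0 < c" "real n * b \<le> c" "real m * b' \<le> c"
    using b(1) b'(1) by (simp_all add: c_def add_nonneg_pos)
  define r where "r = \<epsilon> / (2 * c)"
  have r: "0 < r" "c * r = \<epsilon> / 2"
    using \<epsilon> c(1) by (simp_all add: r_def)
  define U where "U = {p' \<in> carrier_vec n. eucl_dist n p p' < r} \<times> {q' \<in> carrier_vec m. eucl_dist m q q' < r}"
  have "\<bar>V p' q' - V p q\<bar> < \<epsilon>" if "(p', q') \<in> U" for p' q'
  proof -
    have pq': "p' \<in> carrier_vec n" "q' \<in> carrier_vec m" "eucl_dist n p p' < r" "eucl_dist m q q' < r"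
      using that by (simp_all add: U_def)
    have sym: "eucl_dist n p' p = eucl_dist n p p'" "eucl_dist m q' q = eucl_dist m q q'"
      using Metric_space.commute[OF Metric_space_eucl] by blast+
    have "(real n * b) * eucl_dist n p p' \<le> c * eucl_dist n p p'" "(real m * b') * eucl_dist m q q' \<le> c * eucl_dist m q q'"
      using c by (auto intro!: mult_right_mono simp: eucl_dist_def L2_set_nonneg)
    moreover have "c * eucl_dist n p p' < c * r" "c * eucl_dist m q q' < c * r"
      using c(1) pq' by simp_all
    ultimately have "(real n * b) * eucl_dist n p p' + (real m * b') * eucl_dist m q q' < \<epsilon>"
      using r(2) by linarith
    then show ?thesis
      using conjugate_diff_le[OF pq(2,3) pq'(1,2) b(2) b'(2)] conjugate_diff_le[OF pq'(1,2) pq(2,3) b(2) b'(2)]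
      unfolding sym by linarith
  qed
  moreover have "z \<in> U"
    using pq r(1) by (simp add: U_def)
  moreover have "openin (prod_topology (eucl_top n) (eucl_top m)) U"
    unfolding U_def using pq by (simp add: openin_prod_Times_iff openin_eucl_ball)
  ultimately show "\<exists>U. openin (prod_topology (eucl_top n) (eucl_top m)) U \<and> z \<in> U \<and>
      (\<forall>y\<in>U. \<bar>(case y of (p, q) \<Rightarrow> V p q) - (case z of (p, q) \<Rightarrow> V p q)\<bar> < \<epsilon>)"
    using pq(1) by (intro exI[of _ U]) auto
qed

text \<open>x is optimal for the mixed p, while y and y' are optimal at the endpoints. The payoff at
  x and the mixture of y and y' is bounded by the mixture of payoffs through concavity of \<psi> in
  its second argument.\<close>

lemma conjugate_convex:
  assumes p: "p \<in> carrier_vec n" "p' \<in> carrier_vec n" and q: "q \<in> carrier_vec m" and t: "0 \<le> t" "t \<le> 1"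
  shows "V ((1 - t) \<cdot>\<^sub>v p + t \<cdot>\<^sub>v p') q \<le> (1 - t) * V p q + t * V p' q"
proof -
  let ?p = "(1 - t) \<cdot>\<^sub>v p + t \<cdot>\<^sub>v p'"
  have "?p \<in> carrier_vec n"
    using p by simp
  then obtain x where x: "x \<in> X" "\<And>y'. y' \<in> Y \<Longrightarrow> V ?p q \<le> \<phi> ?p q x y'"
    using saddle_point[OF _ q] by blast
  obtain y where y: "y \<in> Y" "\<And>x'. x' \<in> X \<Longrightarrow> \<phi> p q x' y \<le> V p q"
    using saddle_point[OF p(1) q] by blast
  obtain y' where y': "y' \<in> Y" "\<And>x'. x' \<in> X \<Longrightarrow> \<phi> p' q x' y' \<le> V p' q"
    using saddle_point[OF p(2) q] by blast
  let ?y = "(1 - t) \<cdot>\<^sub>v y + t \<cdot>\<^sub>v y'"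
  have c: "x \<in> carrier_vec n" "y \<in> carrier_vec m" "y' \<in> carrier_vec m"
    using x(1) y(1) y'(1) X(1) Y(1) by auto
  have "V ?p q \<le> \<phi> ?p q x ?y"
    by (rule x(2)) (rule convex_set_vecD[OF Y(3) y(1) y'(1) t])
  also have "\<dots> \<le> (1 - t) * \<phi> p q x y + t * \<phi> p' q x y'"
    unfolding conj_payoff_def scalar_prod_comb_left[OF p c(1)] scalar_prod_comb_right[OF q c(2,3)]
    using concave_\<psi>[OF x(1) y(1) y'(1) t] by (simp add: algebra_simps)
  also have "\<dots> \<le> (1 - t) * V p q + t * V p' q"
    using y(2)[OF x(1)] y'(2)[OF x(1)] t by (intro add_mono mult_left_mono) auto
  finally show ?thesis .
qed

text \<open>Mirror image: y comes from the mixed q, the points of X from the endpoints, and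
  convexity of \<psi> in its first argument is used.\<close>

lemma conjugate_concave:
  fixes p q q' :: "real vec"
  assumes p: "p \<in> carrier_vec n" and q: "q \<in> carrier_vec m" "q' \<in> carrier_vec m" and t: "0 \<le> t" "t \<le> 1"
  shows "(1 - t) * V p q + t * V p q' \<le> V p ((1 - t) \<cdot>\<^sub>v q + t \<cdot>\<^sub>v q')"
proof -
  let ?q = "(1 - t) \<cdot>\<^sub>v q + t \<cdot>\<^sub>v q'"
  have "?q \<in> carrier_vec m"
    using q by simp
  then obtain y where y: "y \<in> Y" "\<And>x'. x' \<in> X \<Longrightarrow> \<phi> p ?q x' y \<le> V p ?q"
    using saddle_point[OF p] by blast
  obtain x where x: "x \<in> X" "\<And>y'. y' \<in> Y \<Longrightarrow> V p q \<le> \<phi> p q x y'"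
    using saddle_point[OF p q(1)] by blast
  obtain x' where x': "x' \<in> X" "\<And>y'. y' \<in> Y \<Longrightarrow> V p q' \<le> \<phi> p q' x' y'"
    using saddle_point[OF p q(2)] by blast
  let ?x = "(1 - t) \<cdot>\<^sub>v x + t \<cdot>\<^sub>v x'"
  have c: "y \<in> carrier_vec m" "x \<in> carrier_vec n" "x' \<in> carrier_vec n"
    using x(1) y(1) x'(1) X(1) Y(1) by auto
  have "(1 - t) * V p q + t * V p q' \<le> (1 - t) * \<phi> p q x y + t * \<phi> p q' x' y"
    using x(2)[OF y(1)] x'(2)[OF y(1)] t by (intro add_mono mult_left_mono) auto
  also have "\<dots> \<le> \<phi> p ?q ?x y"
    unfolding conj_payoff_def scalar_prod_comb_left[OF q c(1)] scalar_prod_comb_right[OF p c(2,3)]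
    using convex_\<psi>[OF y(1) x(1) x'(1) t] by (simp add: algebra_simps)
  also have "\<dots> \<le> V p ?q"
    by (rule y(2)) (rule convex_set_vecD[OF X(3) x(1) x'(1) t])
  finally show ?thesis .
qed

lemma cont_convex_concave_conjugate: "cont_convex_concave n (carrier_vec n) m (carrier_vec m) V"
  unfolding cont_convex_concave_def
proof (intro conjI ballI)
  have "subtopology (eucl_top N) (carrier_vec N) = eucl_top N" for N
    using subtopology_topspace[of "eucl_top N"] by simp
  then show "continuous_map (prod_topology (subtopology (eucl_top n) (carrier_vec n))
      (subtopology (eucl_top m) (carrier_vec m))) euclideanreal (\<lambda>(p, q). V p q)"
    using continuous_conjugate by simp
  show "convex_fun_vec (carrier_vec n) (\<lambda>p. V p q)" if "q \<in> carrier_vec m" for q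
    unfolding convex_fun_vec_def using that
    by (auto intro!: convex_set_vec_carrier conjugate_convex)
  show "convex_fun_vec (carrier_vec m) (\<lambda>q. - V p q)" if "p \<in> carrier_vec n" for p
    unfolding convex_fun_vec_def
  proof (intro conjI ballI convex_set_vec_carrier)
    fix q q' :: "real vec" and t :: real assume "q \<in> carrier_vec m" "q' \<in> carrier_vec m" "t \<in> {0..1}"
    then show "- V p ((1 - t) \<cdot>\<^sub>v q + t \<cdot>\<^sub>v q') \<le> (1 - t) * - V p q + t * - V p q'"
      using conjugate_concave[OF that, of q q' t] by simp
  qed
qed

end

text \<open>Pair \<delta> and \<epsilon> with the two slacks and move the matrices across. The
  equations eliminate u and \<xi>, turn P f into -f.\<beta> and t \<pi> into -t, and merge the x
  terms into p.x. The bound covers all feasible (f, t, u) at once.\<close>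

lemma conjugate_weak_duality:
  fixes p \<beta> f u x \<xi> \<delta> \<epsilon> s c :: "real vec"
  assumes data_X: "A \<in> carrier_mat kX n" "B \<in> carrier_mat kX a" "c \<in> carrier_vec kX"
    and data: "P \<in> carrier_mat k m" "\<pi> \<in> carrier_vec k" "Q \<in> carrier_mat k l"
      "R \<in> carrier_mat k n" "s \<in> carrier_vec k"
    and dual: "\<delta> \<in> dual_cone k K" "\<epsilon> \<in> dual_cone kX KX"
      "transpose_mat R *\<^sub>v \<delta> + transpose_mat A *\<^sub>v \<epsilon> = p" "transpose_mat B *\<^sub>v \<epsilon> = 0\<^sub>v a"
      "transpose_mat P *\<^sub>v \<delta> + \<beta> = 0\<^sub>v m" "\<pi> \<bullet> \<delta> = - 1" "transpose_mat Q *\<^sub>v \<delta> = 0\<^sub>v l"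
      "\<beta> \<in> carrier_vec m"
    and primal: "x \<in> carrier_vec n" "\<xi> \<in> carrier_vec a" "A *\<^sub>v x + B *\<^sub>v \<xi> \<le>\<^bsub>KX\<^esub> c"
      "f \<in> carrier_vec m" "u \<in> carrier_vec l" "P *\<^sub>v f + t \<cdot>\<^sub>v \<pi> + Q *\<^sub>v u + R *\<^sub>v x \<le>\<^bsub>K\<^esub> s"
  shows "p \<bullet> x - (s \<bullet> \<delta> + c \<bullet> \<epsilon>) \<le> f \<bullet> \<beta> + t"
proof -
  have d: "\<delta> \<in> carrier_vec k" "\<epsilon> \<in> carrier_vec kX"
    using dual(1,2) by (auto dest: dual_cone_carrier)
  have mv: "P *\<^sub>v f \<in> carrier_vec k" "Q *\<^sub>v u \<in> carrier_vec k" "R *\<^sub>v x \<in> carrier_vec k" "t \<cdot>\<^sub>v \<pi> \<in> carrier_vec k"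
    "A *\<^sub>v x \<in> carrier_vec kX" "B *\<^sub>v \<xi> \<in> carrier_vec kX"
    using data data_X primal by auto
  have tv: "transpose_mat R *\<^sub>v \<delta> \<in> carrier_vec n" "transpose_mat A *\<^sub>v \<epsilon> \<in> carrier_vec n"
    "transpose_mat P *\<^sub>v \<delta> \<in> carrier_vec m"
    using data data_X d by auto
  have "0 \<le> \<delta> \<bullet> (s - (P *\<^sub>v f + t \<cdot>\<^sub>v \<pi> + Q *\<^sub>v u + R *\<^sub>v x))"
    using dual_coneD[OF dual(1)] primal(6) by (simp add: conic_le_def)
  also have "\<dots> = \<delta> \<bullet> s - (\<delta> \<bullet> (P *\<^sub>v f) + t * (\<delta> \<bullet> \<pi>) + \<delta> \<bullet> (Q *\<^sub>v u) + \<delta> \<bullet> (R *\<^sub>v x))"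
    using d(1) data(2) by (simp only: scalar_prod_minus_distrib[OF d(1) data(5)] scalar_prod_add_distrib[OF d(1)]
        mv add_carrier_vec scalar_prod_smult_right carrier_vecD)
  also have "\<delta> \<bullet> (P *\<^sub>v f) = - (f \<bullet> \<beta>)"
  proof -
    have "0 = (transpose_mat P *\<^sub>v \<delta> + \<beta>) \<bullet> f"
      unfolding dual(5) using primal(4) by simp
    also have "\<dots> = \<delta> \<bullet> (P *\<^sub>v f) + f \<bullet> \<beta>"
      unfolding add_scalar_prod_distrib[OF tv(3) dual(8) primal(4)]
        transpose_vec_mult_scalar[OF data(1) primal(4) d(1)] comm_scalar_prod[OF dual(8) primal(4)] ..
    finally show ?thesis
      by simp
  qed
  also have "\<delta> \<bullet> \<pi> = - 1"
    using dual(6) comm_scalar_prod[OF data(2) d(1)] by simp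
  also have "\<delta> \<bullet> (Q *\<^sub>v u) = 0"
    unfolding transpose_vec_mult_scalar[OF data(3) primal(5) d(1), symmetric] dual(7) using primal(5) by simp
  also have "\<delta> \<bullet> s = s \<bullet> \<delta>"
    by (rule comm_scalar_prod[OF d(1) data(5)])
  finally have 1: "\<delta> \<bullet> (R *\<^sub>v x) \<le> s \<bullet> \<delta> + f \<bullet> \<beta> + t"
    by simp
  have "0 \<le> \<epsilon> \<bullet> (c - (A *\<^sub>v x + B *\<^sub>v \<xi>))"
    using dual_coneD[OF dual(2)] primal(3) by (simp add: conic_le_def)
  also have "\<dots> = \<epsilon> \<bullet> c - (\<epsilon> \<bullet> (A *\<^sub>v x) + \<epsilon> \<bullet> (B *\<^sub>v \<xi>))"
    by (simp only: scalar_prod_minus_distrib[OF d(2) data_X(3)] scalar_prod_add_distrib[OF d(2)] mv add_carrier_vec)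
  also have "\<epsilon> \<bullet> (B *\<^sub>v \<xi>) = 0"
    unfolding transpose_vec_mult_scalar[OF data_X(2) primal(2) d(2), symmetric] dual(4) using primal(2) by simp
  also have "\<epsilon> \<bullet> c = c \<bullet> \<epsilon>"
    by (rule comm_scalar_prod[OF d(2) data_X(3)])
  finally have 2: "\<epsilon> \<bullet> (A *\<^sub>v x) \<le> c \<bullet> \<epsilon>"
    by simp
  have "p \<bullet> x = \<delta> \<bullet> (R *\<^sub>v x) + \<epsilon> \<bullet> (A *\<^sub>v x)"
    unfolding dual(3)[symmetric] add_scalar_prod_distrib[OF tv(1,2) primal(1)]
      transpose_vec_mult_scalar[OF data(4) primal(1) d(1)] transpose_vec_mult_scalar[OF data_X(1) primal(1) d(2)] ..
  with 1 2 show ?thesis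
    by simp
qed

theorem mainTheorem10:
  fixes \<K> :: "real vec set set"
    and n m k kX kY l a h :: nat
    and X Y K KX KY :: "real vec set"
    and A B C D P Q R :: "real mat"
    and c e s \<pi> :: "real vec"
    and \<psi> :: "real vec \<Rightarrow> real vec \<Rightarrow> real"
  assumes family: "cone_family \<K>"
    and cone_X: "KX \<in> \<K>" "KX \<subseteq> carrier_vec kX"
    and cone_Y: "KY \<in> \<K>" "KY \<subseteq> carrier_vec kY"
    and cone_\<psi>: "K \<in> \<K>" "K \<subseteq> carrier_vec k"
    and data_X: "A \<in> carrier_mat kX n" "B \<in> carrier_mat kX a" "c \<in> carrier_vec kX"
    and data_Y: "C \<in> carrier_mat kY m" "D \<in> carrier_mat kY h" "e \<in> carrier_vec kY"
    and data_\<psi>: "P \<in> carrier_mat k m" "\<pi> \<in> carrier_vec k" "Q \<in> carrier_mat k l"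
      "R \<in> carrier_mat k n" "s \<in> carrier_vec k"
    and set_X: "X \<subseteq> carrier_vec n" "X \<noteq> {}" "convex_set_vec X" "compactin (eucl_top n) X"
    and set_Y: "Y \<subseteq> carrier_vec m" "Y \<noteq> {}" "convex_set_vec Y" "compactin (eucl_top m) Y"
    and repr_X:
      "X = {x \<in> carrier_vec n. \<exists>\<xi>\<in>carrier_vec a. A *\<^sub>v x + B *\<^sub>v \<xi> \<le>\<^bsub>KX\<^esub> c}"
      "ess_strictly_feasible KX (A @\<^sub>c B) c"
    and repr_Y:
      "Y = {y \<in> carrier_vec m. \<exists>\<eta>\<in>carrier_vec h. C *\<^sub>v y + D *\<^sub>v \<eta> \<le>\<^bsub>KY\<^esub> e}"
      "ess_strictly_feasible KY (C @\<^sub>c D) e"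
    and dual_Y:
      \<comment> \<open>the constraint $D^T\lambda \leq 0$, $-D^T\lambda \leq 0$, $-\lambda \leq_{K_Y^*} 0$\<close>
      "ess_strictly_feasible (orthant (h + h) \<times>\<^sub>v dual_cone kY KY)
         ((transpose_mat D @\<^sub>r - transpose_mat D) @\<^sub>r - 1\<^sub>m kY) (0\<^sub>v (h + h + kY))"
    and saddle: "cont_convex_concave n X m Y \<psi>"
    and repr_\<psi>:
      "inf_represents X Y \<psi> m l
         (\<lambda>f t u x. P *\<^sub>v f + t \<cdot>\<^sub>v \<pi> + Q *\<^sub>v u + R *\<^sub>v x \<le>\<^bsub>K\<^esub> s)"
      "\<forall>x\<in>X. ess_strictly_feasible K (P @\<^sub>c mat_of_cols k [\<pi>] @\<^sub>c Q) (s - R *\<^sub>v x)"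
  shows
    "(\<forall>p\<in>carrier_vec n. \<forall>q\<in>carrier_vec m. conjugate_attained X Y \<psi> p q) \<and>
     cont_convex_concave n (carrier_vec n) m (carrier_vec m) (conjugate_fun X Y \<psi>) \<and>
     K_representable \<K> n (carrier_vec n) m (carrier_vec m) (conjugate_fun X Y \<psi>) \<and>
     (let Sys = (\<lambda>\<beta> \<tau> \<alpha> \<delta> \<epsilon> p.
            0\<^sub>v k \<le>\<^bsub>dual_cone k K\<^esub> \<delta> \<and> 0\<^sub>v kX \<le>\<^bsub>dual_cone kX KX\<^esub> \<epsilon> \<and>
            \<tau> = s \<bullet> \<delta> + c \<bullet> \<epsilon> \<and>
            transpose_mat R *\<^sub>v \<delta> + transpose_mat A *\<^sub>v \<epsilon> = p \<and>
            transpose_mat B *\<^sub>v \<epsilon> = 0\<^sub>v a \<and>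
            transpose_mat P *\<^sub>v \<delta> + \<beta> = 0\<^sub>v m \<and>
            \<pi> \<bullet> \<delta> = - 1 \<and>
            transpose_mat Q *\<^sub>v \<delta> = 0\<^sub>v l \<and>
            0\<^sub>v kY \<le>\<^bsub>KY\<^esub> D *\<^sub>v \<alpha> - C *\<^sub>v \<beta> + e)
      in conic_system \<K> m (h + (k + kX)) n
           (\<lambda>\<beta> \<tau> u p. \<exists>\<alpha>\<in>carrier_vec h. \<exists>\<delta>\<in>carrier_vec k. \<exists>\<epsilon>\<in>carrier_vec kX.
              u = \<alpha> @\<^sub>v \<delta> @\<^sub>v \<epsilon> \<and> Sys \<beta> \<tau> \<alpha> \<delta> \<epsilon> p) \<and>
         (\<forall>p\<in>carrier_vec n. \<forall>q\<in>carrier_vec m.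
            is_minimum
              {\<beta> \<bullet> q + \<tau> | \<beta> \<tau> \<alpha> \<delta> \<epsilon>.
                 \<beta> \<in> carrier_vec m \<and> \<alpha> \<in> carrier_vec h \<and> \<delta> \<in> carrier_vec k \<and>
                 \<epsilon> \<in> carrier_vec kX \<and> Sys \<beta> \<tau> \<alpha> \<delta> \<epsilon> p}
              (conjugate_fun X Y \<psi> p q)))"
proof -
  interpret compact_convex_concave n m X Y \<psi>
    by unfold_locales (fact set_X set_Y saddle)+
  define Sys where "Sys \<beta> \<tau> \<alpha> \<delta> \<epsilon> p \<longleftrightarrow>
      0\<^sub>v k \<le>\<^bsub>dual_cone k K\<^esub> \<delta> \<and> 0\<^sub>v kX \<le>\<^bsub>dual_cone kX KX\<^esub> \<epsilon> \<and>
      \<tau> = s \<bullet> \<delta> + c \<bullet> \<epsilon> \<and>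
      transpose_mat R *\<^sub>v \<delta> + transpose_mat A *\<^sub>v \<epsilon> = p \<and>
      transpose_mat B *\<^sub>v \<epsilon> = 0\<^sub>v a \<and>
      transpose_mat P *\<^sub>v \<delta> + \<beta> = 0\<^sub>v m \<and>
      \<pi> \<bullet> \<delta> = - 1 \<and>
      transpose_mat Q *\<^sub>v \<delta> = 0\<^sub>v l \<and>
      0\<^sub>v kY \<le>\<^bsub>KY\<^esub> D *\<^sub>v \<alpha> - C *\<^sub>v \<beta> + e" for \<beta> \<tau> \<alpha> \<delta> \<epsilon> p
  define vals where "vals p q = {\<beta> \<bullet> q + \<tau> | \<beta> \<tau> \<alpha> \<delta> \<epsilon>. \<beta> \<in> carrier_vec m \<and> \<alpha> \<in> carrier_vec h \<and>
      \<delta> \<in> carrier_vec k \<and> \<epsilon> \<in> carrier_vec kX \<and> Sys \<beta> \<tau> \<alpha> \<delta> \<epsilon> p}" for p q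
  define F where "F \<beta> \<tau> u p \<longleftrightarrow> (\<exists>\<alpha>\<in>carrier_vec h. \<exists>\<delta>\<in>carrier_vec k. \<exists>\<epsilon>\<in>carrier_vec kX.
      u = \<alpha> @\<^sub>v \<delta> @\<^sub>v \<epsilon> \<and> Sys \<beta> \<tau> \<alpha> \<delta> \<epsilon> p)" for \<beta> \<tau> u p
  have regular: "regular_cone k K" "regular_cone kX KX"
    using cone_family_regular[OF family] cone_\<psi> cone_X by auto
  have zero_le: "0\<^sub>v N \<le>\<^bsub>L\<^esub> v \<longleftrightarrow> v \<in> L" if "v \<in> carrier_vec N" for N L v
  proof -
    have "v - 0\<^sub>v N = v"
      using that by (intro eq_vecI) auto
    then show ?thesis
      by (simp add: conic_le_def)
  qed
  \<comment> \<open>The target system writes the constraint of Y with \<alpha> in place of -\<eta>;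
    as \<eta> ranges over a whole space, both describe membership of y in Y.\<close>
  have Y_mem: "0\<^sub>v kY \<le>\<^bsub>KY\<^esub> D *\<^sub>v (- \<eta>) - C *\<^sub>v y + e \<longleftrightarrow> C *\<^sub>v y + D *\<^sub>v \<eta> \<le>\<^bsub>KY\<^esub> e"
    if \<eta>: "\<eta> \<in> carrier_vec h" and y: "y \<in> carrier_vec m" for \<eta> y
  proof -
    have dim: "dim_vec (C *\<^sub>v y) = kY" "dim_vec (D *\<^sub>v \<eta>) = kY" "dim_vec (D *\<^sub>v (- \<eta>)) = kY" "dim_vec e = kY"
      using data_Y by auto
    have "D *\<^sub>v (- \<eta>) - C *\<^sub>v y + e = e - (C *\<^sub>v y + D *\<^sub>v \<eta>)"
    proof (rule eq_vecI)
      fix i assume "i < dim_vec (e - (C *\<^sub>v y + D *\<^sub>v \<eta>))"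
      then have i: "i < kY"
        using dim by simp
      have "(D *\<^sub>v (- \<eta>)) $ i = - (D *\<^sub>v \<eta>) $ i"
        unfolding mult_mat_vec_index_sum[OF data_Y(2) uminus_carrier_vec[THEN iffD2, OF \<eta>] i]
          mult_mat_vec_index_sum[OF data_Y(2) \<eta> i]
        using \<eta> by (simp add: sum_negf)
      then show "(D *\<^sub>v (- \<eta>) - C *\<^sub>v y + e) $ i = (e - (C *\<^sub>v y + D *\<^sub>v \<eta>)) $ i"
        using i dim by (simp del: index_mult_mat_vec)
    qed (simp add: dim del: dim_mult_mat_vec)
    moreover have "D *\<^sub>v (- \<eta>) - C *\<^sub>v y + e \<in> carrier_vec kY"
      using dim(4) by (intro carrier_vecI) simp
    ultimately show ?thesis
      unfolding zero_le[OF \<open>D *\<^sub>v (- \<eta>) - C *\<^sub>v y + e \<in> carrier_vec kY\<close>] by (simp add: conic_le_def)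
  qed
  have \<psi>_le: "\<psi> x y \<le> f \<bullet> y + t"
    if "x \<in> X" "y \<in> Y" "f \<in> carrier_vec m" "u \<in> carrier_vec l"
      "P *\<^sub>v f + t \<cdot>\<^sub>v \<pi> + Q *\<^sub>v u + R *\<^sub>v x \<le>\<^bsub>K\<^esub> s" for x y f t u
  proof -
    have "ereal (\<psi> x y) \<le> ereal (f \<bullet> y + t)"
      using repr_\<psi>(1) that unfolding inf_represents_def by (auto intro!: Inf_lower)
    then show ?thesis
      by simp
  qed
  \<comment> \<open>A lower bound common to all feasible (f, t, u) is a lower bound for the infimum,
    whether or not it is attained.\<close>
  have \<psi>_ge: "w \<le> \<psi> x y"
    if "x \<in> X" "y \<in> Y" and ge: "\<And>f t u. \<lbrakk>f \<in> carrier_vec m; u \<in> carrier_vec l;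
      P *\<^sub>v f + t \<cdot>\<^sub>v \<pi> + Q *\<^sub>v u + R *\<^sub>v x \<le>\<^bsub>K\<^esub> s\<rbrakk> \<Longrightarrow> w \<le> f \<bullet> y + t" for x y w
  proof -
    have "ereal w \<le> ereal (\<psi> x y)"
      using repr_\<psi>(1) that(1,2) ge unfolding inf_represents_def by (auto intro!: Inf_greatest)
    then show ?thesis
      by simp
  qed
  have minimum: "is_minimum (vals p q) (V p q)" if p: "p \<in> carrier_vec n" and q: "q \<in> carrier_vec m" for p q
  proof -
    obtain x y where xy: "x \<in> X" "y \<in> Y" "\<And>y'. y' \<in> Y \<Longrightarrow> V p q \<le> \<phi> p q x y'"
      "\<And>x'. x' \<in> X \<Longrightarrow> \<phi> p q x' y \<le> V p q"
      using saddle_point[OF p q] by blast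
    \<comment> \<open>One fixed x, from the saddle point, serves every feasible \<beta>: as \<beta>
      lies in Y, V is at most the payoff at (x, \<beta>), which weak duality bounds by the
      objective.\<close>
    have lower: "V p q \<le> w" if w: "w \<in> vals p q" for w
    proof -
      obtain \<beta> \<tau> \<alpha> \<delta> \<epsilon> where eq: "w = \<beta> \<bullet> q + \<tau>"
        and c: "\<beta> \<in> carrier_vec m" "\<alpha> \<in> carrier_vec h" "\<delta> \<in> carrier_vec k" "\<epsilon> \<in> carrier_vec kX"
        and sys: "Sys \<beta> \<tau> \<alpha> \<delta> \<epsilon> p"
        using w unfolding vals_def mem_Collect_eq by (elim exE conjE) (rule that)
      have \<alpha>: "- \<alpha> \<in> carrier_vec h" "- (- \<alpha>) = \<alpha>"
        using c(2) by auto
      have "C *\<^sub>v \<beta> + D *\<^sub>v (- \<alpha>) \<le>\<^bsub>KY\<^esub> e"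
        using sys Y_mem[OF \<alpha>(1) c(1)] unfolding Sys_def \<alpha>(2) by blast
      then have \<beta>: "\<beta> \<in> Y"
        unfolding repr_Y(1) using c(1) \<alpha>(1) by blast
      obtain \<xi> where x: "x \<in> carrier_vec n" "\<xi> \<in> carrier_vec a" "A *\<^sub>v x + B *\<^sub>v \<xi> \<le>\<^bsub>KX\<^esub> c"
        using xy(1) unfolding repr_X(1) by blast
      have d: "\<delta> \<in> dual_cone k K" "\<epsilon> \<in> dual_cone kX KX"
        "transpose_mat R *\<^sub>v \<delta> + transpose_mat A *\<^sub>v \<epsilon> = p" "transpose_mat B *\<^sub>v \<epsilon> = 0\<^sub>v a"
        "transpose_mat P *\<^sub>v \<delta> + \<beta> = 0\<^sub>v m" "\<pi> \<bullet> \<delta> = - 1" "transpose_mat Q *\<^sub>v \<delta> = 0\<^sub>v l"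
        "\<tau> = s \<bullet> \<delta> + c \<bullet> \<epsilon>"
        using sys unfolding Sys_def zero_le[OF c(3)] zero_le[OF c(4)] by blast+
      have "p \<bullet> x - (s \<bullet> \<delta> + c \<bullet> \<epsilon>) \<le> \<psi> x \<beta>"
        by (rule \<psi>_ge[OF xy(1) \<beta>]) (rule conjugate_weak_duality[OF data_X data_\<psi> d(1-7) c(1) x])
      then have "\<phi> p q x \<beta> \<le> \<beta> \<bullet> q + \<tau>"
        using comm_scalar_prod[OF c(1) q] d(8) by (simp add: conj_payoff_def)
      then show ?thesis
        using xy(3)[OF \<beta>] eq by linarith
    qed
    obtain \<eta> where y: "y \<in> carrier_vec m" "\<eta> \<in> carrier_vec h" "C *\<^sub>v y + D *\<^sub>v \<eta> \<le>\<^bsub>KY\<^esub> e"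
      using xy(2) unfolding repr_Y(1) by blast
    \<comment> \<open>At the saddle y every p.x - \<psi>(x, y) is at most V - q.y, so this number is
      an admissible bound v for the primal problem.\<close>
    have "\<exists>\<delta>\<in>dual_cone k K. \<exists>\<epsilon>\<in>dual_cone kX KX.
      transpose_mat R *\<^sub>v \<delta> + transpose_mat A *\<^sub>v \<epsilon> = p \<and> transpose_mat B *\<^sub>v \<epsilon> = 0\<^sub>v a \<and>
      transpose_mat P *\<^sub>v \<delta> + y = 0\<^sub>v m \<and> \<pi> \<bullet> \<delta> = - 1 \<and> transpose_mat Q *\<^sub>v \<delta> = 0\<^sub>v l \<and>
      s \<bullet> \<delta> + c \<bullet> \<epsilon> \<le> V p q - q \<bullet> y"
    proof (rule sup_dual_attained[OF regular data_X data_\<psi> repr_X repr_\<psi>(2) p y(1)])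
      show "p \<bullet> x' - (f \<bullet> y + t) \<le> V p q - q \<bullet> y"
        if "f \<in> carrier_vec m" "u \<in> carrier_vec l" "x' \<in> X"
          "P *\<^sub>v f + t \<cdot>\<^sub>v \<pi> + Q *\<^sub>v u + R *\<^sub>v x' \<le>\<^bsub>K\<^esub> s" for f t u x'
        using \<psi>_le[OF that(3) xy(2) that(1,2,4)] xy(4)[OF that(3)] by (simp add: conj_payoff_def)
    qed
    then obtain \<delta> \<epsilon> where d: "\<delta> \<in> dual_cone k K" "\<epsilon> \<in> dual_cone kX KX"
      "transpose_mat R *\<^sub>v \<delta> + transpose_mat A *\<^sub>v \<epsilon> = p" "transpose_mat B *\<^sub>v \<epsilon> = 0\<^sub>v a"
      "transpose_mat P *\<^sub>v \<delta> + y = 0\<^sub>v m" "\<pi> \<bullet> \<delta> = - 1" "transpose_mat Q *\<^sub>v \<delta> = 0\<^sub>v l"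
      and le: "s \<bullet> \<delta> + c \<bullet> \<epsilon> \<le> V p q - q \<bullet> y"
      by (elim bexE conjE) (rule that)
    have dc: "\<delta> \<in> carrier_vec k" "\<epsilon> \<in> carrier_vec kX"
      using d(1,2) by (auto dest: dual_cone_carrier)
    have "Sys y (s \<bullet> \<delta> + c \<bullet> \<epsilon>) (- \<eta>) \<delta> \<epsilon> p"
      unfolding Sys_def zero_le[OF dc(1)] zero_le[OF dc(2)] Y_mem[OF y(2,1)]
      by (intro conjI d y(3) refl)
    then have mem: "y \<bullet> q + (s \<bullet> \<delta> + c \<bullet> \<epsilon>) \<in> vals p q"
      unfolding vals_def mem_Collect_eq using y(1,2) dc by (intro exI conjI) auto
    \<comment> \<open>Duality gives an upper bound and \<open>lower\<close> the matching lower
      bound, so this dual solution attains the value.\<close>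
    have "y \<bullet> q + (s \<bullet> \<delta> + c \<bullet> \<epsilon>) = V p q"
      using lower[OF mem] le comm_scalar_prod[OF y(1) q] by linarith
    then show ?thesis
      using mem lower by (auto simp: is_minimum_def)
  qed
  have system: "conic_system \<K> m (h + (k + kX)) n F"
    unfolding F_def Sys_def
    by (rule conjugate_conic_system[OF family cone_X cone_Y cone_\<psi> data_X data_Y data_\<psi>])
  have F_vals: "{ereal (f \<bullet> q + t) | f t u. f \<in> carrier_vec m \<and> u \<in> carrier_vec (h + (k + kX)) \<and> F f t u p}
      = ereal ` vals p q" for p q
  proof (intro equalityI subsetI)
    fix z assume "z \<in> {ereal (f \<bullet> q + t) | f t u. f \<in> carrier_vec m \<and> u \<in> carrier_vec (h + (k + kX)) \<and> F f t u p}"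
    then show "z \<in> ereal ` vals p q"
      unfolding F_def vals_def by blast
  next
    fix z assume "z \<in> ereal ` vals p q"
    then obtain \<beta> \<tau> \<alpha> \<delta> \<epsilon> where z: "z = ereal (\<beta> \<bullet> q + \<tau>)" "\<beta> \<in> carrier_vec m" "\<alpha> \<in> carrier_vec h"
      "\<delta> \<in> carrier_vec k" "\<epsilon> \<in> carrier_vec kX" "Sys \<beta> \<tau> \<alpha> \<delta> \<epsilon> p"
      unfolding vals_def by blast
    then have "\<alpha> @\<^sub>v \<delta> @\<^sub>v \<epsilon> \<in> carrier_vec (h + (k + kX))" "F \<beta> \<tau> (\<alpha> @\<^sub>v \<delta> @\<^sub>v \<epsilon>) p"
      unfolding F_def by auto
    then show "z \<in> {ereal (f \<bullet> q + t) | f t u. f \<in> carrier_vec m \<and> u \<in> carrier_vec (h + (k + kX)) \<and> F f t u p}"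
      using z(1,2) by blast
  qed
  have "inf_represents (carrier_vec n) (carrier_vec m) V m (h + (k + kX)) F"
    unfolding inf_represents_def F_vals
  proof (intro ballI)
    fix p q :: "real vec" assume "p \<in> carrier_vec n" "q \<in> carrier_vec m"
    \<comment> \<open>An attained minimum is also the infimum in the extended reals, which is the
      form \<open>inf_represents\<close> asks for.\<close>
    then have "V p q \<in> vals p q" "\<And>w. w \<in> vals p q \<Longrightarrow> V p q \<le> w"
      using minimum unfolding is_minimum_def by blast+
    then show "ereal (V p q) = Inf (ereal ` vals p q)"
      by (intro antisym Inf_greatest Inf_lower) auto
  qed
  then have "K_representable \<K> n (carrier_vec n) m (carrier_vec m) V"
    unfolding K_representable_def using cont_convex_concave_conjugate system by blast
  then show ?thesis
    using conjugate_attained_everywhere cont_convex_concave_conjugate system minimum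
    unfolding Let_def F_def vals_def Sys_def by (intro conjI ballI)
qed

end
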